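(* For any $k\in\mathbb{N}$, there exist a natural number $n$ and a sequence of graphs $K_n\rightarrow G^{(1)}\rightarrow\cdots\rightarrow G^{(k)}$, each obtained from the previous one by a $\Delta Y$-move, such that $\mathrm{cr}(K_n)>\mathrm{cr}(G^{(1)})>\cdots>\mathrm{cr}(G^{(k)})$.
   Context: $K_n$ is the complete graph on $n$ vertices. A drawing of a graph is a continuous map from the graph (viewed as a topological 1-complex) to the plane $\mathbb{R}^2$ whose only multiple points are finitely many transversal double points (crossings), none at images of vertices. The crossing number $\mathrm{cr}(G)$ of a graph $G$ is the minimum number of crossings over all drawings of $G$. A $\Delta Y$-move on a $3$-cycle with vertices $v_1,v_2,v_3$ of a graph removes the three edges $v_1v_2$, $v_2v_3$, $v_3v_1$, adds a new vertex $v$, and adds the three edges $vv_1$, $vv_2$, $vv_3$. *)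

theory Defs
  imports "HOL-Analysis.Analysis"
begin

datatype 'a ugraph = UGraph (verts: "'a set") (edges: "'a set set")

definition simple_graph :: "'a ugraph \<Rightarrow> bool" where
  "simple_graph G \<longleftrightarrow> finite (verts G) \<and> (\<forall>e\<in>edges G. e \<subseteq> verts G \<and> card e = 2)"

definition complete_graph :: "nat \<Rightarrow> nat ugraph" where
  "complete_graph n = UGraph {1..n} {e. e \<subseteq> {1..n} \<and> card e = 2}"

definition delta_Y_move :: "'a ugraph \<Rightarrow> 'a ugraph \<Rightarrow> bool" where
  "delta_Y_move G H \<longleftrightarrow>
     (\<exists>v1 v2 v3 v.
        v1 \<noteq> v2 \<and> v2 \<noteq> v3 \<and> v3 \<noteq> v1 \<and>
        {v1, v2} \<in> edges G \<and> {v2, v3} \<in> edges G \<and> {v3, v1} \<in> edges G \<and>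
        v \<notin> verts G \<and>
        H = UGraph (insert v (verts G))
              ((edges G - {{v1, v2}, {v2, v3}, {v3, v1}}) \<union> {{v, v1}, {v, v2}, {v, v3}}))"

text \<open>As a set, the topological 1-complex of a graph is the disjoint union of its vertices and
  of one open unit interval for each edge.  A continuous map from this complex to the plane
  (here \<^typ>\<open>complex\<close>) is given by the images \<open>f v\<close> of the vertices together with, for each
  edge \<open>e\<close>, a path \<open>\<gamma> e\<close> on \<open>[0,1]\<close> joining the images of the two ends of \<open>e\<close>.\<close>

datatype 'a cpoint = Vertex_Point 'a | Edge_Point "'a set" real

definition complex_points :: "'a ugraph \<Rightarrow> 'a cpoint set" where
  "complex_points G =
     Vertex_Point ` verts G \<union> {Edge_Point e t | e t. e \<in> edges G \<and> 0 < t \<and> t < 1}"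

fun drawing_map :: "('a \<Rightarrow> complex) \<Rightarrow> ('a set \<Rightarrow> real \<Rightarrow> complex) \<Rightarrow> 'a cpoint \<Rightarrow> complex" where
  "drawing_map f \<gamma> (Vertex_Point v) = f v"
| "drawing_map f \<gamma> (Edge_Point e t) = \<gamma> e t"

definition fibre ::
  "'a ugraph \<Rightarrow> ('a \<Rightarrow> complex) \<Rightarrow> ('a set \<Rightarrow> real \<Rightarrow> complex) \<Rightarrow> complex \<Rightarrow> 'a cpoint set" where
  "fibre G f \<gamma> p = {x \<in> complex_points G. drawing_map f \<gamma> x = p}"

definition multiple_points ::
  "'a ugraph \<Rightarrow> ('a \<Rightarrow> complex) \<Rightarrow> ('a set \<Rightarrow> real \<Rightarrow> complex) \<Rightarrow> complex set" where
  "multiple_points G f \<gamma> = {p. \<exists>x\<in>fibre G f \<gamma> p. \<exists>y\<in>fibre G f \<gamma> p. x \<noteq> y}"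

text \<open>Drawings are only continuous, so transversality is topological: in a suitable local chart of
  the plane centred at the common point, the two branches are the two coordinate axes.\<close>

definition transversal_at ::
  "(real \<Rightarrow> complex) \<Rightarrow> real \<Rightarrow> (real \<Rightarrow> complex) \<Rightarrow> real \<Rightarrow> bool" where
  "transversal_at \<alpha> s \<beta> t \<longleftrightarrow>
     \<alpha> s = \<beta> t \<and>
     (\<exists>U h h' a b c d.
        open U \<and> homeomorphism U (ball 0 1) h h' \<and>
        0 \<le> a \<and> a < s \<and> s < b \<and> b \<le> 1 \<and>
        0 \<le> c \<and> c < t \<and> t < d \<and> d \<le> 1 \<and>
        inj_on \<alpha> {a<..<b} \<and> \<alpha> ` {a<..<b} \<subseteq> U \<and>
        inj_on \<beta> {c<..<d} \<and> \<beta> ` {c<..<d} \<subseteq> U \<and>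
        h (\<alpha> s) = 0 \<and>
        h ` \<alpha> ` {a<..<b} = {z \<in> ball 0 1. Im z = 0} \<and>
        h ` \<beta> ` {c<..<d} = {z \<in> ball 0 1. Re z = 0})"

definition is_drawing ::
  "'a ugraph \<Rightarrow> ('a \<Rightarrow> complex) \<Rightarrow> ('a set \<Rightarrow> real \<Rightarrow> complex) \<Rightarrow> bool" where
  "is_drawing G f \<gamma> \<longleftrightarrow>
     (\<forall>e\<in>edges G. path (\<gamma> e) \<and> {pathstart (\<gamma> e), pathfinish (\<gamma> e)} = f ` e) \<and>
     finite (multiple_points G f \<gamma>) \<and>
     (\<forall>p\<in>multiple_points G f \<gamma>. \<exists>e s e' t.
        fibre G f \<gamma> p = {Edge_Point e s, Edge_Point e' t} \<and>
        transversal_at (\<gamma> e) s (\<gamma> e') t)"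

definition crossing_number :: "'a ugraph \<Rightarrow> nat" where
  "crossing_number G =
     (LEAST c. \<exists>f \<gamma>. is_drawing G f \<gamma> \<and> card (multiple_points G f \<gamma>) = c)"

lemma simple_graph_complete_graph: "simple_graph (complete_graph n)"
  by (auto simp: simple_graph_def complete_graph_def)

lemma simple_graph_delta_Y_move:
  assumes "simple_graph G" "delta_Y_move G H"
  shows "simple_graph H"
proof -
  obtain v1 v2 v3 v where
    e: "{v1, v2} \<in> edges G" "{v2, v3} \<in> edges G" and v: "v \<notin> verts G"
    and H: "H = UGraph (insert v (verts G))
              ((edges G - {{v1, v2}, {v2, v3}, {v3, v1}}) \<union> {{v, v1}, {v, v2}, {v, v3}})"
    using assms(2) unfolding delta_Y_move_def by blast
  have "v1 \<in> verts G" "v2 \<in> verts G" "v3 \<in> verts G"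
    using e assms(1) unfolding simple_graph_def by blast+
  moreover from this have "v \<noteq> v1" "v \<noteq> v2" "v \<noteq> v3"
    using v by auto
  ultimately show ?thesis
    using assms(1) unfolding H simple_graph_def by auto
qed

end

theory Submission imports Defs "HOL-Complex_Analysis.Winding_Numbers" begin

text \<open>
  Let \<open>G\<close> contain a large clique and consider a drawing of \<open>G\<close> with the minimal number of
  crossings; cutting out loops, we may take every edge to be an arc.

  If two adjacent edges \<open>ab\<close> and \<open>ac\<close> of the clique cross at \<open>p\<close>, put the new vertex of the
  \<open>\<Delta>Y\<close>-move on \<open>abc\<close> at \<open>p\<close> and use subarcs of \<open>ab\<close> and \<open>ac\<close> as its three edges: the crossing
  \<open>p\<close> disappears and no new one arises.

  Otherwise every crossing inside the clique involves four vertices.  Every \<open>K\<^sub>5\<close> has a crossing, so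
  counting 5-subsets yields of the order of \<open>m\<^sup>4\<close> crossings in a clique of size \<open>m\<close>, and some edge
  \<open>xy\<close> of the clique has more crossings than \<open>G\<close> has vertices.  For any further \<open>c\<close> in the clique,
  the \<open>\<Delta>Y\<close>-move on \<open>cxy\<close> deletes \<open>xy\<close>, and the new star can be drawn along \<open>cx\<close> and \<open>cy\<close>,
  joining them in a small disc around \<open>c\<close> at the cost of at most one crossing per edge at \<open>c\<close>.

  In both cases the crossing number drops, and the clique loses at most three vertices; so starting
  from a sufficiently large complete graph the step can be repeated \<open>k\<close> times.
\<close>

section \<open>Nonplanarity of the complete graph on five vertices\<close>

text \<open>Edges of a drawing are merely continuous, so nothing smooth or polygonal may be assumed
  of them, and transversality has to be re-established after every redrawing. The proof therefore
  forgets parametrisations: an edge becomes a point set, and a crossing a chart in which two such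
  sets are the coordinate axes. This local picture survives when an edge is replaced by a piece of
  itself, so old crossings are inherited by mere inclusion, and the only crossings ever made from
  scratch are those of straight segments. Adjacent edges need their own case because the 5-subset
  count relies on a crossing pair occupying four vertices: only then is a 5-subset determined by the
  pair and one more vertex. The count also has to beat the price of redrawing, one crossing per
  vertex of the whole graph; this is why the clique must stay comparable in size to the graph. As
  the crossing number is a \<open>LEAST\<close>, it is informative only for graphs known to have a
  drawing. A straight-line drawing starts the iteration, and every move hands on the drawing it
  constructs.\<close>

locale embedded_complete_graph =
  fixes S :: "'a set" and v :: "'a \<Rightarrow> complex" and g :: "'a \<Rightarrow> 'a \<Rightarrow> real \<Rightarrow> complex"
  assumes arc: "\<lbrakk>i \<in> S; j \<in> S; i \<noteq> j\<rbrakk> \<Longrightarrow> arc (g i j)"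
    and start: "\<lbrakk>i \<in> S; j \<in> S; i \<noteq> j\<rbrakk> \<Longrightarrow> pathstart (g i j) = v i"
    and finish: "\<lbrakk>i \<in> S; j \<in> S; i \<noteq> j\<rbrakk> \<Longrightarrow> pathfinish (g i j) = v j"
    and rev: "\<lbrakk>i \<in> S; j \<in> S; i \<noteq> j\<rbrakk> \<Longrightarrow> g j i = reversepath (g i j)"
    and inj: "inj_on v S"
    and disj: "\<lbrakk>i \<in> S; j \<in> S; i \<noteq> j; k \<in> S; l \<in> S; k \<noteq> l; {i,j} \<noteq> {k,l}\<rbrakk>
      \<Longrightarrow> path_image (g i j) \<inter> path_image (g k l) \<subseteq> v ` ({i,j} \<inter> {k,l})"
begin

section \<open>Triangles, their boundary loops and their insides\<close>

definition tri :: "'a \<Rightarrow> 'a \<Rightarrow> 'a \<Rightarrow> complex set" where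
  "tri i j k = path_image (g i j) \<union> path_image (g j k) \<union> path_image (g k i)"

definition loop :: "'a \<Rightarrow> 'a \<Rightarrow> 'a \<Rightarrow> real \<Rightarrow> complex" where
  "loop i j k = g i j +++ g j k +++ g k i"

lemma image_commute: "\<lbrakk>i \<in> S; j \<in> S; i \<noteq> j\<rbrakk> \<Longrightarrow> path_image (g j i) = path_image (g i j)"
  using rev[of i j] by simp

lemma ends_in_image:
  assumes "i \<in> S" "j \<in> S" "i \<noteq> j"
  shows "v i \<in> path_image (g i j)" "v j \<in> path_image (g i j)"
  using assms start finish by (metis pathstart_in_path_image, metis pathfinish_in_path_image)

lemma vertex_notin_image:
  assumes "i \<in> S" "j \<in> S" "i \<noteq> j" "k \<in> S" "k \<noteq> i" "k \<noteq> j"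
  shows "v k \<notin> path_image (g i j)"
proof
  assume "v k \<in> path_image (g i j)"
  then have "v k \<in> path_image (g i j) \<inter> path_image (g i k)"
    using ends_in_image assms by blast
  also have "\<dots> \<subseteq> v ` ({i,j} \<inter> {i,k})"
    by (rule disj) (use assms in auto)
  finally show False
    using assms inj by (auto simp: inj_on_def)
qed

lemma images_meet:
  assumes "i \<in> S" "j \<in> S" "k \<in> S" "i \<noteq> j" "j \<noteq> k" "i \<noteq> k"
  shows "path_image (g i j) \<inter> path_image (g j k) = {v j}"
proof -
  have "path_image (g i j) \<inter> path_image (g j k) \<subseteq> v ` ({i,j} \<inter> {j,k})"
    by (rule disj) (use assms in auto)
  also have "{i,j} \<inter> {j,k} = {j}"
    using assms by auto
  finally show ?thesis
    using assms ends_in_image by blast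
qed

lemma images_disjoint:
  assumes "i \<in> S" "j \<in> S" "k \<in> S" "l \<in> S" "distinct [i,j,k,l]"
  shows "path_image (g i j) \<inter> path_image (g k l) = {}"
proof -
  have "path_image (g i j) \<inter> path_image (g k l) \<subseteq> v ` ({i,j} \<inter> {k,l})"
    by (rule disj) (use assms in auto)
  also have "{i,j} \<inter> {k,l} = {}"
    using assms by auto
  finally show ?thesis by simp
qed

lemma tri_permute:
  assumes "i \<in> S" "j \<in> S" "k \<in> S" "distinct [i,j,k]"
  shows "tri j k i = tri i j k" "tri j i k = tri i j k"
  using assms by (auto simp: tri_def image_commute)

lemma vertex_notin_tri:
  assumes "i \<in> S" "j \<in> S" "k \<in> S" "l \<in> S" "distinct [i,j,k,l]"
  shows "v l \<notin> tri i j k"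
  using assms vertex_notin_image[of i j l] vertex_notin_image[of j k l] vertex_notin_image[of k i l]
  by (auto simp: tri_def)

lemma tri_meets_image:
  assumes "i \<in> S" "j \<in> S" "k \<in> S" "l \<in> S" "distinct [i,j,k,l]"
  shows "tri i j k \<inter> path_image (g i l) \<subseteq> {v i}"
proof -
  have ne: "j \<noteq> i" "k \<noteq> i" "i \<noteq> l" "j \<noteq> l" "k \<noteq> l" "distinct [j,k,i,l]"
    using assms by auto
  show ?thesis
    using images_meet[of j i l] images_meet[of k i l] images_disjoint[of j k i l]
      image_commute[of j i] assms(1-4) ne
    unfolding tri_def by blast
qed

lemma arc_two:
  assumes "i \<in> S" "j \<in> S" "k \<in> S" "distinct [i,j,k]"
  shows "arc (g i j +++ g j k)" "pathstart (g i j +++ g j k) = v i" "pathfinish (g i j +++ g j k) = v k"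
    "path_image (g i j +++ g j k) = path_image (g i j) \<union> path_image (g j k)"
  using assms images_meet[of i j k]
  by (auto simp: start finish path_image_join intro!: arc_join arc)

lemma loop:
  assumes "i \<in> S" "j \<in> S" "k \<in> S" "distinct [i,j,k]"
  shows "simple_path (loop i j k)" "pathstart (loop i j k) = v i" "pathfinish (loop i j k) = v i"
    "path_image (loop i j k) = tri i j k"
proof -
  have "path_image (g i j) \<inter> path_image (g j k +++ g k i) \<subseteq> {v i, v j}"
    using assms images_meet[of i j k] images_meet[of k i j] arc_two[of j k i] by auto
  then show "simple_path (loop i j k)"
    unfolding loop_def using assms arc_two[of j k i]
    by (intro simple_path_join_loop) (auto simp: start finish arc)
  show "pathstart (loop i j k) = v i" "pathfinish (loop i j k) = v i"
    "path_image (loop i j k) = tri i j k"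
    using assms arc_two[of j k i] by (auto simp: loop_def start finish tri_def path_image_join)
qed

text \<open>A simple closed curve winds once, up to sign, about its inside and not at all about its
  outside. This turns the question which vertex lies in which triangle into additive
  bookkeeping.\<close>

lemma winding_number_loop_inside:
  assumes "i \<in> S" "j \<in> S" "k \<in> S" "distinct [i,j,k]" "p \<notin> tri i j k"
  shows "winding_number (loop i j k) p \<noteq> 0 \<longleftrightarrow> p \<in> inside (tri i j k)"
proof -
  note L = loop[OF assms(1-4)]
  show ?thesis
  proof
    assume "p \<in> inside (tri i j k)"
    then show "winding_number (loop i j k) p \<noteq> 0"
      using simple_closed_path_norm_winding_number_inside[of "loop i j k" p] L by (metis norm_zero zero_neq_one)
  next
    assume nz: "winding_number (loop i j k) p \<noteq> 0"
    show "p \<in> inside (tri i j k)"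
    proof (rule ccontr)
      assume "p \<notin> inside (tri i j k)"
      then have "p \<in> outside (path_image (loop i j k))"
        using assms(5) L(4) by (simp add: outside_inside)
      then show False
        using nz L winding_number_zero_in_outside[of "loop i j k" p] simple_path_imp_path by metis
    qed
  qed
qed

lemma winding_number_loop:
  assumes "i \<in> S" "j \<in> S" "k \<in> S" "distinct [i,j,k]" "p \<notin> tri i j k"
  shows "winding_number (loop i j k) p =
    winding_number (g i j) p + winding_number (g j k) p + winding_number (g k i) p"
proof -
  have ne: "i \<noteq> j" "j \<noteq> k" "k \<noteq> i" "distinct [j,k,i]"
    using assms by auto
  have "path (g i j)" "path (g j k)" "path (g k i)" "path (g j k +++ g k i)"
    using assms ne arc arc_two(1)[of j k i] arc_imp_path by blast+
  moreover have "p \<notin> path_image (g i j)" "p \<notin> path_image (g j k)" "p \<notin> path_image (g k i)"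
    "p \<notin> path_image (g j k +++ g k i)"
    using assms ne arc_two(4)[of j k i] by (auto simp: tri_def)
  ultimately show ?thesis
    using assms ne unfolding loop_def by (simp add: winding_number_join start finish)
qed

text \<open>The boundary relation of a tetrahedron: the edges at \<open>l\<close> are traversed once
  in each direction and cancel, which leaves the edges of the triangle \<open>i j k\<close>.\<close>

lemma winding_number_loop_sum:
  assumes S: "i \<in> S" "j \<in> S" "k \<in> S" "l \<in> S" "distinct [i,j,k,l]"
    and p: "p \<notin> tri i j k" "p \<notin> tri i j l" "p \<notin> tri j k l"
  shows "winding_number (loop i j k) p =
    winding_number (loop i j l) p + winding_number (loop j k l) p + winding_number (loop k i l) p"
proof -
  have p': "p \<notin> tri k i l"
    using p S by (auto simp: tri_def image_commute)
  have "winding_number (g l i) p = - winding_number (g i l) p" 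
    if "i \<in> S" "i \<noteq> l" "p \<notin> path_image (g i l)" for i
    using that S rev[of i l] arc[of i l] by (simp add: winding_number_reversepath arc_imp_path)
  moreover have "distinct [i,j,k]" "distinct [i,j,l]" "distinct [j,k,l]" "distinct [k,i,l]"
    "i \<noteq> l" "j \<noteq> l" "k \<noteq> l"
    using S by auto
  moreover have "p \<notin> path_image (g i l)" "p \<notin> path_image (g j l)" "p \<notin> path_image (g k l)"
    using p p' by (auto simp: tri_def)
  ultimately show ?thesis
    using S(1-4) p p' by (simp add: winding_number_loop)
qed

text \<open>The three arcs from \<open>i\<close> to \<open>j\<close>, direct, via \<open>k\<close>
  and via \<open>l\<close>, form a theta curve. With \<open>l\<close> inside the outer cycle, the
  middle arc cuts that inside in two, one part being the inside of \<open>tri i j l\<close>; it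
  cannot contain \<open>v k\<close>, which lies on the outer cycle.\<close>

lemma inside_triangle_exchange:
  assumes S: "i \<in> S" "j \<in> S" "k \<in> S" "l \<in> S" "distinct [i,j,k,l]"
    and l: "v l \<in> inside (tri i j k)"
  shows "v k \<notin> inside (tri i j l)"
proof -
  have T: "path_image (g i j) \<union> path_image (g i k +++ g k j) = tri i j k"
    "path_image (g i j) \<union> path_image (g i l +++ g l j) = tri i j l"
    using S arc_two[of i k j] arc_two[of i l j] by (auto simp: tri_def image_commute)
  have meets: "path_image (g i j) \<inter> path_image (g i k +++ g k j) = {v i, v j}"
    "path_image (g i j) \<inter> path_image (g i l +++ g l j) = {v i, v j}"
    "path_image (g i k +++ g k j) \<inter> path_image (g i l +++ g l j) = {v i, v j}"
    using S arc_two[of i k j] arc_two[of i l j]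
      images_meet[of j i k] images_meet[of i j k] images_meet[of j i l] images_meet[of i j l]
      images_meet[of k i l] images_meet[of k j l] images_disjoint[of i k l j] images_disjoint[of k j i l]
    by (auto simp: image_commute)
  have ne: "path_image (g i l +++ g l j) \<inter> inside (path_image (g i j) \<union> path_image (g i k +++ g k j)) \<noteq> {}"
    using l T S arc_two[of i l j] ends_in_image[of i l] by auto
  have "i \<noteq> j" "distinct [i,k,j]" "distinct [i,l,j]"
    using S by auto
  then have "simple_path (g i j)" "pathstart (g i j) = v i" "pathfinish (g i j) = v j"
    "simple_path (g i k +++ g k j)" "pathstart (g i k +++ g k j) = v i" "pathfinish (g i k +++ g k j) = v j"
    "simple_path (g i l +++ g l j)" "pathstart (g i l +++ g l j) = v i" "pathfinish (g i l +++ g l j) = v j"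
    "v i \<noteq> v j"
    using S(1-4) arc_two[of i k j] arc_two[of i l j] inj
    by (simp_all add: inj_on_eq_iff arc_imp_simple_path arc start finish)
  from split_inside_simple_closed_curve[OF this meets ne]
  have "inside (tri i j l) \<subseteq> inside (tri i j k)"
    unfolding T by blast
  moreover have "v k \<in> tri i j k"
    using S ends_in_image[of j k] by (simp add: tri_def)
  ultimately show ?thesis
    using inside_no_overlap by blast
qed

lemma connected_image_minus_start:
  assumes "i \<in> S" "j \<in> S" "i \<noteq> j"
  shows "connected (path_image (g i j) - {v i})"
proof -
  have "inj_on (g i j) {0..1}" "continuous_on {0..1} (g i j)" "g i j 0 = v i"
    using arc[OF assms] start[OF assms] by (auto simp: arc_def path_def pathstart_def)
  then have "path_image (g i j) - {v i} = g i j ` {0<..1}"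
    unfolding path_image_def by (auto simp: inj_on_eq_iff less_le) (metis inj_on_eq_iff atLeastAtMost_iff order.refl zero_le_one)
  moreover have "connected (g i j ` {0<..1})"
    using \<open>continuous_on {0..1} (g i j)\<close>
    by (intro connected_continuous_image) (auto intro: continuous_on_subset)
  ultimately show ?thesis by simp
qed

text \<open>A point \<open>p\<close> inside \<open>tri i j k\<close> has nonzero winding number
  there, so some summand in \<open>winding_number_loop_sum\<close> is nonzero and \<open>p\<close>
  also lies inside a triangle through \<open>l\<close>. As \<open>l\<close> is outside, the
  connected inside of \<open>tri i j k\<close> misses the edges of that triangle, hence lies wholly
  inside it, and the third corner, being in the closure, comes along.\<close>

lemma some_vertex_inside:
  assumes S: "i \<in> S" "j \<in> S" "k \<in> S" "l \<in> S" "distinct [i,j,k,l]"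
    and l: "v l \<notin> inside (tri i j k)"
  shows "v k \<in> inside (tri i j l) \<or> v i \<in> inside (tri j k l) \<or> v j \<in> inside (tri k i l)"
proof -
  have "distinct [i,j,k]"
    using S by simp
  note L = loop[OF S(1-3) this]
  have frontier: "frontier (inside (tri i j k)) = tri i j k" and con: "connected (inside (tri i j k))"
    and ne: "inside (tri i j k) \<noteq> {}"
    using Jordan_inside_outside[OF L(1)] L by auto
  have out: "v l \<in> outside (tri i j k)"
    using S l vertex_notin_tri[of i j k l] by (simp add: outside_inside)
  \<comment> \<open>An edge from a corner to \<open>l\<close> never enters the inside: without its
    first point it is connected, misses \<open>tri i j k\<close> and ends outside.\<close>
  have away: "inside (tri i j k) \<inter> path_image (g m l) = {}" if m: "m \<in> {i,j,k}" for m
  proof -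
    have vm: "v m \<in> tri i j k"
      using m S ends_in_image by (auto simp: tri_def)
    have "tri i j k \<inter> (path_image (g m l) - {v m}) = {}"
      using m S tri_meets_image[of i j k l] tri_meets_image[of j k i l] tri_meets_image[of k i j l]
        tri_permute[of i j k] tri_permute[of j k i] by auto
    moreover have "v l \<in> path_image (g m l) - {v m}"
      using m S ends_in_image[of m l] inj by (auto simp: inj_on_eq_iff)
    ultimately have "inside (tri i j k) \<inter> (path_image (g m l) - {v m}) = {}"
      using inside_outside_intersect_connected[OF connected_image_minus_start[of m l], of "tri i j k"]
        out m S by auto
    then show ?thesis
      using vm inside_no_overlap[of "tri i j k"] by blast
  qed
  have disj: "inside (tri i j k) \<inter> tri a b l = {}"
    if "(a,b) \<in> {(i,j),(j,k),(k,i)}" for a b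
  proof -
    have "path_image (g a b) \<subseteq> tri i j k"
      using that by (auto simp: tri_def)
    then show ?thesis
      using that S away[of a] away[of b] inside_no_overlap[of "tri i j k"]
        image_commute[of a l]
      unfolding tri_def by blast
  qed
  obtain p where p: "p \<in> inside (tri i j k)"
    using ne by blast
  have "p \<notin> tri i j k" "p \<notin> tri i j l" "p \<notin> tri j k l" "p \<notin> tri k i l"
    using p inside_no_overlap[of "tri i j k"] disj by blast+
  then have "p \<in> inside (tri i j l) \<or> p \<in> inside (tri j k l) \<or> p \<in> inside (tri k i l)"
    using winding_number_loop_sum[OF S] winding_number_loop_inside[of i j k p]
      winding_number_loop_inside[of i j l p] winding_number_loop_inside[of j k l p]
      winding_number_loop_inside[of k i l p] p S by auto
  moreover have "v c \<in> inside (tri a b l)"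
    if "p \<in> inside (tri a b l)" and ab: "(a,b,c) \<in> {(i,j,k),(j,k,i),(k,i,j)}" for a b c
  proof -
    have abS: "a \<in> S" "b \<in> S" "c \<in> S" "distinct [a,b,c,l]"
      using ab S by auto
    have "inside (tri i j k) \<subseteq> inside (tri a b l)"
      using inside_outside_intersect_connected[OF con, of "tri a b l"] disj[of a b] that p
        inside_Un_outside[of "tri a b l"] by blast
    then have "closure (inside (tri i j k)) \<subseteq> closure (inside (tri a b l))"
      by (rule closure_mono)
    moreover have "v c \<in> tri i j k"
      using ab S ends_in_image by (auto simp: tri_def)
    then have "v c \<in> closure (inside (tri i j k))"
      using frontier by (auto simp: frontier_def)
    moreover have "v c \<notin> tri a b l"
      using abS S by (intro vertex_notin_tri) auto
    moreover have "closure (inside (tri a b l)) \<subseteq> inside (tri a b l) \<union> tri a b l"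
      using Jordan_inside_outside[of "loop a b l"] loop[of a b l] abS S closure_Un_frontier
      by (metis distinct_length_2_or_more subset_refl)
    ultimately show ?thesis by blast
  qed
  ultimately show ?thesis by blast
qed

text \<open>\<open>v m\<close> is joined to each vertex by an arc avoiding the triangle of the other
  three, so that triangle winds equally often about both. If \<open>v l\<close> were inside
  \<open>tri i j k\<close>, then by \<open>inside_triangle_exchange\<close> each small triangle
  would wind zero times about its opposite corner, hence about \<open>v m\<close>. Summing up,
  \<open>tri i j k\<close> would wind zero times about \<open>v m\<close>, hence about
  \<open>v l\<close>.\<close>

lemma no_fifth_vertex:
  assumes S: "i \<in> S" "j \<in> S" "k \<in> S" "l \<in> S" "m \<in> S" "distinct [i,j,k,l,m]"
  shows "v l \<notin> inside (tri i j k)"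
proof
  assume l: "v l \<in> inside (tri i j k)"
  have eq: "winding_number (loop a b c) (v m) = winding_number (loop a b c) (v d)"
    if "{a,b,c,d} \<subseteq> {i,j,k,l}" "distinct [a,b,c,d]" for a b c d
  proof (rule winding_number_eq[where S = "path_image (g m d)"])
    have abcd: "a \<in> S" "b \<in> S" "c \<in> S" "d \<in> S" "distinct [a,b,c,d,m]"
      using that S by auto
    show "path (loop a b c)" "pathfinish (loop a b c) = pathstart (loop a b c)"
      "v m \<in> path_image (g m d)" "v d \<in> path_image (g m d)" "connected (path_image (g m d))"
      using abcd S loop[of a b c] ends_in_image[of m d] arc[of m d]
      by (auto simp: simple_path_imp_path arc_imp_path)
    show "path_image (g m d) \<inter> path_image (loop a b c) = {}"
      using abcd S loop[of a b c] images_disjoint[of m d] by (auto simp: tri_def)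
  qed
  have notin: "v e \<notin> tri a b c"
    if "{a,b,c} \<subseteq> {i,j,k,l}" "distinct [a,b,c,e]" "e \<in> {i,j,k,l,m}" for a b c e
    using that S by (intro vertex_notin_tri) auto
  have zero: "winding_number (loop a b l) (v m) = 0" if "(a,b,c) \<in> {(i,j,k),(j,k,i),(k,i,j)}" for a b c
  proof -
    have abc: "a \<in> S" "b \<in> S" "c \<in> S" "distinct [a,b,c,l]" "tri a b c = tri i j k"
      using that S tri_permute[of i j k] tri_permute[of j k i] by auto
    then have "v c \<notin> inside (tri a b l)"
      using inside_triangle_exchange[of a b c l] l S by simp
    moreover have "v c \<notin> tri a b l"
      using that S by (intro notin) auto
    ultimately have "winding_number (loop a b l) (v c) = 0"
      using winding_number_loop_inside[of a b l "v c"] abc S by auto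
    then show ?thesis
      using eq[of a b l c] that S by auto
  qed
  have "winding_number (loop i j k) (v m) =
    winding_number (loop i j l) (v m) + winding_number (loop j k l) (v m) + winding_number (loop k i l) (v m)"
    using S by (intro winding_number_loop_sum notin) auto
  then have "winding_number (loop i j k) (v m) = 0"
    using zero[of i j k] zero[of j k i] zero[of k i j] by simp
  then have "winding_number (loop i j k) (v l) = 0"
    using eq[of i j k l] S by auto
  then show False
    using winding_number_loop_inside[of i j k "v l"] notin[of i j k l] l S by auto
qed

lemma not_five_vertices:
  assumes "i \<in> S" "j \<in> S" "k \<in> S" "l \<in> S" "m \<in> S" "distinct [i,j,k,l,m]"
  shows False
proof -
  have "v l \<notin> inside (tri i j k)"
    by (rule no_fifth_vertex[where m = m]) (use assms in auto)
  moreover have "v k \<notin> inside (tri i j l)"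
    by (rule no_fifth_vertex[where m = m]) (use assms in auto)
  moreover have "v i \<notin> inside (tri j k l)"
    by (rule no_fifth_vertex[where m = m]) (use assms in auto)
  moreover have "v j \<notin> inside (tri k i l)"
    by (rule no_fifth_vertex[where m = m]) (use assms in auto)
  moreover have "distinct [i,j,k,l]"
    using assms by simp
  ultimately show False
    using some_vertex_inside[of i j k l] assms(1-4) by simp
qed

end

section \<open>Germs of transversal crossings\<close>

text \<open>Unlike in \<open>transversal_at\<close>, no parametrisation occurs, and within
  \<open>U\<close> the whole sets \<open>A\<close> and \<open>B\<close> are the axes, not just one
  branch of each. The notion depends only on the two sets near \<open>p\<close>.\<close>

definition crossing_germ :: "complex set \<Rightarrow> complex set \<Rightarrow> complex \<Rightarrow> bool" where
  "crossing_germ A B p \<longleftrightarrow>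
     (\<exists>U h h'. open U \<and> p \<in> U \<and> homeomorphism U (ball 0 1) h h' \<and> h p = 0 \<and>
        (\<forall>x\<in>U. x \<in> A \<longleftrightarrow> Im (h x) = 0) \<and> (\<forall>x\<in>U. x \<in> B \<longleftrightarrow> Re (h x) = 0))"

text \<open>The preimage of a small disc, blown up again, is a unit chart; this is how germs are
  shrunk.\<close>

lemma rescale_chart:
  fixes h h' :: "complex \<Rightarrow> complex"
  assumes U: "open U" and hom: "homeomorphism U (ball 0 1) h h'" and \<epsilon>: "0 < \<epsilon>" "\<epsilon> \<le> 1"
  defines "V \<equiv> {x \<in> U. h x \<in> ball 0 \<epsilon>}"
  shows "open V" "homeomorphism V (ball 0 1) (\<lambda>x. h x / of_real \<epsilon>) (\<lambda>z. h' (of_real \<epsilon> * z))"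
proof -
  have "continuous_on U h"
    using hom by (simp add: homeomorphism_def)
  then have "open (U \<inter> h -` ball 0 \<epsilon>)"
    using U by (simp add: continuous_open_preimage)
  then show "open V"
    by (simp add: V_def Int_def vimage_def)
  have sub: "of_real \<epsilon> * z \<in> ball 0 1" if "z \<in> ball 0 1" for z :: complex
  proof -
    have "\<epsilon> * norm z \<le> 1 * norm z"
      using \<epsilon> by (intro mult_right_mono) auto
    then show ?thesis
      using that \<epsilon> by (simp add: norm_mult)
  qed
  have inv: "h' (h x) = x" if "x \<in> U" for x
    using hom that by (simp add: homeomorphism_def)
  have inv': "h (h' z) = z" "h' z \<in> U" if "z \<in> ball 0 1" for z
    using hom that by (auto simp: homeomorphism_def)
  show "homeomorphism V (ball 0 1) (\<lambda>x. h x / of_real \<epsilon>) (\<lambda>z. h' (of_real \<epsilon> * z))"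
  proof (rule homeomorphismI)
    show "continuous_on V (\<lambda>x. h x / of_real \<epsilon>)"
      using \<open>continuous_on U h\<close> \<epsilon> by (auto simp: V_def intro!: continuous_intros elim: continuous_on_subset)
    have "continuous_on (ball 0 1) h'"
      using hom by (simp add: homeomorphism_def)
    then show "continuous_on (ball 0 1) (\<lambda>z. h' (of_real \<epsilon> * z))"
      by (rule continuous_on_compose2) (intro continuous_intros, use sub in blast)
    show "(\<lambda>x. h x / of_real \<epsilon>) ` V \<subseteq> ball 0 1"
      using \<epsilon> by (auto simp: V_def norm_divide)
    show "(\<lambda>z. h' (of_real \<epsilon> * z)) ` ball 0 1 \<subseteq> V"
    proof safe
      fix z :: complex assume "z \<in> ball 0 1"
      moreover from this have "\<epsilon> * norm z < \<epsilon> * 1"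
        using \<epsilon> by (intro mult_strict_left_mono) auto
      ultimately show "h' (of_real \<epsilon> * z) \<in> V"
        using inv'[OF sub[of z]] \<epsilon> by (simp add: V_def norm_mult)
    qed
    show "h' (of_real \<epsilon> * (h x / of_real \<epsilon>)) = x" if "x \<in> V" for x
      using that \<epsilon> inv by (simp add: V_def)
    show "h (h' (of_real \<epsilon> * z)) / of_real \<epsilon> = z" if "z \<in> ball 0 1" for z
      using inv'[OF sub[OF that]] \<epsilon> by simp
  qed
qed

text \<open>This is what makes the germ of a crossing insensitive to passing to subarcs.\<close>

lemma inj_path_covers_neighbourhood:
  fixes \<phi> :: "real \<Rightarrow> real"
  assumes "a < s" "s < b" "continuous_on {a..b} \<phi>" "inj_on \<phi> {a..b}" "\<phi> s = 0"
  shows "\<exists>\<epsilon>>0. {-\<epsilon><..<\<epsilon>} \<subseteq> \<phi> ` {a..b}"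
proof -
  have ab: "a \<in> {a..b}" "b \<in> {a..b}" "s \<in> {a..b}"
    using assms by auto
  have "\<phi> a < \<phi> s \<and> \<phi> s < \<phi> b \<or> \<phi> b < \<phi> s \<and> \<phi> s < \<phi> a"
    using continuous_inj_imp_mono[of a s b \<phi>] assms(1-4) by auto
  then obtain l r where lr: "l < 0" "0 < r" "l \<in> \<phi> ` {a..b}" "r \<in> \<phi> ` {a..b}"
    using assms(5) ab by (metis imageI)
  have "connected (\<phi> ` {a..b})"
    using assms(3) by (intro connected_continuous_image) auto
  then have "{l..r} \<subseteq> \<phi> ` {a..b}"
    using lr connected_contains_Icc by blast
  moreover have "{- min (-l) r<..<min (-l) r} \<subseteq> {l..r}"
    by auto
  ultimately show ?thesis
    using lr by (intro exI[of _ "min (-l) r"]) auto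
qed

text \<open>Here \<pi> is the coordinate along an axis, \<open>Re\<close> for one branch and
  \<open>Im\<close> for the other. The hypothesis \<open>axis\<close> holds when the other
  coordinate vanishes on the branch. It makes \<pi> injective along the arc near \<tau>, so the
  values pass from one side of 0 to the other.\<close>

lemma arc_covers_axis:
  fixes g :: "real \<Rightarrow> complex" and \<pi> :: "complex \<Rightarrow> real"
  assumes W: "open W" and h: "continuous_on W h" "inj_on h W" "h p = 0" and \<pi>: "continuous_on UNIV \<pi>" "\<pi> 0 = 0"
    and g: "arc g" "0 < \<tau>" "\<tau> < 1" "g \<tau> = p" "p \<in> W"
    and axis: "\<And>x y. \<lbrakk>x \<in> W; y \<in> W; x \<in> path_image g; y \<in> path_image g; \<pi> (h x) = \<pi> (h y)\<rbrakk> \<Longrightarrow> h x = h y"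
  shows "\<exists>\<epsilon>>0. \<forall>t. \<bar>t\<bar> < \<epsilon> \<longrightarrow> (\<exists>x \<in> path_image g \<inter> W. \<pi> (h x) = t)"
proof -
  have cg: "continuous_on {0..1} g" and ig: "inj_on g {0..1}"
    using g by (auto simp: arc_def path_def)
  have "continuous_on {0<..<1} g"
    using cg by (rule continuous_on_subset) auto
  then have "open ({0<..<1} \<inter> g -` W)"
    using W by (intro continuous_open_preimage) auto
  moreover have "\<tau> \<in> {0<..<1} \<inter> g -` W"
    using g by auto
  ultimately obtain e where e: "0 < e" "cball \<tau> e \<subseteq> {0<..<1} \<inter> g -` W"
    using open_contains_cball by metis
  define I where "I = {\<tau> - e..\<tau> + e}"
  have I: "I \<subseteq> {0..1}" "g ` I \<subseteq> W"
    using e(2) by (auto simp: I_def cball_eq_atLeastAtMost subset_iff intro: less_imp_le)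
  define \<phi> where "\<phi> t = \<pi> (h (g t))" for t
  have "continuous_on I (\<lambda>t. h (g t))"
    using continuous_on_compose2[OF h(1) continuous_on_subset[OF cg I(1)] I(2)] .
  then have "continuous_on I \<phi>"
    unfolding \<phi>_def by (intro continuous_on_compose2[OF \<pi>(1)]) auto
  moreover have "inj_on \<phi> I"
  proof (rule inj_onI)
    fix s t assume st: "s \<in> I" "t \<in> I" "\<phi> s = \<phi> t"
    then have "h (g s) = h (g t)"
      using I by (intro axis) (auto simp: \<phi>_def path_image_def)
    then show "s = t"
      using h(2) ig st I by (metis imageI inj_onD subsetD)
  qed
  ultimately obtain \<epsilon> where "\<epsilon> > 0" "{-\<epsilon><..<\<epsilon>} \<subseteq> \<phi> ` I"
    using inj_path_covers_neighbourhood[of "\<tau> - e" \<tau> "\<tau> + e" \<phi>] e g h \<pi> by (auto simp: I_def \<phi>_def)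
  moreover have "\<exists>x \<in> path_image g \<inter> W. \<pi> (h x) = t" if "t \<in> \<phi> ` I" for t
    using that I by (auto simp: \<phi>_def path_image_def)
  ultimately show ?thesis
    by (intro exI[of _ \<epsilon>]) (auto simp: abs_less_iff subset_iff)
qed

lemma path_image_interior_parameter:
  assumes "p \<in> path_image g" "p \<noteq> pathstart g" "p \<noteq> pathfinish g"
  obtains s where "g s = p" "0 < s" "s < 1"
proof -
  obtain s where s: "0 \<le> s" "s \<le> 1" "g s = p"
    using assms(1) by (auto simp: path_image_def)
  then have "s \<noteq> 0" "s \<noteq> 1"
    using assms by (auto simp: pathstart_def pathfinish_def)
  then show thesis
    using s that by simp
qed

text \<open>Lying in the axes near \<open>p\<close> is enough: an arc with \<open>p\<close> in its
  interior cannot stop on the axis, so it fills a neighbourhood of 0 there, and in a smaller chart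
  inclusion becomes equality.\<close>

lemma crossing_germ_subarcs:
  fixes h h' :: "complex \<Rightarrow> complex"
  assumes U: "open U" "p \<in> U" "homeomorphism U (ball 0 1) h h'" "h p = 0" and N: "open N" "p \<in> N"
    and g: "arc g" "path_image g = A" "p \<in> A" "p \<noteq> pathstart g" "p \<noteq> pathfinish g"
    and k: "arc k" "path_image k = B" "p \<in> B" "p \<noteq> pathstart k" "p \<noteq> pathfinish k"
    and axes: "\<And>x. x \<in> A \<Longrightarrow> x \<in> N \<Longrightarrow> x \<in> U \<Longrightarrow> Im (h x) = 0" "\<And>x. x \<in> B \<Longrightarrow> x \<in> N \<Longrightarrow> x \<in> U \<Longrightarrow> Re (h x) = 0"
  shows "crossing_germ A B p"
proof -
  define W where "W = U \<inter> N"
  have W: "open W" "p \<in> W" "W \<subseteq> U"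
    using U N by (auto simp: W_def)
  have h: "continuous_on U h" "inj_on h U" "h ` U = ball 0 1"
    using U(3) by (auto simp: homeomorphism_def intro: inj_on_inverseI)
  have hW: "continuous_on W h" "inj_on h W"
    using h W by (auto intro: continuous_on_subset inj_on_subset)
  obtain s where s: "g s = p" "0 < s" "s < 1"
    using g path_image_interior_parameter by metis
  obtain t where t: "k t = p" "0 < t" "t < 1"
    using k path_image_interior_parameter by metis
  have "\<exists>\<epsilon>>0. \<forall>t. \<bar>t\<bar> < \<epsilon> \<longrightarrow> (\<exists>x \<in> path_image g \<inter> W. Re (h x) = t)"
    using axes g by (intro arc_covers_axis[where p = p and \<tau> = s] W hW U(4) s)
      (auto simp: W_def complex_eq_iff intro: continuous_intros)
  then obtain \<epsilon>1 where e1: "\<epsilon>1 > 0" "\<And>t. \<bar>t\<bar> < \<epsilon>1 \<Longrightarrow> \<exists>x \<in> A \<inter> W. Re (h x) = t"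
    using g by auto
  have "\<exists>\<epsilon>>0. \<forall>t. \<bar>t\<bar> < \<epsilon> \<longrightarrow> (\<exists>x \<in> path_image k \<inter> W. Im (h x) = t)"
    using axes k by (intro arc_covers_axis[where p = p and \<tau> = t] W hW U(4) t)
      (auto simp: W_def complex_eq_iff intro: continuous_intros)
  then obtain \<epsilon>2 where e2: "\<epsilon>2 > 0" "\<And>t. \<bar>t\<bar> < \<epsilon>2 \<Longrightarrow> \<exists>x \<in> B \<inter> W. Im (h x) = t"
    using k by auto
  have h'c: "continuous_on (ball 0 1) h'" "h' 0 = p"
    using U by (auto simp: homeomorphism_def)
  then have "open (ball 0 1 \<inter> h' -` N)"
    using N by (intro continuous_open_preimage) auto
  moreover have "0 \<in> ball 0 1 \<inter> h' -` N"
    using h'c N by auto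
  ultimately obtain \<epsilon>3 where e3: "\<epsilon>3 > 0" "ball 0 \<epsilon>3 \<subseteq> ball 0 1 \<inter> h' -` N"
    using open_contains_ball by metis
  \<comment> \<open>The four bounds: 1 for \<open>rescale_chart\<close>, \<epsilon>1 and \<epsilon>2
    for the covered parts of the axes, \<epsilon>3 to keep the chart inside
    \<open>N\<close>.\<close>
  define \<epsilon> where "\<epsilon> = min 1 (min \<epsilon>1 (min \<epsilon>2 \<epsilon>3))"
  have \<epsilon>: "0 < \<epsilon>" "\<epsilon> \<le> 1" "\<epsilon> \<le> \<epsilon>1" "\<epsilon> \<le> \<epsilon>2" "\<epsilon> \<le> \<epsilon>3"
    using e1 e2 e3 by (auto simp: \<epsilon>_def)
  define V where "V = {x \<in> U. h x \<in> ball 0 \<epsilon>}"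
  note V = rescale_chart[OF U(1) U(3) \<epsilon>(1,2), folded V_def]
  have VN: "x \<in> N" "x \<in> U" "norm (h x) < \<epsilon>" if "x \<in> V" for x
  proof -
    show x: "x \<in> U" "norm (h x) < \<epsilon>"
      using that by (auto simp: V_def)
    then have "h x \<in> ball 0 \<epsilon>3"
      using \<epsilon> by auto
    then have "h' (h x) \<in> N"
      using e3 by auto
    then show "x \<in> N"
      using U(3) x by (simp add: homeomorphism_def)
  qed
  have A: "x \<in> A \<longleftrightarrow> Im (h x) = 0" if x: "x \<in> V" for x
  proof
    assume im: "Im (h x) = 0"
    have "\<bar>Re (h x)\<bar> < \<epsilon>1"
      using VN(3)[OF x] abs_Re_le_cmod[of "h x"] \<epsilon> by linarith
    then obtain y where y: "y \<in> A" "y \<in> W" "Re (h y) = Re (h x)"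
      using e1 by blast
    then have "h y = h x"
      using axes(1)[of y] im by (simp add: complex_eq_iff W_def)
    then have "y = x"
      using h(2) y VN(2)[OF x] W by (meson inj_onD subsetD)
    then show "x \<in> A"
      using y by simp
  qed (use axes(1) VN x in blast)
  have B: "x \<in> B \<longleftrightarrow> Re (h x) = 0" if x: "x \<in> V" for x
  proof
    assume re: "Re (h x) = 0"
    have "\<bar>Im (h x)\<bar> < \<epsilon>2"
      using VN(3)[OF x] abs_Im_le_cmod[of "h x"] \<epsilon> by linarith
    then obtain y where y: "y \<in> B" "y \<in> W" "Im (h y) = Im (h x)"
      using e2 by blast
    then have "h y = h x"
      using axes(2)[of y] re by (simp add: complex_eq_iff W_def)
    then have "y = x"
      using h(2) y VN(2)[OF x] W by (meson inj_onD subsetD)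
    then show "x \<in> B"
      using y by simp
  qed (use axes(2) VN x in blast)
  show ?thesis
    unfolding crossing_germ_def
  proof (intro exI conjI)
    show "open V" "homeomorphism V (ball 0 1) (\<lambda>x. h x / of_real \<epsilon>) (\<lambda>z. h' (of_real \<epsilon> * z))"
      by (rule V)+
    show "p \<in> V" "h p / of_real \<epsilon> = 0"
      using U \<epsilon> by (auto simp: V_def)
    show "\<forall>x\<in>V. x \<in> A \<longleftrightarrow> Im (h x / of_real \<epsilon>) = 0" "\<forall>x\<in>V. x \<in> B \<longleftrightarrow> Re (h x / of_real \<epsilon>) = 0"
      using A B \<epsilon> by auto
  qed
qed

lemma crossing_germ_cong:
  assumes "crossing_germ A B p" "open N" "p \<in> N"
    and "arc g" "path_image g = A'" "p \<in> A'" "p \<noteq> pathstart g" "p \<noteq> pathfinish g"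
    and "arc k" "path_image k = B'" "p \<in> B'" "p \<noteq> pathstart k" "p \<noteq> pathfinish k"
    and "A' \<inter> N \<subseteq> A" "B' \<inter> N \<subseteq> B"
  shows "crossing_germ A' B' p"
proof -
  obtain U h h' where U: "open U" "p \<in> U" "homeomorphism U (ball 0 1) h h'" "h p = 0"
    and AB: "\<forall>x\<in>U. x \<in> A \<longleftrightarrow> Im (h x) = 0" "\<forall>x\<in>U. x \<in> B \<longleftrightarrow> Re (h x) = 0"
    using assms(1) unfolding crossing_germ_def by blast
  show ?thesis
    by (rule crossing_germ_subarcs[OF U assms(2-13)]) (use AB assms(14,15) in blast)+
qed

lemma crossing_germ_lines:
  assumes det: "Im (cnj u * w) \<noteq> 0"
  shows "crossing_germ (range (\<lambda>t. p + of_real t * u)) (range (\<lambda>t. p + of_real t * w)) p"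
proof -
  \<comment> \<open>The affine chart with axes in the directions \<open>u\<close> and
    \<open>w\<close>; \<open>h\<close> inverts \<open>h'\<close> by Cramer's rule, with determinant
    \<open>Im (cnj u * w)\<close>.\<close>
  define h' where "h' z = p + of_real (Re z) * u + of_real (Im z) * w" for z
  define h where "h x = Complex (Im (cnj (x - p) * w) / Im (cnj u * w)) (Im (cnj u * (x - p)) / Im (cnj u * w))" for x
  have hh': "h (h' z) = z" for z
    using det by (simp add: h_def h'_def complex_eq_iff field_simps)
  have h'h: "h' (h x) = x" for x
    using det by (simp add: h_def h'_def complex_eq_iff divide_simps) (simp add: algebra_simps)
  have ch: "continuous_on UNIV h" "continuous_on UNIV h'"
    using det by (auto simp: h_def h'_def Complex_eq simp flip: of_real_mult intro!: continuous_intros)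
  define U where "U = h -` ball 0 1"
  have "open U"
    using ch unfolding U_def by (simp add: continuous_open_vimage continuous_on_eq_continuous_at)
  moreover have "homeomorphism U (ball 0 1) h h'"
    by (rule homeomorphismI) (use hh' h'h ch in \<open>auto simp: U_def intro: continuous_on_subset\<close>)
  moreover have "h p = 0"
    by (simp add: h_def complex_eq_iff)
  moreover have "x \<in> range (\<lambda>t. p + of_real t * u) \<longleftrightarrow> Im (h x) = 0" for x
  proof
    assume "Im (h x) = 0"
    then have "x = p + of_real (Re (h x)) * u"
      using h'h[of x] by (simp add: h'_def)
    then show "x \<in> range (\<lambda>t. p + of_real t * u)"
      by blast
  qed (auto simp: h_def)
  moreover have "x \<in> range (\<lambda>t. p + of_real t * w) \<longleftrightarrow> Re (h x) = 0" for x
  proof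
    assume "Re (h x) = 0"
    then have "x = p + of_real (Im (h x)) * w"
      using h'h[of x] by (simp add: h'_def)
    then show "x \<in> range (\<lambda>t. p + of_real t * w)"
      by blast
  qed (auto simp: h_def)
  ultimately show ?thesis
    unfolding crossing_germ_def U_def by (intro exI[of _ U] exI[of _ h] exI[of _ h']) (auto simp: U_def)
qed

section \<open>Drawings by arcs\<close>

lemma open_connected_real_interval:
  fixes T :: "real set"
  assumes "open T" "connected T" "bounded T" "s \<in> T"
  obtains a b where "T = {a<..<b}" "a < s" "s < b"
proof -
  have bdd: "bdd_below T" "bdd_above T" and "T \<noteq> {}"
    using assms bounded_imp_bdd_below bounded_imp_bdd_above by auto
  have "T = {Inf T<..<Sup T}"
  proof (intro equalityI subsetI)
    fix x assume x: "x \<in> T"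
    obtain e where e: "0 < e" "cball x e \<subseteq> T"
      using assms(1) x open_contains_cball by blast
    then have "x - e \<in> T" "x + e \<in> T"
      by (auto simp: cball_eq_atLeastAtMost)
    then have "Inf T \<le> x - e" "x + e \<le> Sup T"
      using bdd by (auto intro: cInf_lower cSup_upper)
    then show "x \<in> {Inf T<..<Sup T}"
      using e by auto
  next
    fix x assume "x \<in> {Inf T<..<Sup T}"
    then obtain y z where "y \<in> T" "y < x" "z \<in> T" "x < z"
      using bdd \<open>T \<noteq> {}\<close> by (auto simp: cInf_less_iff less_cSup_iff)
    then show "x \<in> T"
      using connected_contains_Icc[OF assms(2), of y z] by auto
  qed
  then show thesis
    using that[of "Inf T" "Sup T"] assms(4) by (metis greaterThanLessThan_iff)
qed

lemma crossing_germ_within: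
  assumes "crossing_germ A B p" "open N" "p \<in> N"
  obtains U h h' where "open U" "p \<in> U" "U \<subseteq> N" "homeomorphism U (ball 0 1) h h'" "h p = 0"
    "\<forall>x\<in>U. x \<in> A \<longleftrightarrow> Im (h x) = 0" "\<forall>x\<in>U. x \<in> B \<longleftrightarrow> Re (h x) = 0"
proof -
  obtain U h h' where U: "open U" "p \<in> U" "homeomorphism U (ball 0 1) h h'" "h p = 0"
    and AB: "\<forall>x\<in>U. x \<in> A \<longleftrightarrow> Im (h x) = 0" "\<forall>x\<in>U. x \<in> B \<longleftrightarrow> Re (h x) = 0"
    using assms(1) unfolding crossing_germ_def by blast
  have h': "continuous_on (ball 0 1) h'" "h' 0 = p" and inv: "\<And>x. x \<in> U \<Longrightarrow> h' (h x) = x"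
    using U by (auto simp: homeomorphism_def)
  then have "open (ball 0 1 \<inter> h' -` N)"
    using assms by (intro continuous_open_preimage) auto
  moreover have "0 \<in> ball 0 1 \<inter> h' -` N"
    using h' assms by auto
  ultimately obtain d where d: "d > 0" "ball 0 d \<subseteq> ball 0 1 \<inter> h' -` N"
    using open_contains_ball by metis
  define \<epsilon> where "\<epsilon> = min 1 d"
  have \<epsilon>: "0 < \<epsilon>" "\<epsilon> \<le> 1" "\<epsilon> \<le> d"
    using d by (auto simp: \<epsilon>_def)
  define V where "V = {x \<in> U. h x \<in> ball 0 \<epsilon>}"
  show thesis
  proof (rule that)
    show "open V" "homeomorphism V (ball 0 1) (\<lambda>x. h x / of_real \<epsilon>) (\<lambda>z. h' (of_real \<epsilon> * z))"
      using rescale_chart[OF U(1) U(3) \<epsilon>(1,2)] by (auto simp: V_def)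
    show "p \<in> V" "h p / of_real \<epsilon> = 0"
      using U \<epsilon> by (auto simp: V_def)
    show "V \<subseteq> N"
    proof
      fix x assume "x \<in> V"
      then have "x \<in> U" "h x \<in> ball 0 d"
        using \<epsilon> by (auto simp: V_def)
      then have "h' (h x) \<in> N"
        using d by blast
      then show "x \<in> N"
        using inv \<open>x \<in> U\<close> by simp
    qed
    show "\<forall>x\<in>V. x \<in> A \<longleftrightarrow> Im (h x / of_real \<epsilon>) = 0" "\<forall>x\<in>V. x \<in> B \<longleftrightarrow> Re (h x / of_real \<epsilon>) = 0"
      using AB \<epsilon> by (auto simp: V_def)
  qed
qed

text \<open>The part of the arc in \<open>U\<close> corresponds through the chart to a convex, hence
  connected set, and \<open>g\<close> is a homeomorphism onto its image; so the parameters with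
  value in \<open>U\<close> form one interval. It is open because both ends of \<open>g\<close> are
  outside \<open>U\<close>.\<close>

lemma arc_axis_branch:
  fixes g :: "real \<Rightarrow> complex" and h h' :: "complex \<Rightarrow> complex"
  assumes g: "arc g" "0 < s" "s < 1" "g s \<in> U" "g 0 \<notin> U" "g 1 \<notin> U"
    and U: "open U" "homeomorphism U (ball 0 1) h h'"
    and L: "convex L" "\<forall>x\<in>U. x \<in> path_image g \<longleftrightarrow> h x \<in> L"
  obtains a b where "0 \<le> a" "a < s" "s < b" "b \<le> 1" "inj_on g {a<..<b}" "g ` {a<..<b} \<subseteq> U"
    "h ` g ` {a<..<b} = ball 0 1 \<inter> L"
proof -
  have g': "continuous_on {0..1} g" "inj_on g {0..1}"
    using g by (auto simp: arc_def path_def)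
  define T where "T = {0<..<1} \<inter> g -` U"
  have T': "T = {0..1} \<inter> g -` U"
    using g by (auto simp: T_def less_le)
  have "continuous_on {0<..<1} g"
    using g'(1) by (rule continuous_on_subset) auto
  then have "open T"
    using U unfolding T_def by (intro continuous_open_preimage) auto
  obtain k where k: "homeomorphism {0..1} (path_image g) g k"
    using homeomorphism_arc[OF g(1)] .
  have gT: "g ` T = h' ` (ball 0 1 \<inter> L)"
  proof (intro equalityI subsetI)
    fix x assume "x \<in> g ` T"
    then have "x \<in> U" "x \<in> path_image g"
      by (auto simp: T' path_image_def)
    then have "h x \<in> ball 0 1 \<inter> L" "h' (h x) = x"
      using U L by (auto simp: homeomorphism_def)
    then show "x \<in> h' ` (ball 0 1 \<inter> L)"
      by (metis imageI)
  next
    fix x assume "x \<in> h' ` (ball 0 1 \<inter> L)"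
    then have "x \<in> U" "x \<in> path_image g"
      using U L by (auto simp: homeomorphism_def)
    then show "x \<in> g ` T"
      by (auto simp: T' path_image_def)
  qed
  have "continuous_on (ball 0 1 \<inter> L) h'"
    using U(2) by (auto simp: homeomorphism_def intro: continuous_on_subset[of "ball 0 1"])
  then have "connected (g ` T)"
    unfolding gT using L by (intro connected_continuous_image) (auto intro!: convex_connected convex_Int)
  moreover have "continuous_on (g ` T) k"
    using k by (auto simp: homeomorphism_def T' path_image_def intro: continuous_on_subset)
  ultimately have "connected (k ` g ` T)"
    by (rule connected_continuous_image[rotated])
  moreover have "k ` g ` T = T"
    using k by (force simp: homeomorphism_def T' image_image)
  ultimately have "connected T"
    by simp
  moreover have "bounded T"
    by (rule bounded_subset[of "{0..1}"]) (auto simp: T')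
  moreover have "s \<in> T"
    using g by (auto simp: T_def)
  ultimately obtain a b where ab: "T = {a<..<b}" "a < s" "s < b"
    using open_connected_real_interval \<open>open T\<close> by metis
  show thesis
  proof (rule that)
    have "{a<..<b} \<subseteq> {0..1}"
      using ab T' by auto
    then show "0 \<le> a" "b \<le> 1"
      using ab greaterThanLessThan_subseteq_atLeastAtMost_iff[of a b 0 1] by auto
    show "inj_on g {a<..<b}"
      using g'(2) \<open>{a<..<b} \<subseteq> {0..1}\<close> by (rule inj_on_subset)
    show "g ` {a<..<b} \<subseteq> U"
      using ab by (auto simp: T_def)
    show "h ` g ` {a<..<b} = ball 0 1 \<inter> L"
      unfolding ab(1)[symmetric] gT using U by (force simp: homeomorphism_def image_image)
  qed (use ab in auto)
qed

lemma crossing_germ_imp_transversal_at: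
  assumes germ: "crossing_germ (path_image g) (path_image k) p"
    and g: "arc g" "0 < s" "s < 1" "g s = p" and k: "arc k" "0 < t" "t < 1" "k t = p"
  shows "transversal_at g s k t"
proof -
  \<comment> \<open>A chart without the four end points is what \<open>arc_axis_branch\<close>
    requires.\<close>
  define N where "N = - {g 0, g 1, k 0, k 1}"
  have "g s \<noteq> g 0" "g s \<noteq> g 1" "k t \<noteq> k 0" "k t \<noteq> k 1"
    using g k by (auto simp: arc_def inj_on_eq_iff)
  then have N: "open N" "p \<in> N"
    using g k by (auto simp: N_def open_Compl finite_imp_closed)
  obtain U h h' where U: "open U" "p \<in> U" "U \<subseteq> N" "homeomorphism U (ball 0 1) h h'" "h p = 0"
    and axes: "\<forall>x\<in>U. x \<in> path_image g \<longleftrightarrow> Im (h x) = 0" "\<forall>x\<in>U. x \<in> path_image k \<longleftrightarrow> Re (h x) = 0"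
    using crossing_germ_within[OF germ N] .
  have eq: "{z \<in> ball 0 1. P z} = ball 0 1 \<inter> {z. P z}" for P :: "complex \<Rightarrow> bool"
    by auto
  have cv: "convex {z. Im z = 0}" "convex {z. Re z = 0}"
    by (auto simp: convex_def)
  have ends: "g 0 \<notin> U" "g 1 \<notin> U" "k 0 \<notin> U" "k 1 \<notin> U"
    using U by (auto simp: N_def)
  obtain a b where ab: "0 \<le> a" "a < s" "s < b" "b \<le> 1" "inj_on g {a<..<b}" "g ` {a<..<b} \<subseteq> U"
    "h ` g ` {a<..<b} = ball 0 1 \<inter> {z. Im z = 0}"
    by (rule arc_axis_branch[OF g(1-3) _ ends(1,2) U(1,4) cv(1)]) (use g U axes in auto)
  obtain c d where cd: "0 \<le> c" "c < t" "t < d" "d \<le> 1" "inj_on k {c<..<d}" "k ` {c<..<d} \<subseteq> U"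
    "h ` k ` {c<..<d} = ball 0 1 \<inter> {z. Re z = 0}"
    by (rule arc_axis_branch[OF k(1-3) _ ends(3,4) U(1,4) cv(2)]) (use k U axes in auto)
  have "h (g s) = 0" "g s = k t"
    using U g k by auto
  then show ?thesis
    unfolding transversal_at_def eq using U(1,4) ab cd by blast
qed

text \<open>The ends are recorded as an unordered set because the ends of an edge are
  unordered.\<close>

definition arc_between :: "complex set \<Rightarrow> complex set \<Rightarrow> bool" where
  "arc_between A X \<longleftrightarrow> (\<exists>g. arc g \<and> path_image g = A \<and> {pathstart g, pathfinish g} = X)"

lemma arc_between_crossing_germ_cong:
  assumes "crossing_germ A B p" "open N" "p \<in> N"
    and "arc_between A' X" "p \<in> A'" "p \<notin> X" "arc_between B' Y" "p \<in> B'" "p \<notin> Y"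
    and "A' \<inter> N \<subseteq> A" "B' \<inter> N \<subseteq> B"
  shows "crossing_germ A' B' p"
proof -
  obtain g k where "arc g" "path_image g = A'" "{pathstart g, pathfinish g} = X"
    "arc k" "path_image k = B'" "{pathstart k, pathfinish k} = Y"
    using assms(4,7) unfolding arc_between_def by blast
  then show ?thesis
    using assms by (intro crossing_germ_cong[of A B p N g A' k B']) auto
qed

definition crossings :: "'a ugraph \<Rightarrow> ('a \<Rightarrow> complex) \<Rightarrow> ('a set \<Rightarrow> complex set) \<Rightarrow> complex set" where
  "crossings G f A =
     {p. p \<notin> f ` verts G \<and> (\<exists>e\<in>edges G. \<exists>e'\<in>edges G. e \<noteq> e' \<and> p \<in> A e \<and> p \<in> A e')}"

text \<open>Arcs rule out the self-crossings that \<open>is_drawing\<close> allows, and the set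
  equation in the last clause rules out triple points. Which of the two edges is the real axis of
  the germ is left open.\<close>

definition arc_drawing :: "'a ugraph \<Rightarrow> ('a \<Rightarrow> complex) \<Rightarrow> ('a set \<Rightarrow> complex set) \<Rightarrow> bool" where
  "arc_drawing G f A \<longleftrightarrow>
     inj_on f (verts G) \<and>
     (\<forall>e\<in>edges G. arc_between (A e) (f ` e)) \<and>
     (\<forall>e\<in>edges G. \<forall>v\<in>verts G. f v \<in> A e \<longrightarrow> v \<in> e) \<and>
     finite (crossings G f A) \<and>
     (\<forall>p\<in>crossings G f A. \<exists>e\<in>edges G. \<exists>e'\<in>edges G. e \<noteq> e' \<and>
        crossing_germ (A e) (A e') p \<and> {d \<in> edges G. p \<in> A d} = {e, e'})"

section \<open>Passing between drawings and arc drawings\<close>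

lemma fibre_iff:
  "Vertex_Point v \<in> fibre G f \<gamma> p \<longleftrightarrow> v \<in> verts G \<and> f v = p"
  "Edge_Point e t \<in> fibre G f \<gamma> p \<longleftrightarrow> e \<in> edges G \<and> 0 < t \<and> t < 1 \<and> \<gamma> e t = p"
  by (auto simp: fibre_def complex_points_def)

text \<open>Each path is replaced by an arc inside its image, so multiple points can only disappear.
  Germs survive because a crossing has exactly two preimages: apart from the two branches, both
  paths stay away from it.\<close>

lemma is_drawing_imp_arc_drawing:
  assumes G: "simple_graph G" and D: "is_drawing G f \<gamma>"
  obtains A where "arc_drawing G f A" "crossings G f A \<subseteq> multiple_points G f \<gamma>"
proof -
  have multiple: "p \<in> multiple_points G f \<gamma>" if "x \<in> fibre G f \<gamma> p" "y \<in> fibre G f \<gamma> p" "x \<noteq> y" for p x y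
    using that by (auto simp: multiple_points_def)
  have no_vertex: "Vertex_Point v \<notin> fibre G f \<gamma> p" if "p \<in> multiple_points G f \<gamma>" for v p
    using D that unfolding is_drawing_def by (metis cpoint.distinct(1) insertE singletonD)
  have inj: "inj_on f (verts G)"
  proof (rule inj_onI, rule ccontr)
    fix u v assume "u \<in> verts G" "v \<in> verts G" "f u = f v" "u \<noteq> v"
    then show False
      using multiple[of "Vertex_Point u" "f u" "Vertex_Point v"] no_vertex by (auto simp: fibre_iff)
  qed
  have ends: "path (\<gamma> e)" "{pathstart (\<gamma> e), pathfinish (\<gamma> e)} = f ` e" "e \<subseteq> verts G"
    if "e \<in> edges G" for e
    using that D G by (auto simp: is_drawing_def simple_graph_def)
  have "\<exists>B. arc_between B (f ` e) \<and> B \<subseteq> path_image (\<gamma> e)" if e: "e \<in> edges G" for e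
  proof -
    \<comment> \<open>\<open>path_contains_arc\<close> applies only to a path with distinct
      ends.\<close>
    have "card (f ` e) = 2"
      using e G inj by (metis card_image inj_on_subset simple_graph_def)
    then have "pathstart (\<gamma> e) \<noteq> pathfinish (\<gamma> e)"
      unfolding ends(2)[OF e, symmetric] by auto
    then obtain q where "arc q" "path_image q \<subseteq> path_image (\<gamma> e)"
      "pathstart q = pathstart (\<gamma> e)" "pathfinish q = pathfinish (\<gamma> e)"
      using path_contains_arc ends(1)[OF e] by metis
    then show ?thesis
      using ends(2)[OF e] unfolding arc_between_def by metis
  qed
  then obtain A where A: "\<And>e. e \<in> edges G \<Longrightarrow> arc_between (A e) (f ` e)"
    "\<And>e. e \<in> edges G \<Longrightarrow> A e \<subseteq> path_image (\<gamma> e)"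
    by metis
  have param: "\<exists>t. Edge_Point e t \<in> fibre G f \<gamma> p" if "e \<in> edges G" "p \<in> path_image (\<gamma> e)" "p \<notin> f ` e" for e p
    using that path_image_interior_parameter[of p "\<gamma> e"] ends(2)[OF that(1)] unfolding fibre_iff
    by (metis insertI1 insertI2)
  have vertex: "v \<in> e" if v: "e \<in> edges G" "v \<in> verts G" "f v \<in> A e" for e v
  proof (rule ccontr)
    assume "v \<notin> e"
    then have "f v \<notin> f ` e"
      using inj v ends(3) by (meson inj_on_image_mem_iff)
    then obtain t where "Edge_Point e t \<in> fibre G f \<gamma> (f v)"
      using param[of e "f v"] v A(2) by blast
    then show False
      using multiple[of "Edge_Point e t" "f v" "Vertex_Point v"] no_vertex[of "f v" v] v(2)
      by (simp add: fibre_iff)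
  qed
  have off_ends: "p \<notin> f ` e" if "p \<in> crossings G f A" "e \<in> edges G" for e p
    using that ends(3) by (auto simp: crossings_def)
  have param': "\<exists>t. Edge_Point e t \<in> fibre G f \<gamma> p" if "p \<in> crossings G f A" "e \<in> edges G" "p \<in> A e" for e p
    using param[OF that(2)] off_ends[OF that(1,2)] A(2)[OF that(2)] that(3) by blast
  have sub: "crossings G f A \<subseteq> multiple_points G f \<gamma>"
  proof
    fix p assume p: "p \<in> crossings G f A"
    then obtain e e' where "e \<in> edges G" "e' \<in> edges G" "e \<noteq> e'" "p \<in> A e" "p \<in> A e'"
      by (auto simp: crossings_def)
    then obtain s t where "Edge_Point e s \<in> fibre G f \<gamma> p" "Edge_Point e' t \<in> fibre G f \<gamma> p"
      using param'[OF p] by metis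
    then show "p \<in> multiple_points G f \<gamma>"
      using multiple[of "Edge_Point e s" p "Edge_Point e' t"] \<open>e \<noteq> e'\<close> by simp
  qed
  have cross: "\<exists>e\<in>edges G. \<exists>e'\<in>edges G. e \<noteq> e' \<and>
        crossing_germ (A e) (A e') p \<and> {d \<in> edges G. p \<in> A d} = {e, e'}"
    if p: "p \<in> crossings G f A" for p
  proof -
    obtain d d' where d: "d \<in> edges G" "d' \<in> edges G" "d \<noteq> d'" "p \<in> A d" "p \<in> A d'"
      using p by (auto simp: crossings_def)
    obtain e s e' t where fib: "fibre G f \<gamma> p = {Edge_Point e s, Edge_Point e' t}"
      and trans: "transversal_at (\<gamma> e) s (\<gamma> e') t"
      using D p sub unfolding is_drawing_def by blast
    have in_ee': "c \<in> {e, e'}" if "c \<in> edges G" "p \<in> A c" for c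
      using param'[OF p that] unfolding fib by auto
    then have dd: "{d, d'} = {e, e'}"
      using d by blast
    then have ee': "e \<noteq> e'" "e \<in> edges G" "e' \<in> edges G" "p \<in> A e" "p \<in> A e'"
      using d by (metis doubleton_eq_iff)+
    have "Edge_Point e s \<in> fibre G f \<gamma> p" "Edge_Point e' t \<in> fibre G f \<gamma> p"
      unfolding fib by simp_all
    then have p_at: "\<gamma> e s = p" "\<gamma> e' t = p"
      by (simp_all add: fibre_iff)
    obtain U h h' a b c d where U: "open U" "homeomorphism U (ball 0 1) h h'"
      and ab: "a < s" "s < b" "\<gamma> e ` {a<..<b} \<subseteq> U" "h ` \<gamma> e ` {a<..<b} = {z \<in> ball 0 1. Im z = 0}"
      and cd: "c < t" "t < d" "\<gamma> e' ` {c<..<d} \<subseteq> U" "h ` \<gamma> e' ` {c<..<d} = {z \<in> ball 0 1. Re z = 0}"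
      and h0: "h (\<gamma> e s) = 0"
      using trans unfolding transversal_at_def by (elim conjE exE) (rule that; assumption)
    have "s \<in> {a<..<b}"
      using ab by simp
    then have "p \<in> U"
      using ab(3) p_at by blast
    \<comment> \<open>Another parameter with value \<open>p\<close> on either edge would be a third
      point of the fibre.\<close>
    have remote: "p \<notin> \<gamma> e0 ` ({0..1} - {a0<..<b0})"
      if e0: "(e0, s0) \<in> {(e, s), (e', t)}" and "a0 < s0" "s0 < b0" for e0 s0 a0 b0
    proof
      assume "p \<in> \<gamma> e0 ` ({0..1} - {a0<..<b0})"
      then obtain r where r: "0 \<le> r" "r \<le> 1" "r \<notin> {a0<..<b0}" "\<gamma> e0 r = p"
        by auto
      have "e0 \<in> edges G"
        using e0 ee' by auto
      then have "p \<noteq> pathstart (\<gamma> e0)" "p \<noteq> pathfinish (\<gamma> e0)"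
        using off_ends[OF p] ends(2) by (metis insertI1, metis insertI1 insertI2)
      then have "r \<noteq> 0" "r \<noteq> 1"
        using r by (auto simp: pathstart_def pathfinish_def)
      then have "Edge_Point e0 r \<in> fibre G f \<gamma> p"
        using r \<open>e0 \<in> edges G\<close> by (simp add: fibre_iff)
      then have "r = s0"
        using e0 ee'(1) unfolding fib by auto
      then show False
        using r that by simp
    qed
    \<comment> \<open>Within \<open>N\<close> the two edges consist only of the branches that the
      chart describes.\<close>
    define N where "N = - (\<gamma> e ` ({0..1} - {a<..<b}) \<union> \<gamma> e' ` ({0..1} - {c<..<d}))"
    have compact: "compact (\<gamma> e0 ` ({0..1} - {a0<..<b0}))" if "e0 \<in> edges G" for e0 a0 b0
    proof (rule compact_continuous_image)
      show "continuous_on ({0..1} - {a0<..<b0}) (\<gamma> e0)"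
        using ends(1)[OF that] unfolding path_def by (rule continuous_on_subset) auto
      show "compact ({0..1} - {a0<..<b0})"
        by (simp add: compact_diff)
    qed
    have N: "open N" "p \<in> N"
      using compact ee' remote[of e s a b] remote[of e' t c d] ab cd
      by (auto simp: N_def compact_imp_closed open_Compl simp del: Compl_Un intro!: closed_Un)
    obtain g where g: "arc g" "path_image g = A e" "{pathstart g, pathfinish g} = f ` e"
      using A(1) ee' unfolding arc_between_def by blast
    obtain k where k: "arc k" "path_image k = A e'" "{pathstart k, pathfinish k} = f ` e'"
      using A(1) ee' unfolding arc_between_def by blast
    have "crossing_germ (A e) (A e') p"
    proof (rule crossing_germ_subarcs[OF U(1) \<open>p \<in> U\<close> U(2) _ N g(1,2) ee'(4) _ _ k(1,2) ee'(5)])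
      show "h p = 0"
        using h0 p_at by simp
      show "p \<noteq> pathstart g" "p \<noteq> pathfinish g" "p \<noteq> pathstart k" "p \<noteq> pathfinish k"
        using off_ends[OF p] ee' g(3) k(3) by blast+
      fix x
      show "Im (h x) = 0" if "x \<in> A e" "x \<in> N" "x \<in> U"
      proof -
        have "x \<in> \<gamma> e ` {a<..<b}"
          using that A(2)[OF ee'(2)] unfolding N_def path_image_def by blast
        then show ?thesis
          using ab(4) by blast
      qed
      show "Re (h x) = 0" if "x \<in> A e'" "x \<in> N" "x \<in> U"
      proof -
        have "x \<in> \<gamma> e' ` {c<..<d}"
          using that A(2)[OF ee'(3)] unfolding N_def path_image_def by blast
        then show ?thesis
          using cd(4) by blast
      qed
    qed
    moreover have "{d \<in> edges G. p \<in> A d} = {e, e'}"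
      using ee' in_ee' by blast
    ultimately show ?thesis
      using ee' by blast
  qed
  have "finite (crossings G f A)"
    using D sub finite_subset by (auto simp: is_drawing_def)
  then have "arc_drawing G f A"
    unfolding arc_drawing_def using inj A(1) vertex cross by blast
  then show thesis
    using that sub by blast
qed

lemma arc_drawing_imp_is_drawing:
  assumes G: "simple_graph G" and D: "arc_drawing G f A"
  obtains \<gamma> where "is_drawing G f \<gamma>" "multiple_points G f \<gamma> = crossings G f A"
proof -
  have inj: "inj_on f (verts G)" and vertex: "\<And>e v. \<lbrakk>e \<in> edges G; v \<in> verts G; f v \<in> A e\<rbrakk> \<Longrightarrow> v \<in> e"
    and fin: "finite (crossings G f A)"
    using D by (auto simp: arc_drawing_def)
  obtain \<gamma> where \<gamma>: "\<And>e. e \<in> edges G \<Longrightarrow> arc (\<gamma> e)" "\<And>e. e \<in> edges G \<Longrightarrow> path_image (\<gamma> e) = A e"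
    "\<And>e. e \<in> edges G \<Longrightarrow> {pathstart (\<gamma> e), pathfinish (\<gamma> e)} = f ` e"
    using D unfolding arc_drawing_def arc_between_def by metis
  have sub: "e \<subseteq> verts G" if "e \<in> edges G" for e
    using that G by (auto simp: simple_graph_def)
  have inj_edge: "s = t" if "e \<in> edges G" "0 \<le> s" "s \<le> 1" "0 \<le> t" "t \<le> 1" "\<gamma> e s = \<gamma> e t" for e s t
    using \<gamma>(1)[OF that(1)] that by (auto simp: arc_def inj_on_def)
  have in_A: "\<gamma> e t \<in> A e" if "e \<in> edges G" "0 < t" "t < 1" for e t
    using \<gamma>(2)[OF that(1)] that by (auto simp: path_image_def)
  have not_vertex: "\<gamma> e t \<notin> f ` verts G" if "e \<in> edges G" "0 < t" "t < 1" for e t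
  proof
    assume "\<gamma> e t \<in> f ` verts G"
    then obtain v where "v \<in> verts G" "\<gamma> e t = f v"
      by auto
    then have "\<gamma> e t \<in> f ` e"
      using vertex[of e v] in_A[OF that] that by auto
    then have "\<gamma> e t = \<gamma> e 0 \<or> \<gamma> e t = \<gamma> e 1"
      unfolding \<gamma>(3)[OF that(1), symmetric] by (auto simp: pathstart_def pathfinish_def)
    then have "t = 0 \<or> t = 1"
      using inj_edge[OF that(1), of t 0] inj_edge[OF that(1), of t 1] that(2,3) by (metis less_imp_le order.refl zero_le_one)
    then show False
      using that by simp
  qed
  have param: "\<exists>t. 0 < t \<and> t < 1 \<and> \<gamma> e t = p" if "e \<in> edges G" "p \<in> A e" "p \<notin> f ` verts G" for e p
  proof -
    have "p \<noteq> pathstart (\<gamma> e)" "p \<noteq> pathfinish (\<gamma> e)"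
      using that \<gamma>(3)[OF that(1)] sub[OF that(1)] by blast+
    then show ?thesis
      using path_image_interior_parameter \<gamma>(2)[OF that(1)] that(2) by metis
  qed
  have mp: "multiple_points G f \<gamma> = crossings G f A"
  proof (intro equalityI subsetI)
    fix p assume "p \<in> multiple_points G f \<gamma>"
    then obtain x y where xy: "x \<in> fibre G f \<gamma> p" "y \<in> fibre G f \<gamma> p" "x \<noteq> y"
      by (auto simp: multiple_points_def)
    have "\<exists>e e' s t. x = Edge_Point e s \<and> y = Edge_Point e' t \<and> e \<noteq> e'"
    proof (cases x; cases y)
      fix u v assume "x = Vertex_Point u" "y = Vertex_Point v"
      then show ?thesis
        using xy inj by (auto simp: fibre_iff inj_on_def)
    next
      fix u e t assume "x = Vertex_Point u" "y = Edge_Point e t"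
      then show ?thesis
        using xy not_vertex by (auto simp: fibre_iff)
    next
      fix u e t assume "y = Vertex_Point u" "x = Edge_Point e t"
      then show ?thesis
        using xy not_vertex by (auto simp: fibre_iff)
    next
      fix e s e' t assume *: "x = Edge_Point e s" "y = Edge_Point e' t"
      then have "e \<noteq> e'"
        using xy inj_edge[of e s t] by (auto simp: fibre_iff)
      then show ?thesis
        using * by blast
    qed
    then obtain e e' s t where *: "x = Edge_Point e s" "y = Edge_Point e' t" "e \<noteq> e'"
      by blast
    then show "p \<in> crossings G f A"
      using xy not_vertex in_A unfolding crossings_def mem_Collect_eq by (metis fibre_iff(2))
  next
    fix p assume p: "p \<in> crossings G f A"
    then obtain e e' where e: "e \<in> edges G" "e' \<in> edges G" "e \<noteq> e'" "p \<in> A e" "p \<in> A e'" "p \<notin> f ` verts G"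
      by (auto simp: crossings_def)
    then obtain s t where "Edge_Point e s \<in> fibre G f \<gamma> p" "Edge_Point e' t \<in> fibre G f \<gamma> p"
      using param unfolding fibre_iff by metis
    then show "p \<in> multiple_points G f \<gamma>"
      using e(3) unfolding multiple_points_def by blast
  qed
  have "\<exists>e s e' t. fibre G f \<gamma> p = {Edge_Point e s, Edge_Point e' t} \<and> transversal_at (\<gamma> e) s (\<gamma> e') t"
    if p: "p \<in> crossings G f A" for p
  proof -
    obtain e e' where e: "e \<in> edges G" "e' \<in> edges G" "e \<noteq> e'" "crossing_germ (A e) (A e') p"
      and ee': "{d \<in> edges G. p \<in> A d} = {e, e'}"
      using D p unfolding arc_drawing_def by meson
    have pv: "p \<notin> f ` verts G"
      using p by (simp add: crossings_def)
    have "p \<in> A e" "p \<in> A e'"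
      using ee' by auto
    then obtain s t where s: "0 < s" "s < 1" "\<gamma> e s = p" and t: "0 < t" "t < 1" "\<gamma> e' t = p"
      using param pv e by metis
    have "fibre G f \<gamma> p = {Edge_Point e s, Edge_Point e' t}"
    proof (intro equalityI subsetI)
      fix x assume x: "x \<in> fibre G f \<gamma> p"
      show "x \<in> {Edge_Point e s, Edge_Point e' t}"
      proof (cases x)
        case (Vertex_Point v)
        then show ?thesis
          using x pv by (auto simp: fibre_iff)
      next
        case (Edge_Point d r)
        then have r: "d \<in> edges G" "0 < r" "r < 1" "\<gamma> d r = p"
          using x by (auto simp: fibre_iff)
        then consider "d = e" | "d = e'"
          using in_A[of d r] ee' by blast
        then show ?thesis
        proof cases
          case 1
          then have "r = s"
            using r s by (intro inj_edge[of e]) auto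
          then show ?thesis
            using Edge_Point 1 by simp
        next
          case 2
          then have "r = t"
            using r t by (intro inj_edge[of e']) auto
          then show ?thesis
            using Edge_Point 2 by simp
        qed
      qed
    qed (use s t e in \<open>auto simp: fibre_iff\<close>)
    moreover have "transversal_at (\<gamma> e) s (\<gamma> e') t"
      using e \<gamma>(1,2) s t by (intro crossing_germ_imp_transversal_at[where p = p]) auto
    ultimately show ?thesis
      by blast
  qed
  then have "is_drawing G f \<gamma>"
    unfolding is_drawing_def mp using \<gamma>(1,3) fin arc_imp_path by blast
  then show thesis
    using that mp by blast
qed

lemma crossing_number_le:
  assumes "simple_graph G" "arc_drawing G f A"
  shows "crossing_number G \<le> card (crossings G f A)"
proof -
  obtain \<gamma> where "is_drawing G f \<gamma>" "multiple_points G f \<gamma> = crossings G f A"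
    using arc_drawing_imp_is_drawing[OF assms] .
  then show ?thesis
    unfolding crossing_number_def by (intro Least_le) metis
qed

text \<open>A \<open>LEAST\<close> over an empty set says nothing, hence the assumed drawing
  \<open>A0\<close>. Passing to arcs cannot undercut the minimum, because an arc drawing yields a
  drawing again.\<close>

lemma crossing_number_attained:
  assumes "simple_graph G" "arc_drawing G f0 A0"
  obtains f A where "arc_drawing G f A" "card (crossings G f A) = crossing_number G"
proof -
  obtain \<gamma>0 where "is_drawing G f0 \<gamma>0"
    using arc_drawing_imp_is_drawing[OF assms] .
  then have "\<exists>f \<gamma>. is_drawing G f \<gamma> \<and> card (multiple_points G f \<gamma>) = card (multiple_points G f0 \<gamma>0)"
    by blast
  then have "\<exists>f \<gamma>. is_drawing G f \<gamma> \<and> card (multiple_points G f \<gamma>) = crossing_number G"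
    unfolding crossing_number_def by (rule LeastI)
  then obtain f \<gamma> where D: "is_drawing G f \<gamma>" "card (multiple_points G f \<gamma>) = crossing_number G"
    by blast
  obtain A where A: "arc_drawing G f A" "crossings G f A \<subseteq> multiple_points G f \<gamma>"
    using is_drawing_imp_arc_drawing[OF assms(1) D(1)] .
  have "card (crossings G f A) \<le> crossing_number G"
    using A(2) D card_mono[of "multiple_points G f \<gamma>" "crossings G f A"] by (auto simp: is_drawing_def)
  then show thesis
    using that A crossing_number_le[OF assms(1) A(1)] by force
qed

section \<open>Delta-Y moves at a crossing of adjacent edges\<close>

lemma arc_between_oriented:
  assumes "arc_between A {a, b}"
  obtains g where "arc g" "path_image g = A" "pathstart g = a" "pathfinish g = b"
proof -
  obtain g where g: "arc g" "path_image g = A" "{pathstart g, pathfinish g} = {a, b}"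
    using assms by (auto simp: arc_between_def)
  then consider "pathstart g = a" "pathfinish g = b" | "pathstart g = b" "pathfinish g = a"
    by (auto simp: doubleton_eq_iff)
  then show thesis
  proof cases
    case 2
    then show thesis
      using that[of "reversepath g"] g by (simp add: arc_reversepath)
  qed (use that g in blast)
qed

lemma arc_between_segment: "a \<noteq> b \<Longrightarrow> arc_between (closed_segment a b) {a, b}"
  unfolding arc_between_def by (intro exI[of _ "linepath a b"]) (auto simp: arc_linepath)

lemma arc_between_compact: "arc_between A X \<Longrightarrow> compact A"
  by (auto simp: arc_between_def arc_imp_path compact_path_image)

lemma arc_between_join:
  assumes "arc_between A {a, p}" "arc_between B {p, b}" "A \<inter> B \<subseteq> {p}"
  shows "arc_between (A \<union> B) {a, b}"
proof -
  obtain g where g: "arc g" "path_image g = A" "pathstart g = a" "pathfinish g = p"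
    using arc_between_oriented[OF assms(1)] .
  obtain k where k: "arc k" "path_image k = B" "pathstart k = p" "pathfinish k = b"
    using arc_between_oriented[OF assms(2)] .
  show ?thesis
    unfolding arc_between_def
    by (rule exI[of _ "g +++ k"]) (use g k assms(3) in \<open>auto simp: path_image_join intro!: arc_join\<close>)
qed

lemma arc_between_subpath:
  assumes "arc g" "0 \<le> u" "u < w" "w \<le> 1"
  shows "arc_between (g ` {u..w}) {g u, g w}"
  using assms unfolding arc_between_def
  by (intro exI[of _ "subpath u w g"]) (simp add: path_image_subpath arc_subpath_arc)

lemma arc_between_split:
  assumes "arc_between A {a, b}" "p \<in> A" "p \<noteq> a" "p \<noteq> b"
  obtains B C where "arc_between B {p, a}" "arc_between C {p, b}" "B \<union> C = A" "B \<inter> C = {p}"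
    "b \<notin> B" "a \<notin> C"
proof -
  obtain g where g: "arc g" "path_image g = A" "pathstart g = a" "pathfinish g = b"
    using arc_between_oriented[OF assms(1)] .
  obtain s where s: "g s = p" "0 < s" "s < 1"
    using path_image_interior_parameter[of p g] g assms by auto
  have inj: "inj_on g {0..1}" and ends: "g 0 = a" "g 1 = b"
    using g by (auto simp: arc_def pathstart_def pathfinish_def)
  show thesis
  proof (rule that[of "g ` {0..s}" "g ` {s..1}"])
    show "arc_between (g ` {0..s}) {p, a}" "arc_between (g ` {s..1}) {p, b}"
      using arc_between_subpath[OF g(1), of 0 s] arc_between_subpath[OF g(1), of s 1] s ends
      by (simp_all add: insert_commute)
    have "{0..1} = {0..s} \<union> {s..1}"
      using s by auto
    then show "g ` {0..s} \<union> g ` {s..1} = A"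
      using g by (metis image_Un path_image_def)
    have "g ` {0..s} \<inter> g ` {s..1} = g ` ({0..s} \<inter> {s..1})"
      using s by (intro inj_on_image_Int[OF inj, symmetric]) auto
    also have "{0..s} \<inter> {s..1} = {s}"
      using s by auto
    finally show "g ` {0..s} \<inter> g ` {s..1} = {p}"
      using s by simp
    have "g 1 \<notin> g ` {0..s}" "g 0 \<notin> g ` {s..1}"
      using s by (subst inj_on_image_mem_iff[OF inj]; auto)+
    then show "b \<notin> g ` {0..s}" "a \<notin> g ` {s..1}"
      using ends by auto
  qed
qed

text \<open>An arc may leave and re-enter the disc on its way to the centre; cutting at the first
  point of the circle discards everything uncontrolled.\<close>

lemma arc_between_first_hit:
  assumes A: "arc_between A {a, c}" and a: "a \<notin> cball c \<rho>" and \<rho>: "0 < \<rho>"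
  obtains B P where "arc_between B {a, P}" "B \<subseteq> A" "B \<inter> cball c \<rho> = {P}" "P \<in> sphere c \<rho>"
proof -
  obtain g where g: "arc g" "path_image g = A" "pathstart g = a" "pathfinish g = c"
    using arc_between_oriented[OF A] .
  have "path g" "pathstart g \<in> closure (- cball c \<rho>)" "pathfinish g \<notin> - cball c \<rho>"
    using g a \<rho> closure_subset[of "- cball c \<rho>"] by (auto simp: arc_imp_path)
  then obtain u where u: "0 \<le> u" "u \<le> 1" "g u \<in> frontier (- cball c \<rho>)"
    "path_image (subpath 0 u g) - {g u} \<subseteq> interior (- cball c \<rho>)"
    using subpath_to_frontier by metis
  have gu: "g u \<in> sphere c \<rho>"
    using u(3) \<rho> by (simp add: frontier_complement)
  have "u \<noteq> 0"
    using gu a g by (auto simp: pathstart_def)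
  show thesis
  proof (rule that)
    show "arc_between (path_image (subpath 0 u g)) {a, g u}"
      using arc_between_subpath[OF g(1), of 0 u] g(3) u \<open>u \<noteq> 0\<close> by (simp add: path_image_subpath pathstart_def)
    show "path_image (subpath 0 u g) \<subseteq> A"
      using g u path_image_subpath_subset[of 0 u g] by auto
    show "g u \<in> sphere c \<rho>"
      by (rule gu)
    have "g u \<in> path_image (subpath 0 u g)"
      using u by (auto simp: path_image_subpath)
    then show "path_image (subpath 0 u g) \<inter> cball c \<rho> = {g u}"
      using u(4) gu interior_subset[of "- cball c \<rho>"] by auto
  qed
qed

section \<open>The graph after a move, and crossings inherited from before\<close>

definition delta_Y_graph :: "'a ugraph \<Rightarrow> 'a \<Rightarrow> 'a \<Rightarrow> 'a \<Rightarrow> 'a \<Rightarrow> 'a ugraph" where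
  "delta_Y_graph G a b c v = UGraph (insert v (verts G))
     ((edges G - {{a, b}, {b, c}, {c, a}}) \<union> {{v, a}, {v, b}, {v, c}})"

lemma delta_Y_move_delta_Y_graph:
  assumes "distinct [a, b, c]" "{a, b} \<in> edges G" "{b, c} \<in> edges G" "{c, a} \<in> edges G" "v \<notin> verts G"
  shows "delta_Y_move G (delta_Y_graph G a b c v)"
  unfolding delta_Y_move_def delta_Y_graph_def using assms by (metis distinct_length_2_or_more)

lemma edge_subset:
  assumes "simple_graph G" "e \<in> edges G"
  shows "e \<subseteq> verts G"
  using assms by (auto simp: simple_graph_def)

lemma crossing_edges:
  assumes "arc_drawing G f A" "p \<in> crossings G f A" "e \<in> edges G" "e' \<in> edges G" "e \<noteq> e'" "p \<in> A e" "p \<in> A e'"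
  shows "{d \<in> edges G. p \<in> A d} = {e, e'}" "crossing_germ (A e) (A e') p \<or> crossing_germ (A e') (A e) p"
proof -
  obtain d d' where d: "crossing_germ (A d) (A d') p" "{d \<in> edges G. p \<in> A d} = {d, d'}"
    using assms(1,2) unfolding arc_drawing_def by meson
  moreover have "e \<in> {d \<in> edges G. p \<in> A d}" "e' \<in> {d \<in> edges G. p \<in> A d}"
    using assms by auto
  ultimately have "e = d \<and> e' = d' \<or> e = d' \<and> e' = d"
    using assms(5) by auto
  then show "{d \<in> edges G. p \<in> A d} = {e, e'}" "crossing_germ (A e) (A e') p \<or> crossing_germ (A e') (A e) p"
    using d by auto
qed

text \<open>\<open>src d\<close> is the old edge that the new edge \<open>d\<close> follows near
  \<open>q\<close>. Injectivity of \<open>src\<close> at \<open>q\<close> makes two meeting new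
  edges stem from two different old ones, so \<open>q\<close> was a crossing already, and it keeps a
  third new edge away. The redrawing at a crossing takes \<open>N = UNIV\<close>, the one near a
  vertex the complement of a disc.\<close>

lemma crossing_transfer:
  assumes D: "arc_drawing G f A" and q: "q \<notin> f ` verts G" and N: "open N" "q \<in> N"
    and e: "e \<in> E" "e' \<in> E" "e \<noteq> e'" "q \<in> A' e" "q \<in> A' e'"
    and src: "\<And>d. \<lbrakk>d \<in> E; q \<in> A' d\<rbrakk> \<Longrightarrow> src d \<in> edges G \<and> A' d \<inter> N \<subseteq> A (src d)"
    and arcs: "\<And>d. \<lbrakk>d \<in> E; q \<in> A' d\<rbrakk> \<Longrightarrow> \<exists>X. arc_between (A' d) X \<and> q \<notin> X"
    and inj: "inj_on src {d \<in> E. q \<in> A' d}"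
  shows "q \<in> crossings G f A" "{d \<in> edges G. q \<in> A d} = {src e, src e'}"
    "\<exists>e\<in>E. \<exists>e'\<in>E. e \<noteq> e' \<and> crossing_germ (A' e) (A' e') q \<and> {d \<in> E. q \<in> A' d} = {e, e'}"
proof -
  have ne: "src e \<noteq> src e'"
    using inj e by (auto simp: inj_on_def)
  have s: "src e \<in> edges G" "src e' \<in> edges G" "q \<in> A (src e)" "q \<in> A (src e')"
    using src[of e] src[of e'] e N by auto
  show cr: "q \<in> crossings G f A"
    using q s ne by (auto simp: crossings_def)
  show eq: "{d \<in> edges G. q \<in> A d} = {src e, src e'}"
    by (rule crossing_edges(1)[OF D cr s(1,2) ne s(3,4)])
  have "{d \<in> E. q \<in> A' d} = {e, e'}"
  proof (intro equalityI subsetI)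
    fix d assume d: "d \<in> {d \<in> E. q \<in> A' d}"
    then have "src d \<in> {d \<in> edges G. q \<in> A d}"
      using src[of d] N by auto
    then have "src d = src e \<or> src d = src e'"
      unfolding eq by simp
    then show "d \<in> {e, e'}"
      using inj d e by (auto simp: inj_on_def)
  qed (use e in auto)
  moreover obtain X Y where "arc_between (A' e) X" "q \<notin> X" "arc_between (A' e') Y" "q \<notin> Y"
    using arcs e by meson
  then have "crossing_germ (A' e) (A' e') q \<or> crossing_germ (A' e') (A' e) q"
    using crossing_edges(2)[OF D cr s(1,2) ne s(3,4)] src[of e] src[of e'] e N
      arc_between_crossing_germ_cong[of "A (src e)" "A (src e')" q N "A' e" X "A' e'" Y]
      arc_between_crossing_germ_cong[of "A (src e')" "A (src e)" q N "A' e'" Y "A' e" X]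
    by blast
  ultimately show "\<exists>e\<in>E. \<exists>e'\<in>E. e \<noteq> e' \<and> crossing_germ (A' e) (A' e') q \<and> {d \<in> E. q \<in> A' d} = {e, e'}"
    using e by (metis insert_commute)
qed

text \<open>All three star edges are pieces of \<open>A {a, b}\<close> and \<open>A {c, a}\<close>,
  so every crossing is inherited. The piece of \<open>A {c, a}\<close> between \<open>p\<close> and
  \<open>f a\<close> is dropped, and so is all of \<open>A {b, c}\<close>.\<close>

lemma delta_Y_at_crossing:
  assumes G: "simple_graph G" and D: "arc_drawing G f A" and abc: "distinct [a, b, c]"
    and ab: "{a, b} \<in> edges G" and bc: "{b, c} \<in> edges G" and ca: "{c, a} \<in> edges G" and v: "v \<notin> verts G"
    and p: "p \<in> crossings G f A" "p \<in> A {a, b}" "p \<in> A {c, a}"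
  obtains f' A' where "arc_drawing (delta_Y_graph G a b c v) f' A'"
    "crossings (delta_Y_graph G a b c v) f' A' \<subseteq> crossings G f A - {p}"
proof -
  define H where "H = delta_Y_graph G a b c v"
  have vH: "verts H = insert v (verts G)"
    and eH: "edges H = (edges G - {{a, b}, {b, c}, {c, a}}) \<union> {{v, a}, {v, b}, {v, c}}"
    by (auto simp: H_def delta_Y_graph_def)
  have vs: "a \<in> verts G" "b \<in> verts G" "c \<in> verts G"
    using ab bc edge_subset[OF G] by auto
  then have vne: "v \<noteq> a" "v \<noteq> b" "v \<noteq> c" "a \<noteq> b" "b \<noteq> c" "c \<noteq> a"
    using v abc by auto
  have inj: "inj_on f (verts G)"
    and arc: "\<And>e. e \<in> edges G \<Longrightarrow> arc_between (A e) (f ` e)"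
    and vertex: "\<And>e w. \<lbrakk>e \<in> edges G; w \<in> verts G; f w \<in> A e\<rbrakk> \<Longrightarrow> w \<in> e"
    and fin: "finite (crossings G f A)"
    using D by (auto simp: arc_drawing_def)
  have pv: "p \<notin> f ` verts G"
    using p by (simp add: crossings_def)
  have pne: "p \<noteq> f a" "p \<noteq> f b" "p \<noteq> f c"
    using pv vs by auto
  obtain B C where BC: "arc_between B {p, f a}" "arc_between C {p, f b}" "B \<union> C = A {a, b}"
    "B \<inter> C = {p}" "f b \<notin> B" "f a \<notin> C"
    using arc_between_split[of "A {a, b}" "f a" "f b" p] arc[OF ab] p(2) pne by auto
  obtain E where E: "arc_between E {p, f c}" "E \<subseteq> A {c, a}" "f a \<notin> E"
    using arc_between_split[of "A {c, a}" "f c" "f a" p] arc[OF ca] p(3) pne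
    by (metis Un_upper1 image_empty image_insert)
  define f' where "f' = f(v := p)"
  define A' where "A' e = (if e = {v, a} then B else if e = {v, b} then C else if e = {v, c} then E else A e)" for e
  \<comment> \<open>Two star edges share the source \<open>{a, b}\<close>, but their arcs meet only
    in \<open>p\<close>. So \<open>src\<close> is injective on the edges through any point except
    \<open>p\<close>, which is now a vertex.\<close>
  define src where "src e = (if e = {v, a} \<or> e = {v, b} then {a, b} else if e = {v, c} then {c, a} else e)" for e
  have star: "{v, a} \<noteq> {v, b}" "{v, b} \<noteq> {v, c}" "{v, a} \<noteq> {v, c}" "{a, b} \<noteq> {c, a}"
    using vne by (auto simp: doubleton_eq_iff)
  have A'_star: "A' {v, a} = B" "A' {v, b} = C" "A' {v, c} = E"
    using star by (auto simp: A'_def)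
  have src_star: "src {v, a} = {a, b}" "src {v, b} = {a, b}" "src {v, c} = {c, a}"
    using star by (auto simp: src_def)
  have old: "v \<notin> e" "A' e = A e" "src e = e" "f' ` e = f ` e" "e \<subseteq> verts G"
    if "e \<in> edges G" for e
  proof -
    show "e \<subseteq> verts G"
      using edge_subset[OF G that] .
    then show "v \<notin> e"
      using v by blast
    then show "A' e = A e" "src e = e" "f' ` e = f ` e"
      by (auto simp: A'_def src_def f'_def image_def)
  qed
  have edge_cases: "e = {v, a} \<or> e = {v, b} \<or> e = {v, c} \<or> (e \<in> edges G \<and> e \<noteq> {a, b} \<and> e \<noteq> {b, c} \<and> e \<noteq> {c, a})"
    if "e \<in> edges H" for e
    using that by (auto simp: eH)
  have f'_star: "f' ` {v, w} = {p, f w}" if "w \<noteq> v" for w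
    using that by (auto simp: f'_def)
  have arc': "arc_between (A' e) (f' ` e)" if "e \<in> edges H" for e
    using edge_cases[OF that] A'_star BC(1,2) E(1) old(2,4) arc f'_star vne by metis
  have src: "src e \<in> edges G" "A' e \<subseteq> A (src e)" if "e \<in> edges H" for e
  proof -
    show "src e \<in> edges G"
      using edge_cases[OF that] src_star ab ca old(3) by metis
    show "A' e \<subseteq> A (src e)"
      using edge_cases[OF that] src_star A'_star BC(3) E(2) old(2,3) by (metis Un_upper1 Un_upper2 order.refl)
  qed
  have inj_src: "e = e'" if e: "e \<in> edges H" "e' \<in> edges H" "src e = src e'" "q \<in> A' e" "q \<in> A' e'" "q \<noteq> p" for e e' q
  proof -
    have "\<not> (q \<in> A' {v, a} \<and> q \<in> A' {v, b})"
      using e BC(4) A'_star by auto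
    then show ?thesis
      using edge_cases[OF e(1)] edge_cases[OF e(2)] e old(3) star(4) src_star by metis
  qed
  have f'_verts: "f' ` verts H = insert p (f ` verts G)"
    using v by (auto simp: vH f'_def)
  have trans: "q \<in> crossings G f A - {p}"
    "\<exists>e\<in>edges H. \<exists>e'\<in>edges H. e \<noteq> e' \<and> crossing_germ (A' e) (A' e') q \<and> {d \<in> edges H. q \<in> A' d} = {e, e'}"
    if q_cross: "q \<in> crossings H f' A'" for q
  proof -
    obtain e e' where q: "q \<noteq> p" "q \<notin> f ` verts G" and e: "e \<in> edges H" "e' \<in> edges H" "e \<noteq> e'" "q \<in> A' e" "q \<in> A' e'"
      using q_cross f'_verts by (auto simp: crossings_def)
    have arcs: "\<exists>X. arc_between (A' d) X \<and> q \<notin> X" if "d \<in> edges H" for d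
    proof -
      have "d \<subseteq> verts H"
        using edge_cases[OF that] vs old(5) by (auto simp: vH)
      then have "q \<notin> f' ` d"
        using q f'_verts by blast
      then show ?thesis
        using arc'[OF that] by blast
    qed
    have injq: "inj_on src {d \<in> edges H. q \<in> A' d}"
      using inj_src[of _ _ q] q by (auto intro!: inj_onI)
    have src': "src d \<in> edges G \<and> A' d \<inter> UNIV \<subseteq> A (src d)" if "d \<in> edges H" for d
      using src[OF that] by simp
    note T = crossing_transfer[where src = src, OF D q(2) open_UNIV UNIV_I e src' arcs injq]
    show "q \<in> crossings G f A - {p}"
      using T(1) q by simp
    show "\<exists>e\<in>edges H. \<exists>e'\<in>edges H. e \<noteq> e' \<and> crossing_germ (A' e) (A' e') q \<and> {d \<in> edges H. q \<in> A' d} = {e, e'}"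
      by (rule T(3))
  qed
  \<comment> \<open>No third edge passes through \<open>p\<close>, so the new vertex lies on its own
    star only.\<close>
  have p_edges: "{d \<in> edges G. p \<in> A d} = {{a, b}, {c, a}}"
    using crossing_edges(1)[OF D p(1) ab ca star(4) p(2,3)] .
  have vertex': "w \<in> e" if e: "e \<in> edges H" and w: "w \<in> verts H" "f' w \<in> A' e" for e w
  proof (cases "w = v")
    case True
    then have "p \<in> A' e"
      using w by (simp add: f'_def)
    then show ?thesis
      using edge_cases[OF e] p_edges old(2) True by blast
  next
    case False
    then have fw: "w \<in> verts G" "f w \<in> A' e"
      using w by (auto simp: f'_def vH)
    then have "w \<in> src e"
      using src[OF e] vertex by blast
    then show ?thesis
      using edge_cases[OF e] fw(2) A'_star BC(5,6) E(3) src_star old(3) by (metis insert_iff singletonD)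
  qed
  have "arc_drawing H f' A'"
    unfolding arc_drawing_def
  proof (intro conjI ballI impI)
    show "inj_on f' (verts H)"
      using inj pv v by (auto simp: vH f'_def inj_on_def)
    show "finite (crossings H f' A')"
      using trans(1) by (intro finite_subset[OF _ fin]) auto
  qed (fact arc' vertex' trans(2))+
  then show thesis
    using that trans(1) unfolding H_def by blast
qed

section \<open>Delta-Y moves near a vertex\<close>

lemma closed_segment_complexE:
  fixes a b :: complex
  assumes "x \<in> closed_segment a b"
  obtains u where "0 \<le> u" "u \<le> 1" "x = a + of_real u * (b - a)"
  using assms by (auto simp: in_segment scaleR_conv_of_real algebra_simps)

lemma segment_in_ball:
  fixes P Q c x :: complex
  assumes "P \<in> cball c \<rho>" "Q \<in> cball c \<rho>" "x \<in> closed_segment P Q" "x \<noteq> P" "x \<noteq> Q"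
  shows "x \<in> ball c \<rho>"
proof -
  have "x \<in> open_segment P Q"
    using assms by (simp add: open_segment_def)
  then show ?thesis
    using dist_decreases_open_segment[of x P Q c] assms by auto
qed

text \<open>A second common point would put \<open>P\<close> and \<open>Q\<close> on one ray from
  \<open>c\<close>. The nearer one would then lie on the segment from \<open>c\<close> to the other,
  hence strictly inside the disc and not on its circle.\<close>

lemma radial_segments_meet:
  fixes P Q c o' :: complex
  assumes P: "P \<in> sphere o' \<rho>" and Q: "Q \<in> sphere o' \<rho>" and "P \<noteq> Q" and c: "c \<in> ball o' \<rho>"
  shows "closed_segment P c \<inter> closed_segment Q c \<subseteq> {c}"
proof -
  have on_ray: False
    if PQ: "P \<in> sphere o' \<rho>" "Q \<in> sphere o' \<rho>" "P \<noteq> Q" and st: "0 < s" "s \<le> t"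
      and eq: "of_real s * (P - c) = of_real t * (Q - c)" for P Q s t
  proof -
    define r where "r = s / t"
    have "Q - c = of_real r * (P - c)"
      using eq st by (simp add: r_def field_simps)
    then have "Q = c + of_real r * (P - c)"
      by (simp add: algebra_simps)
    then have "Q = (1 - (1 - r)) *\<^sub>R P + (1 - r) *\<^sub>R c"
      by (simp add: scaleR_conv_of_real algebra_simps)
    moreover have "0 \<le> 1 - r" "1 - r \<le> 1"
      using st by (auto simp: r_def)
    ultimately have "Q \<in> closed_segment P c"
      unfolding in_segment by blast
    then have "Q \<in> ball o' \<rho>"
      using PQ c by (intro segment_in_ball[of P o' \<rho> c Q]) auto
    then show False
      using PQ by auto
  qed
  show ?thesis
  proof safe
    fix x assume x: "x \<in> closed_segment P c" "x \<in> closed_segment Q c"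
    obtain s where s: "0 \<le> s" "x = c + of_real s * (P - c)"
      using x(1) closed_segment_complexE by (metis closed_segment_commute)
    obtain t where t: "0 \<le> t" "x = c + of_real t * (Q - c)"
      using x(2) closed_segment_complexE by (metis closed_segment_commute)
    show "x = c"
    proof (rule ccontr)
      assume "x \<noteq> c"
      then have "0 < s" "0 < t"
        using s t by (auto simp: less_le)
      then show False
        using on_ray[of P Q s t] on_ray[of Q P t s] s t assms by (cases "s \<le> t") auto
    qed
  qed
qed

text \<open>\<open>Im (cnj d * z)\<close> is the cross product of \<open>d\<close> and
  \<open>z\<close>; it vanishes when they are parallel. A centre on the line is pushed off it at a
  right angle by half the radius.\<close>

lemma exists_off_line:
  fixes c d P :: complex
  assumes "0 < \<rho>" "d \<noteq> 0"
  obtains c' where "c' \<in> ball c \<rho>" "Im (cnj d * (c' - P)) \<noteq> 0"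
proof (cases "Im (cnj d * (c - P)) = 0")
  case True
  define t where "t = \<rho> / (2 * norm d)"
  have t: "0 < t" "t * norm d < \<rho>"
    using assms by (auto simp: t_def)
  have "Im (cnj d * (c + \<i> * of_real t * d - P)) = Im (cnj d * (c - P)) + t * ((Re d)\<^sup>2 + (Im d)\<^sup>2)"
    by (simp add: algebra_simps power2_eq_square)
  moreover have "(Re d)\<^sup>2 + (Im d)\<^sup>2 > 0"
    using assms(2) by (simp add: complex_neq_0)
  moreover have "c + \<i> * of_real t * d \<in> ball c \<rho>"
    using t by (simp add: dist_norm norm_mult)
  ultimately show thesis
    using that[of "c + \<i> * of_real t * d"] True t(1) by (metis add_0 less_irrefl mult_pos_pos)
qed (use that[of c] assms in auto)

lemma chord_Im:
  fixes P Q x :: complex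
  assumes "x \<in> closed_segment P Q"
  shows "Im (cnj (Q - P) * (x - P)) = 0"
proof -
  obtain u where u: "x = P + of_real u * (Q - P)"
    using assms by (rule closed_segment_complexE)
  have "Im (cnj w * (of_real u * w)) = 0" for w
    by simp
  from this[of "Q - P"] show ?thesis
    unfolding u by (simp only: add_diff_cancel_left')
qed

lemma segment_Im:
  fixes P R c d x :: complex
  assumes "x = c + of_real t * (R - c)"
  shows "Im (cnj d * (x - P)) = Im (cnj d * (c - P)) + t * Im (cnj d * (R - c))"
  unfolding assms by (simp add: algebra_simps)

lemma closed_segment_subset_line:
  fixes a b q :: complex
  assumes "q \<in> closed_segment a b"
  shows "closed_segment a b \<subseteq> range (\<lambda>t. q + of_real t * (b - a))"
proof
  fix x assume "x \<in> closed_segment a b"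
  then obtain u where u: "x = a + of_real u * (b - a)"
    by (rule closed_segment_complexE)
  obtain w where w: "q = a + of_real w * (b - a)"
    using assms by (rule closed_segment_complexE)
  have "x = q + of_real (u - w) * (b - a)"
    unfolding u w by (simp add: algebra_simps)
  then show "x \<in> range (\<lambda>t. q + of_real t * (b - a))"
    by blast
qed

lemma crossingsI:
  "\<lbrakk>p \<notin> f ` verts G; e \<in> edges G; e' \<in> edges G; e \<noteq> e'; p \<in> A e; p \<in> A e'\<rbrakk> \<Longrightarrow> p \<in> crossings G f A"
  unfolding crossings_def by blast

lemma vertex_neighbourhood:
  assumes G: "simple_graph G" and D: "arc_drawing G f A" and c: "c \<in> verts G" and fin: "finite (edges G)"
  obtains \<rho> where "0 < \<rho>" "\<And>w. w \<in> verts G \<Longrightarrow> w \<noteq> c \<Longrightarrow> f w \<notin> cball (f c) \<rho>"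
    "cball (f c) \<rho> \<inter> crossings G f A = {}" "\<And>e. e \<in> edges G \<Longrightarrow> c \<notin> e \<Longrightarrow> cball (f c) \<rho> \<inter> A e = {}"
proof -
  define F where "F = f ` (verts G - {c}) \<union> crossings G f A \<union> (\<Union>e\<in>{e \<in> edges G. c \<notin> e}. A e)"
  have "closed (A e)" if "e \<in> edges G" for e
    using D that arc_between_compact[of "A e"] compact_imp_closed by (auto simp: arc_drawing_def)
  then have "closed F"
    unfolding F_def using G D fin
    by (intro closed_Un closed_UN) (auto simp: simple_graph_def arc_drawing_def intro: finite_imp_closed)
  moreover have "f c \<notin> F"
    using D c unfolding F_def arc_drawing_def crossings_def inj_on_def by auto
  ultimately obtain r where r: "0 < r" "cball (f c) r \<subseteq> - F"
    using open_contains_cball[of "- F"] by auto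
  show thesis
    by (rule that[OF r(1)]) (use r(2) in \<open>auto simp: F_def\<close>)
qed

lemma finite_edges: "simple_graph G \<Longrightarrow> finite (edges G)"
  by (rule finite_subset[of _ "Pow (verts G)"]) (auto simp: simple_graph_def)

text \<open>The third corner \<open>c\<close> is redrawn inside a disc so small that it meets only the edges at \<open>c\<close>.
  Edge \<open>cz\<close> is kept up to the point \<open>P z\<close> where it first enters the disc, and \<open>c\<close> is moved to a
  point \<open>c'\<close> off the line through \<open>P x\<close> and \<open>P y\<close>.  The new vertex \<open>v\<close> is put at \<open>P x\<close>, so that only
  the chord from \<open>P x\<close> to \<open>P y\<close>, which belongs to the edge \<open>vy\<close>, can create new crossings: at most
  one with each of the segments from \<open>c'\<close> to \<open>P z\<close>.\<close>

lemma delta_Y_near_vertex: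
  assumes G: "simple_graph G" and D: "arc_drawing G f A" and cxy: "distinct [c, x, y]"
    and cx: "{c, x} \<in> edges G" and xy: "{x, y} \<in> edges G" and yc: "{y, c} \<in> edges G" and v: "v \<notin> verts G"
  obtains f' A' where "arc_drawing (delta_Y_graph G c x y v) f' A'"
    "card (crossings (delta_Y_graph G c x y v) f' A') \<le> card (crossings G f A - A {x, y}) + card (verts G)"
proof -
  define H where "H = delta_Y_graph G c x y v"
  have vH: "verts H = insert v (verts G)"
    and eH: "edges H = (edges G - {{c, x}, {x, y}, {y, c}}) \<union> {{v, c}, {v, x}, {v, y}}"
    by (auto simp: H_def delta_Y_graph_def)
  have vs: "c \<in> verts G" "x \<in> verts G" "y \<in> verts G"
    using cx xy edge_subset[OF G] by auto
  then have vne: "v \<noteq> c" "v \<noteq> x" "v \<noteq> y" "c \<noteq> x" "x \<noteq> y" "y \<noteq> c"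
    using v cxy by auto
  have inj: "inj_on f (verts G)"
    and arc: "\<And>e. e \<in> edges G \<Longrightarrow> arc_between (A e) (f ` e)"
    and vertex: "\<And>e w. \<lbrakk>e \<in> edges G; w \<in> verts G; f w \<in> A e\<rbrakk> \<Longrightarrow> w \<in> e"
    and fin: "finite (crossings G f A)"
    using D by (auto simp: arc_drawing_def)
  obtain \<rho> where \<rho>: "0 < \<rho>" "\<And>w. w \<in> verts G \<Longrightarrow> w \<noteq> c \<Longrightarrow> f w \<notin> cball (f c) \<rho>"
    "cball (f c) \<rho> \<inter> crossings G f A = {}" "\<And>e. e \<in> edges G \<Longrightarrow> c \<notin> e \<Longrightarrow> cball (f c) \<rho> \<inter> A e = {}"
    using vertex_neighbourhood[OF G D vs(1) finite_edges[OF G]] by metis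
  define DD where "DD = cball (f c) \<rho>"
  define N where "N = {z. {c, z} \<in> edges G}"
  have N: "z \<in> verts G" "z \<noteq> c" "z \<noteq> v" if "z \<in> N" for z
  proof -
    show "z \<in> verts G"
      using that edge_subset[OF G, of "{c, z}"] by (auto simp: N_def)
    then show "z \<noteq> v"
      using v by auto
    have "card {c, z} = 2"
      using that G by (auto simp: N_def simple_graph_def)
    then show "z \<noteq> c"
      by auto
  qed
  have xyN: "x \<in> N" "y \<in> N"
    using cx yc by (auto simp: N_def insert_commute)
  have "\<exists>B P. arc_between B {f z, P} \<and> B \<subseteq> A {c, z} \<and> B \<inter> DD = {P} \<and> P \<in> sphere (f c) \<rho>" if z: "z \<in> N" for z
  proof -
    have "arc_between (A {c, z}) {f z, f c}"
      using arc[of "{c, z}"] z by (simp add: N_def insert_commute)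
    then show ?thesis
      unfolding DD_def using arc_between_first_hit \<rho>(1) \<rho>(2)[OF N(1,2)[OF z]] by metis
  qed
  then obtain B P where B: "\<And>z. z \<in> N \<Longrightarrow> arc_between (B z) {f z, P z}" "\<And>z. z \<in> N \<Longrightarrow> B z \<subseteq> A {c, z}"
    "\<And>z. z \<in> N \<Longrightarrow> B z \<inter> DD = {P z}" and P: "\<And>z. z \<in> N \<Longrightarrow> P z \<in> sphere (f c) \<rho>"
    by metis
  \<comment> \<open>Two edges entering the disc at the same point would cross there, but the disc
    contains no crossing.\<close>
  have P_inj: "z = z'" if z: "z \<in> N" "z' \<in> N" "P z = P z'" for z z'
  proof (rule ccontr)
    assume "z \<noteq> z'"
    then have "{c, z} \<noteq> {c, z'}"
      by (auto simp: doubleton_eq_iff)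
    moreover have "P z \<in> A {c, z}" "P z \<in> A {c, z'}" "P z \<in> DD"
      using B(2,3)[OF z(1)] B(2,3)[OF z(2)] z(3) by blast+
    moreover have "P z \<notin> f ` verts G"
    proof
      assume "P z \<in> f ` verts G"
      then obtain w where w: "w \<in> verts G" "P z = f w"
        by auto
      then have "w = c"
        using \<rho>(2)[of w] \<open>P z \<in> DD\<close> by (auto simp: DD_def)
      then show False
        using P[OF z(1)] w \<rho>(1) by simp
    qed
    ultimately have "P z \<in> crossings G f A"
      using z(1,2) by (intro crossingsI[of _ _ _ "{c, z}" "{c, z'}"]) (simp_all add: N_def)
    then show False
      using \<rho>(3) \<open>P z \<in> DD\<close> by (auto simp: DD_def)
  qed
  define \<delta> where "\<delta> = P y - P x"
  have "\<delta> \<noteq> 0"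
    using P_inj[OF xyN] vne by (auto simp: \<delta>_def)
  then obtain c' where c': "c' \<in> ball (f c) \<rho>" "Im (cnj \<delta> * (c' - P x)) \<noteq> 0"
    using exists_off_line[OF \<rho>(1)] by metis
  have P_DD: "P z \<in> DD" "P z \<notin> ball (f c) \<rho>" "P z \<noteq> c'" if "z \<in> N" for z
    using P[OF that] c' by (auto simp: DD_def)
  have c'_DD: "c' \<in> DD"
    using c' by (auto simp: DD_def)
  have seg_DD: "closed_segment a b \<subseteq> DD" if "a \<in> DD" "b \<in> DD" for a b
    using that unfolding DD_def by (meson closed_segment_subset convex_cball)
  have radial: "q \<in> ball (f c) \<rho>" if "z \<in> N" "q \<in> closed_segment (P z) c'" "q \<noteq> P z" for q z
  proof (cases "q = c'")
    case False
    then show ?thesis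
      using that P_DD[OF that(1)] c'_DD segment_in_ball[of "P z" "f c" \<rho> c' q] by (simp add: DD_def)
  qed (use c' in simp)
  define chord where "chord = closed_segment (P x) (P y)"
  have chord_Im: "Im (cnj \<delta> * (q - P x)) = 0" if "q \<in> chord" for q
    using chord_Im[of q "P x" "P y"] that by (simp add: chord_def \<delta>_def)
  have chord_ball: "q \<in> ball (f c) \<rho>" if "q \<in> chord" "q \<noteq> P x" "q \<noteq> P y" for q
    using that P_DD[OF xyN(1)] P_DD[OF xyN(2)] segment_in_ball[of "P x" "f c" \<rho> "P y" q]
    by (simp add: chord_def DD_def)
  have c'_chord: "c' \<notin> chord"
    using chord_Im c' by blast
  \<comment> \<open>\<open>c'\<close> is off the line of the chord, so the segment from
    \<open>P x\<close> to \<open>c'\<close> meets that line only in \<open>P x\<close>.\<close>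
  have chord_vc: "q = P x" if q: "q \<in> chord" "q \<in> closed_segment (P x) c'" for q
  proof -
    obtain t where t: "q = P x + of_real t * (c' - P x)"
      using q(2) by (rule closed_segment_complexE)
    have "t * Im (cnj \<delta> * (c' - P x)) = 0"
      using segment_Im[OF t, of \<delta> "P x"] chord_Im[OF q(1)] by simp
    then show ?thesis
      using c' t by simp
  qed
  \<comment> \<open>Along the segment from \<open>c'\<close> to \<open>P z\<close> the cross product
    with \<delta> is affine and nonzero at \<open>c'\<close>. A zero at \<open>q\<close> forces a
    nonzero slope, which gives transversality and uniqueness at once.\<close>
  have radial_det: "Im (cnj \<delta> * (P z - c')) \<noteq> 0"
    and radial_unique: "\<And>q'. q' \<in> closed_segment (P z) c' \<Longrightarrow> q' \<in> chord \<Longrightarrow> q' = q"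
    if q: "q \<in> closed_segment (P z) c'" "q \<in> chord" for q z
  proof -
    have param: "\<exists>t. r = c' + of_real t * (P z - c') \<and> t * Im (cnj \<delta> * (P z - c')) = - Im (cnj \<delta> * (c' - P x))"
      if r: "r \<in> closed_segment (P z) c'" "r \<in> chord" for r
    proof -
      obtain t where t: "r = c' + of_real t * (P z - c')"
        using r(1) closed_segment_complexE by (metis closed_segment_commute)
      then show ?thesis
        using segment_Im[OF t, of \<delta> "P x"] chord_Im[OF r(2)] by (intro exI[of _ t]) simp
    qed
    obtain t where t: "q = c' + of_real t * (P z - c')"
      "t * Im (cnj \<delta> * (P z - c')) = - Im (cnj \<delta> * (c' - P x))"
      using param[OF q] by blast
    show det: "Im (cnj \<delta> * (P z - c')) \<noteq> 0"
      using t(2) c'(2) by (metis mult_zero_right neg_equal_0_iff_equal)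
    fix q' assume q': "q' \<in> closed_segment (P z) c'" "q' \<in> chord"
    obtain t' where t': "q' = c' + of_real t' * (P z - c')"
      "t' * Im (cnj \<delta> * (P z - c')) = - Im (cnj \<delta> * (c' - P x))"
      using param[OF q'] by blast
    have "t' = t"
      using t(2) t'(2) det by (metis mult_right_cancel)
    then show "q' = q"
      using t(1) t'(1) by simp
  qed
  have rad_meet: "q = c'" if "z \<in> N" "z' \<in> N" "z \<noteq> z'" "q \<in> closed_segment (P z) c'" "q \<in> closed_segment (P z') c'" for q z z'
    using radial_segments_meet[OF P[OF that(1)] P[OF that(2)] _ c'(1)] P_inj that by blast
  define N' where "N' = N - {x, y}"
  define f' where "f' = f(c := c', v := P x)"
  \<comment> \<open>The union over \<open>e - {c}\<close> merely extracts the other end of an edge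
    at \<open>c\<close>.\<close>
  define A' where "A' e = (if e = {v, x} then B x else if e = {v, y} then B y \<union> chord
    else if e = {v, c} then closed_segment (P x) c'
    else if c \<in> e then (\<Union>z\<in>e - {c}. B z \<union> closed_segment (P z) c') else A e)" for e
  \<comment> \<open>The trace of the new edge in \<open>DD\<close>, by \<open>F1\<close>. The facts
    \<open>F1\<close> to \<open>F4\<close> split each question into what happens in the disc and
    what is inherited through \<open>src\<close> outside.\<close>
  define In where "In e = (if e = {v, x} then {P x} else if e = {v, y} then chord
    else if e = {v, c} then closed_segment (P x) c'
    else if c \<in> e then (\<Union>z\<in>e - {c}. closed_segment (P z) c') else {})" for e
  \<comment> \<open>The edge \<open>{v, c}\<close> lies in \<open>DD\<close> and follows no old
    edge; as \<open>src\<close> matters only outside the disc, \<open>F3\<close> and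
    \<open>F4\<close> exclude it.\<close>
  define src where "src e = (if e = {v, x} then {c, x} else if e = {v, y} then {y, c} else e)" for e
  have star: "{v, x} \<noteq> {v, y}" "{v, y} \<noteq> {v, c}" "{v, x} \<noteq> {v, c}" "{c, x} \<noteq> {y, c}"
    using vne by (auto simp: doubleton_eq_iff)
  have at_v: "A' {v, x} = B x" "A' {v, y} = B y \<union> chord" "A' {v, c} = closed_segment (P x) c'"
    "In {v, x} = {P x}" "In {v, y} = chord" "In {v, c} = closed_segment (P x) c'"
    "src {v, x} = {c, x}" "src {v, y} = {y, c}"
    using star by (auto simp: A'_def In_def src_def)
  have N': "z \<in> N" "z \<noteq> x" "z \<noteq> y" "z \<noteq> c" "z \<noteq> v" if "z \<in> N'" for z
    using that N by (auto simp: N'_def)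
  have at_c: "A' {c, z} = B z \<union> closed_segment (P z) c'" "In {c, z} = closed_segment (P z) c'" "src {c, z} = {c, z}"
    if "z \<in> N'" for z
  proof -
    have "{c, z} - {c} = {z}" "v \<notin> {c, z}"
      using N'[OF that] vne by auto
    moreover from this have "{c, z} \<noteq> {v, x}" "{c, z} \<noteq> {v, y}" "{c, z} \<noteq> {v, c}"
      by blast+
    ultimately show "A' {c, z} = B z \<union> closed_segment (P z) c'" "In {c, z} = closed_segment (P z) c'" "src {c, z} = {c, z}"
      unfolding A'_def In_def src_def by simp_all
  qed
  have far: "v \<notin> e" "A' e = A e" "In e = {}" "src e = e" "f' ` e = f ` e" "e \<subseteq> verts G" "DD \<inter> A e = {}"
    if e: "e \<in> edges G" "c \<notin> e" for e
  proof -
    show sub: "e \<subseteq> verts G"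
      using edge_subset[OF G e(1)] .
    then show ve: "v \<notin> e"
      using v by blast
    then have "e \<noteq> {v, x}" "e \<noteq> {v, y}" "e \<noteq> {v, c}"
      by blast+
    then show "A' e = A e" "In e = {}" "src e = e"
      unfolding A'_def In_def src_def using e by simp_all
    show "f' ` e = f ` e"
      using ve e(2) by (intro image_cong) (auto simp: f'_def)
    show "DD \<inter> A e = {}"
      using \<rho>(4)[OF e] by (simp add: DD_def)
  qed
  have edge_cases: thesis
    if e: "e \<in> edges H" and "e = {v, x} \<Longrightarrow> thesis" "e = {v, y} \<Longrightarrow> thesis" "e = {v, c} \<Longrightarrow> thesis"
      "\<And>z. z \<in> N' \<Longrightarrow> e = {c, z} \<Longrightarrow> thesis"
      "e \<in> edges G \<Longrightarrow> c \<notin> e \<Longrightarrow> e \<noteq> {x, y} \<Longrightarrow> thesis" for e thesis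
  proof (cases "e \<in> edges G \<and> c \<in> e \<and> e \<noteq> {c, x} \<and> e \<noteq> {y, c}")
    case True
    then have "card e = 2"
      using G by (auto simp: simple_graph_def)
    then obtain z where z: "e = {c, z}"
      using True by (auto simp: card_2_iff)
    then have "z \<in> N'"
      using True by (auto simp: N'_def N_def insert_commute)
    then show thesis
      using that(5) z by blast
  next
    case False
    then show thesis
      using that by (auto simp: eH)
  qed
  have F1: "A' e \<inter> DD = In e" if "e \<in> edges H" for e
  proof (rule edge_cases[OF that])
    assume e: "e = {v, y}"
    have "chord \<subseteq> DD" "P y \<in> chord"
      using seg_DD P_DD xyN by (auto simp: chord_def)
    then show ?thesis
      using B(3)[OF xyN(2)] unfolding e at_v by (simp add: Int_Un_distrib2 Int_absorb2 insert_absorb)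
  next
    assume e: "e = {v, c}"
    show ?thesis
      using seg_DD[of "P x" c'] P_DD[OF xyN(1)] c'_DD unfolding e at_v by blast
  next
    fix z assume z: "z \<in> N'" and e: "e = {c, z}"
    show ?thesis
      using B(3)[OF N'(1)[OF z]] seg_DD[of "P z" c'] P_DD(1)[OF N'(1)[OF z]] c'_DD
      unfolding e at_c[OF z] by (auto simp: Int_Un_distrib2)
  next
    assume e: "e = {v, x}"
    show ?thesis
      using B(3)[OF xyN(1)] unfolding e at_v .
  next
    assume "e \<in> edges G" "c \<notin> e"
    then show ?thesis
      using far(2,3,7) by (simp add: Int_commute)
  qed
  have F2: "A' e - DD \<subseteq> A (src e)" if "e \<in> edges H" for e
  proof (rule edge_cases[OF that])
    assume e: "e = {v, x}"
    show ?thesis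
      using B(2)[OF xyN(1)] unfolding e at_v by blast
  next
    assume e: "e = {v, y}"
    have "chord \<subseteq> DD"
      using seg_DD P_DD xyN by (auto simp: chord_def)
    then show ?thesis
      using B(2)[OF xyN(2)] unfolding e at_v by (auto simp: insert_commute)
  next
    assume e: "e = {v, c}"
    show ?thesis
      using seg_DD[of "P x" c'] P_DD[OF xyN(1)] c'_DD unfolding e at_v by blast
  next
    fix z assume z: "z \<in> N'" and e: "e = {c, z}"
    show ?thesis
      using B(2)[OF N'(1)[OF z]] seg_DD[of "P z" c'] P_DD(1)[OF N'(1)[OF z]] c'_DD
      unfolding e at_c[OF z] by blast
  next
    assume "e \<in> edges G" "c \<notin> e"
    then show ?thesis
      using far(2,4) by auto
  qed
  have F3: "src e \<in> edges G" "src e \<noteq> {x, y}" if "e \<in> edges H" "e \<noteq> {v, c}" for e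
  proof -
    have "src e \<in> edges G \<and> src e \<noteq> {x, y}"
    proof (rule edge_cases[OF that(1)])
      fix z assume z: "z \<in> N'" and e: "e = {c, z}"
      have "{c, z} \<noteq> {x, y}"
        using vne by blast
      then show ?thesis
        using N'(1)[OF z] unfolding e at_c[OF z] by (simp add: N_def)
    next
      assume e: "e = {v, x}"
      have "{c, x} \<noteq> {x, y}"
        using vne by blast
      then show ?thesis
        unfolding e at_v using cx by simp
    next
      assume e: "e = {v, y}"
      have "{y, c} \<noteq> {x, y}"
        using vne by blast
      then show ?thesis
        unfolding e at_v using yc by simp
    next
      assume "e \<in> edges G" "c \<notin> e" "e \<noteq> {x, y}"
      then show ?thesis
        using far(4) by simp
    qed (use that in simp)
    then show "src e \<in> edges G" "src e \<noteq> {x, y}"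
      by auto
  qed
  have F4: "inj_on src (edges H - {{v, c}})"
  proof -
    have cases: "e = {v, x} \<or> e = {v, y} \<or> (src e = e \<and> e \<noteq> {c, x} \<and> e \<noteq> {y, c})"
      if "e \<in> edges H" "e \<noteq> {v, c}" for e
    proof (rule edge_cases[OF that(1)])
      fix z assume z: "z \<in> N'" and e: "e = {c, z}"
      have "{c, z} \<noteq> {c, x}" "{c, z} \<noteq> {y, c}"
        using N'[OF z] by (auto simp: doubleton_eq_iff)
      then show ?thesis
        unfolding e using at_c(3)[OF z] by simp
    next
      assume "e \<in> edges G" "c \<notin> e"
      then show ?thesis
        using far(4) by blast
    qed (use that in simp_all)
    show ?thesis
    proof (rule inj_onI)
      fix e e' assume "e \<in> edges H - {{v, c}}" "e' \<in> edges H - {{v, c}}" "src e = src e'"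
      then show "e = e'"
        using cases[of e] cases[of e'] at_v(7,8) star(4) by (metis Diff_iff insertCI)
    qed
  qed
  \<comment> \<open>In the disc, radii meet one another only in \<open>c'\<close>, and the chord
    meets the radius of \<open>{v, c}\<close> only in \<open>P x\<close>. Both points are vertices
    now, so what remains is the chord against the radius of an old edge.\<close>
  have F6: "\<exists>z\<in>N'. q \<in> closed_segment (P z) c' \<and> q \<in> chord \<and> {e, e'} = {{v, y}, {c, z}}"
    if e: "e \<in> edges H" "e' \<in> edges H" "e \<noteq> e'" and q: "q \<in> In e" "q \<in> In e'" "q \<noteq> P x" "q \<noteq> c'" for e e' q
  proof -
    have kinds: "(d = {v, y} \<and> q \<in> chord) \<or> (\<exists>z\<in>N. (z = x \<and> d = {v, c} \<or> z \<in> N' \<and> d = {c, z}) \<and> q \<in> closed_segment (P z) c')"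
      if "d \<in> edges H" "q \<in> In d" for d
    proof (rule edge_cases[OF that(1)])
      fix z assume z: "z \<in> N'" and d: "d = {c, z}"
      have "q \<in> closed_segment (P z) c'"
        using that(2) unfolding d at_c(2)[OF z] .
      then show ?thesis
        using N'(1)[OF z] z d by (intro disjI2 bexI[of _ z]) auto
    next
      assume d: "d = {v, c}"
      have "q \<in> closed_segment (P x) c'"
        using that(2) unfolding d at_v .
      then show ?thesis
        using xyN d by (intro disjI2 bexI[of _ x]) auto
    next
      assume d: "d = {v, x}"
      show ?thesis
        using that(2) q(3) unfolding d at_v by simp
    next
      assume d: "d = {v, y}"
      show ?thesis
        using that(2) unfolding d at_v by simp
    next
      assume "d \<in> edges G" "c \<notin> d"
      then show ?thesis
        using that(2) far(3) by simp
    qed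
    have mixed: "\<exists>z\<in>N'. q \<in> closed_segment (P z) c' \<and> q \<in> chord \<and> d' = {c, z}"
      if "q \<in> chord" "d' \<noteq> {v, y}" "d' \<in> edges H" "q \<in> In d'" for d'
      using kinds[OF that(3,4)] that(1,2) chord_vc q(3) by blast
    show ?thesis
    proof (cases "e = {v, y} \<or> e' = {v, y}")
      case True
      then consider "e = {v, y}" | "e' = {v, y}"
        by blast
      then show ?thesis
      proof cases
        case 1
        then obtain z where "z \<in> N'" "q \<in> closed_segment (P z) c'" "q \<in> chord" "e' = {c, z}"
          using mixed[of e'] e q at_v(5) by metis
        then show ?thesis
          using 1 by (intro bexI[of _ z]) simp_all
      next
        case 2
        then obtain z where "z \<in> N'" "q \<in> closed_segment (P z) c'" "q \<in> chord" "e = {c, z}"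
          using mixed[of e] e q at_v(5) by metis
        then show ?thesis
          using 2 by (intro bexI[of _ z]) (simp_all add: insert_commute)
      qed
    next
      case False
      then obtain z z' where "z \<in> N" "z' \<in> N" "q \<in> closed_segment (P z) c'" "q \<in> closed_segment (P z') c'"
        "z = x \<and> e = {v, c} \<or> z \<in> N' \<and> e = {c, z}" "z' = x \<and> e' = {v, c} \<or> z' \<in> N' \<and> e' = {c, z'}"
        using kinds[OF e(1) q(1)] kinds[OF e(2) q(2)] by blast
      moreover from this have "z \<noteq> z'"
        using e(3) N'(2) by blast
      ultimately show ?thesis
        using rad_meet q(4) by blast
    qed
  qed
  have f'_vals: "f' v = P x" "f' c = c'" "\<And>w. w \<noteq> v \<Longrightarrow> w \<noteq> c \<Longrightarrow> f' w = f w"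
    using vne by (auto simp: f'_def)
  have arc': "arc_between (A' e) (f' ` e)" if "e \<in> edges H" for e
  proof (rule edge_cases[OF that])
    assume e: "e = {v, x}"
    show ?thesis
      using B(1)[OF xyN(1)] vne unfolding e at_v by (simp add: f'_vals insert_commute)
  next
    assume e: "e = {v, y}"
    have "P y \<noteq> P x"
      using P_inj xyN vne by blast
    moreover have "B y \<inter> chord \<subseteq> {P y}"
      using B(3)[OF xyN(2)] seg_DD[of "P x" "P y"] P_DD xyN unfolding chord_def by blast
    ultimately have "arc_between (B y \<union> chord) {f y, P x}"
      using B(1)[OF xyN(2)] arc_between_segment[of "P y" "P x"]
      by (intro arc_between_join) (auto simp: chord_def closed_segment_commute)
    then show ?thesis
      using vne unfolding e at_v by (simp add: f'_vals insert_commute)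
  next
    assume e: "e = {v, c}"
    show ?thesis
      using arc_between_segment[of "P x" c'] P_DD xyN vne unfolding e at_v by (simp add: f'_vals)
  next
    fix z assume z: "z \<in> N'" and e: "e = {c, z}"
    have "B z \<inter> closed_segment (P z) c' \<subseteq> {P z}"
      using B(3)[OF N'(1)[OF z]] seg_DD[of "P z" c'] P_DD(1)[OF N'(1)[OF z]] c'_DD by blast
    then have "arc_between (B z \<union> closed_segment (P z) c') {f z, c'}"
      using B(1)[OF N'(1)[OF z]] arc_between_segment[of "P z" c'] P_DD(3)[OF N'(1)[OF z]]
      by (intro arc_between_join) auto
    then show ?thesis
      using N'[OF z] unfolding e at_c[OF z] by (simp add: f'_vals insert_commute)
  next
    assume "e \<in> edges G" "c \<notin> e"
    then show ?thesis
      using far(2,5) arc by simp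
  qed
  have sub_H: "e \<subseteq> verts H" if "e \<in> edges H" for e
    using that edge_subset[OF G] vs by (auto simp: eH vH)
  have vertex': "w \<in> e" if e: "e \<in> edges H" and w: "w \<in> verts H" "f' w \<in> A' e" for e w
  proof -
    consider "w = v" | "w = c" | "w \<in> verts G" "w \<noteq> v" "w \<noteq> c"
      using w by (auto simp: vH)
    then show ?thesis
    proof cases
      case 1
      then have Px: "P x \<in> In e"
        using w F1[OF e] P_DD(1)[OF xyN(1)] by (auto simp: f'_vals)
      show ?thesis
      proof (rule edge_cases[OF e])
        fix z assume z: "z \<in> N'" and e': "e = {c, z}"
        have "P x \<noteq> P z"
          using P_inj xyN N'[OF z] by metis
        then show ?thesis
          using radial[of z "P x"] Px N'(1)[OF z] P_DD(2)[OF xyN(1)] unfolding e' at_c[OF z] by blast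
      next
        assume "e \<in> edges G" "c \<notin> e"
        then show ?thesis
          using Px far(3) by simp
      qed (use 1 in simp_all)
    next
      case 2
      then have c'e: "c' \<in> In e"
        using w F1[OF e] c'_DD by (auto simp: f'_vals)
      show ?thesis
      proof (rule edge_cases[OF e])
        assume "e = {v, x}"
        then show ?thesis
          using c'e at_v P_DD(3)[OF xyN(1)] by auto
      next
        assume "e = {v, y}"
        then show ?thesis
          using c'e at_v c'_chord by auto
      next
        assume "e \<in> edges G" "c \<notin> e"
        then show ?thesis
          using c'e far(3) by simp
      qed (use 2 in simp_all)
    next
      case 3
      then have fw: "f w \<in> A' e" "f w \<notin> DD"
        using w \<rho>(2)[of w] f'_vals(3) by (auto simp: DD_def)
      then have fw': "f w \<in> A (src e)"
        using F2[OF e] by blast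
      have "e \<noteq> {v, c}"
        using fw F1[OF e] at_v seg_DD[of "P x" c'] P_DD(1)[OF xyN(1)] c'_DD by auto
      then have wsrc: "w \<in> src e"
        using F3[OF e] vertex[OF _ 3(1) fw'] by blast
      show ?thesis
      proof (rule edge_cases[OF e])
        assume e': "e = {v, x}"
        show ?thesis
          using wsrc 3 unfolding e' at_v by simp
      next
        assume e': "e = {v, y}"
        show ?thesis
          using wsrc 3 unfolding e' at_v by simp
      next
        fix z assume z: "z \<in> N'" and e': "e = {c, z}"
        show ?thesis
          using wsrc unfolding e' at_c[OF z] .
      next
        assume "e \<in> edges G" "c \<notin> e"
        then show ?thesis
          using wsrc far(4) by simp
      qed (use \<open>e \<noteq> {v, c}\<close> in simp)
    qed
  qed
  have f'_out: "q \<notin> f ` verts G" if "q \<notin> f' ` verts H" "q \<notin> DD" for q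
  proof
    assume "q \<in> f ` verts G"
    then obtain w where w: "w \<in> verts G" "q = f w"
      by auto
    have "w \<noteq> c"
      using that(2) w \<rho>(1) by (auto simp: DD_def)
    moreover have "w \<noteq> v"
      using w v by auto
    ultimately have "q = f' w"
      using w f'_vals(3) by simp
    then show False
      using that(1) w by (auto simp: vH)
  qed
  \<comment> \<open>Outside the disc every edge follows its source and no source is
    \<open>{x, y}\<close>, so none of these crossings lies on the deleted edge.\<close>
  have outer: "q \<in> crossings G f A - A {x, y}"
    "\<exists>e\<in>edges H. \<exists>e'\<in>edges H. e \<noteq> e' \<and> crossing_germ (A' e) (A' e') q \<and> {d \<in> edges H. q \<in> A' d} = {e, e'}"
    if qc: "q \<in> crossings H f' A'" and q_DD: "q \<notin> DD" for q
  proof -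
    obtain e e' where q: "q \<notin> f' ` verts H" and e: "e \<in> edges H" "e' \<in> edges H" "e \<noteq> e'" "q \<in> A' e" "q \<in> A' e'"
      using qc by (auto simp: crossings_def)
    have notvc: "d \<noteq> {v, c}" if "q \<in> A' d" for d
      using that q_DD at_v(3) seg_DD[of "P x" c'] P_DD(1)[OF xyN(1)] c'_DD by auto
    have arcs: "\<exists>X. arc_between (A' d) X \<and> q \<notin> X" if "d \<in> edges H" for d
      using arc'[OF that] sub_H[OF that] q by blast
    have srcs: "src d \<in> edges G \<and> A' d \<inter> (- DD) \<subseteq> A (src d)" if "d \<in> edges H" "q \<in> A' d" for d
      using F2[OF that(1)] F3(1)[OF that(1) notvc[OF that(2)]] by blast
    have "inj_on src {d \<in> edges H. q \<in> A' d}"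
      using notvc by (intro inj_on_subset[OF F4]) auto
    moreover have "open (- DD)" "q \<in> - DD"
      using q_DD by (auto simp: DD_def)
    ultimately have T: "q \<in> crossings G f A" "{d \<in> edges G. q \<in> A d} = {src e, src e'}"
      "\<exists>e\<in>edges H. \<exists>e'\<in>edges H. e \<noteq> e' \<and> crossing_germ (A' e) (A' e') q \<and> {d \<in> edges H. q \<in> A' d} = {e, e'}"
      using crossing_transfer[where src = src and N = "- DD", OF D f'_out[OF q q_DD] _ _ e srcs arcs] by blast+
    have "src e \<noteq> {x, y}" "src e' \<noteq> {x, y}"
      using F3(2) notvc e by auto
    then have "{x, y} \<notin> {d \<in> edges G. q \<in> A d}"
      unfolding T(2) by simp
    then have "q \<notin> A {x, y}"
      using xy by simp
    then show "q \<in> crossings G f A - A {x, y}"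
      using T(1) by blast
    show "\<exists>e\<in>edges H. \<exists>e'\<in>edges H. e \<noteq> e' \<and> crossing_germ (A' e) (A' e') q \<and> {d \<in> edges H. q \<in> A' d} = {e, e'}"
      by (rule T(3))
  qed
  have inner: "\<exists>z\<in>N'. q \<in> closed_segment (P z) c' \<and> q \<in> chord \<and> q \<noteq> P x \<and> q \<noteq> c' \<and> {d \<in> edges H. q \<in> A' d} = {{v, y}, {c, z}}"
    if qc: "q \<in> crossings H f' A'" and q_DD: "q \<in> DD" for q
  proof -
    obtain e e' where q: "q \<notin> f' ` verts H" and e: "e \<in> edges H" "e' \<in> edges H" "e \<noteq> e'" "q \<in> A' e" "q \<in> A' e'"
      using qc by (auto simp: crossings_def)
    have ne: "q \<noteq> P x" "q \<noteq> c'"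
      using q f'_vals(1,2) vs(1) by (auto simp: vH)
    have In: "q \<in> In d" if "d \<in> edges H" "q \<in> A' d" for d
      using F1[OF that(1)] that(2) q_DD by blast
    obtain z where z: "z \<in> N'" "q \<in> closed_segment (P z) c'" "q \<in> chord" "{e, e'} = {{v, y}, {c, z}}"
      using F6[OF e(1-3) In[OF e(1,4)] In[OF e(2,5)] ne] by blast
    \<comment> \<open>A third edge together with \<open>{c, z}\<close> would again have to be a
      chord and a radius by \<open>F6\<close>, but neither of the two is
      \<open>{v, y}\<close>.\<close>
    have only: "d \<in> {e, e'}" if d: "d \<in> edges H" "q \<in> A' d" for d
    proof (rule ccontr)
      assume "d \<notin> {e, e'}"
      then have dne: "d \<noteq> {v, y}" "d \<noteq> {c, z}"
        using z(4) by auto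
      have cz: "{c, z} \<in> edges H" "q \<in> In {c, z}"
        using z(4) e In by (metis insertI1 insertE singletonD insertI2)+
      obtain z' where "{d, {c, z}} = {{v, y}, {c, z'}}"
        using F6[OF d(1) cz(1) dne(2) In[OF d] cz(2) ne] by blast
      then have "{v, y} \<in> {d, {c, z}}"
        by simp
      then have "{v, y} = {c, z}"
        using dne by auto
      then show False
        using vne N'(5)[OF z(1)] by (auto simp: doubleton_eq_iff)
    qed
    have "{d \<in> edges H. q \<in> A' d} = {e, e'}"
      by (intro equalityI subsetI) (use only e in auto)
    then have "{d \<in> edges H. q \<in> A' d} = {{v, y}, {c, z}}"
      using z(4) by simp
    then show ?thesis
      using z ne by blast
  qed
  have inner_germ: "\<exists>e\<in>edges H. \<exists>e'\<in>edges H. e \<noteq> e' \<and> crossing_germ (A' e) (A' e') q \<and> {d \<in> edges H. q \<in> A' d} = {e, e'}"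
    if qc: "q \<in> crossings H f' A'" and q_DD: "q \<in> DD" for q
  proof -
    obtain z where z: "z \<in> N'" "q \<in> closed_segment (P z) c'" "q \<in> chord" "q \<noteq> P x" "q \<noteq> c'"
      and ed: "{d \<in> edges H. q \<in> A' d} = {{v, y}, {c, z}}"
      using inner[OF qc q_DD] by blast
    have in_H: "{v, y} \<in> edges H" "{c, z} \<in> edges H" "q \<in> A' {v, y}" "q \<in> A' {c, z}"
      using ed by blast+
    \<comment> \<open>The chord meets the circle only in \<open>P x\<close> and \<open>P y\<close>,
      both different from \<open>P z\<close>. So \<open>q\<close> is in the open disc, where both
      edges are straight.\<close>
    have "q \<noteq> P z"
    proof
      assume "q = P z"
      then show False
        using chord_ball[OF z(3,4)] P_DD(2)[OF N'(1)[OF z(1)]] P_inj[OF N'(1)[OF z(1)] xyN(2)] N'(3)[OF z(1)] by metis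
    qed
    then have q_ball: "q \<in> ball (f c) \<rho>"
      using radial N'(1)[OF z(1)] z(2) by blast
    have q_ends: "q \<notin> f' ` {v, y}" "q \<notin> f' ` {c, z}"
      using qc sub_H[OF in_H(1)] sub_H[OF in_H(2)] unfolding crossings_def by blast+
    have ball_DD: "ball (f c) \<rho> \<subseteq> DD"
      by (auto simp: DD_def)
    have "crossing_germ (range (\<lambda>t. q + of_real t * (P y - P x))) (range (\<lambda>t. q + of_real t * (c' - P z))) q"
    proof (rule crossing_germ_lines)
      have "Im (cnj \<delta> * (c' - P z)) = - Im (cnj \<delta> * (P z - c'))"
        by (simp add: algebra_simps)
      then show "Im (cnj (P y - P x) * (c' - P z)) \<noteq> 0"
        using radial_det[OF z(2,3)] unfolding \<delta>_def by simp
    qed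
    then have "crossing_germ (A' {v, y}) (A' {c, z}) q"
    proof (rule arc_between_crossing_germ_cong[OF _ open_ball q_ball arc'[OF in_H(1)] in_H(3) q_ends(1) arc'[OF in_H(2)] in_H(4) q_ends(2)])
      show "A' {v, y} \<inter> ball (f c) \<rho> \<subseteq> range (\<lambda>t. q + of_real t * (P y - P x))"
        using F1[OF in_H(1)] ball_DD closed_segment_subset_line[of q "P x" "P y"] z(3)
        unfolding at_v chord_def by blast
      show "A' {c, z} \<inter> ball (f c) \<rho> \<subseteq> range (\<lambda>t. q + of_real t * (c' - P z))"
        using F1[OF in_H(2)] ball_DD closed_segment_subset_line[OF z(2)]
        unfolding at_c[OF z(1)] by blast
    qed
    moreover have "{v, y} \<noteq> {c, z}"
      using vne N'(5)[OF z(1)] by (auto simp: doubleton_eq_iff)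
    ultimately show ?thesis
      using in_H(1,2) ed by (intro bexI[of _ "{v, y}"] bexI[of _ "{c, z}"] conjI)
  qed
  have finN: "finite N'" "card N' \<le> card (verts G)"
  proof -
    have sub: "N' \<subseteq> verts G" "finite (verts G)"
      using N'(1) N(1) G by (auto simp: simple_graph_def)
    then show "finite N'" "card N' \<le> card (verts G)"
      by (auto intro: finite_subset card_mono)
  qed
  \<comment> \<open>The neighbour \<open>zz q\<close> names the radius through \<open>q\<close>. A
    radius meets the chord at most once, so \<open>zz\<close> is injective and new crossings are no
    more numerous than vertices.\<close>
  obtain zz where zz: "\<And>q. q \<in> crossings H f' A' \<inter> DD \<Longrightarrow> zz q \<in> N' \<and> q \<in> closed_segment (P (zz q)) c' \<and> q \<in> chord"
    using inner by (metis IntE)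
  have zz_inj: "inj_on zz (crossings H f' A' \<inter> DD)"
    using zz radial_unique by (intro inj_onI) metis
  have zz_sub: "zz ` (crossings H f' A' \<inter> DD) \<subseteq> N'"
    using zz by blast
  have fin_in: "finite (crossings H f' A' \<inter> DD)" and card_in: "card (crossings H f' A' \<inter> DD) \<le> card (verts G)"
    using finite_subset[OF zz_sub finN(1)] finite_imageD[OF _ zz_inj] card_inj_on_le[OF zz_inj zz_sub finN(1)] finN(2)
    by auto
  have sub_out: "crossings H f' A' - DD \<subseteq> crossings G f A - A {x, y}"
    using outer(1) by blast
  have fin_out: "finite (crossings H f' A' - DD)"
    using sub_out fin by (meson finite_Diff finite_subset)
  have split: "crossings H f' A' = (crossings H f' A' \<inter> DD) \<union> (crossings H f' A' - DD)"
    by blast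
  have finH: "finite (crossings H f' A')"
    by (subst split) (use fin_in fin_out in simp)
  have "card (crossings H f' A') \<le> card (crossings H f' A' \<inter> DD) + card (crossings H f' A' - DD)"
    by (subst split) (rule card_Un_le)
  also have "\<dots> \<le> card (verts G) + card (crossings G f A - A {x, y})"
    using card_in card_mono[OF _ sub_out] fin by (intro add_mono) auto
  finally have card_H: "card (crossings H f' A') \<le> card (crossings G f A - A {x, y}) + card (verts G)"
    by simp
  have injH: "inj_on f' (verts H)"
  proof -
    have "f' w \<notin> DD" if "w \<in> verts G" "w \<noteq> c" for w
    proof -
      have "w \<noteq> v"
        using that v by auto
      then show ?thesis
        using that \<rho>(2)[OF that] f'_vals(3)[of w] by (simp add: DD_def)
    qed
    moreover have "f' v \<in> DD" "f' c \<in> DD" "f' v \<noteq> f' c"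
      using f'_vals P_DD[OF xyN(1)] c'_DD by auto
    moreover have "inj_on f' (verts G - {c})"
      using inj f'_vals(3) v unfolding inj_on_def by (metis DiffD1 DiffD2 insertI1)
    ultimately show ?thesis
      unfolding inj_on_def vH by (metis DiffI insertE singletonD)
  qed
  have "arc_drawing H f' A'"
    unfolding arc_drawing_def
  proof (intro conjI ballI impI)
    fix q assume "q \<in> crossings H f' A'"
    then show "\<exists>e\<in>edges H. \<exists>e'\<in>edges H. e \<noteq> e' \<and> crossing_germ (A' e) (A' e') q \<and> {d \<in> edges H. q \<in> A' d} = {e, e'}"
      using outer(2) inner_germ by (cases "q \<in> DD") simp_all
  qed (fact injH arc' vertex' finH)+
  then show thesis
    using that card_H unfolding H_def by blast
qed

section \<open>Straight-line drawings\<close>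

text \<open>Over an arbitrary vertex set, so that vertices can be added one at a time.\<close>

definition complete_on :: "'a set \<Rightarrow> 'a ugraph" where
  "complete_on V = UGraph V {e. e \<subseteq> V \<and> card e = 2}"

text \<open>Twice the signed area of the triangle with corners \<open>a\<close>, \<open>b\<close>,
  \<open>c\<close>.\<close>

definition orient :: "complex \<Rightarrow> complex \<Rightarrow> complex \<Rightarrow> real" where
  "orient a b c = Im (cnj (b - a) * (c - a))"

lemma Im_cnj_mult_self: "Im (cnj z * z) = 0"
  by simp

lemma orient_permute: "orient b c a = orient a b c" "orient b a c = - orient a b c"
  by (simp_all add: orient_def algebra_simps)

text \<open>Lines have measure zero, so finitely many of them do not cover the plane.\<close>

lemma exists_off_finite_lines:
  fixes L :: "(complex \<times> complex) set"
  assumes "finite L" "\<And>a d. (a, d) \<in> L \<Longrightarrow> d \<noteq> 0"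
  obtains q where "\<And>a d. (a, d) \<in> L \<Longrightarrow> Im (cnj d * (q - a)) \<noteq> 0"
proof -
  have "negligible {q. Im (cnj d * (q - a)) = 0}" if "(a, d) \<in> L" for a d
  proof -
    \<comment> \<open>\<open>\<i> * d\<close> is a normal vector of the line.\<close>
    have "{q. Im (cnj d * (q - a)) = 0} = {q. (\<i> * d) \<bullet> q = (\<i> * d) \<bullet> a}"
      by (auto simp: inner_complex_def algebra_simps)
    then show ?thesis
      using assms(2)[OF that] by (simp add: negligible_hyperplane)
  qed
  then have "negligible (\<Union>(a, d)\<in>L. {q. Im (cnj d * (q - a)) = 0})"
    using assms(1) by (intro negligible_Union) auto
  then have "(\<Union>(a, d)\<in>L. {q. Im (cnj d * (q - a)) = 0}) \<noteq> UNIV"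
    using non_negligible_UNIV by metis
  then show thesis
    using that by blast
qed

text \<open>The last clause excludes three concurrent edges, which noncollinearity of the vertices
  does not. Segments are written as convex hulls because an edge has no preferred first end.\<close>

definition general_position :: "'a set \<Rightarrow> ('a \<Rightarrow> complex) \<Rightarrow> bool" where
  "general_position V f \<longleftrightarrow>
     inj_on f V \<and>
     (\<forall>i\<in>V. \<forall>j\<in>V. \<forall>k\<in>V. i \<noteq> j \<longrightarrow> j \<noteq> k \<longrightarrow> i \<noteq> k \<longrightarrow> orient (f i) (f j) (f k) \<noteq> 0) \<and>
     (\<forall>p e1 e2 e3. {e1, e2, e3} \<subseteq> edges (complete_on V) \<longrightarrow> e1 \<noteq> e2 \<longrightarrow> e2 \<noteq> e3 \<longrightarrow> e1 \<noteq> e3 \<longrightarrow>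
        p \<in> convex hull (f ` e1) \<longrightarrow> p \<in> convex hull (f ` e2) \<longrightarrow> p \<in> convex hull (f ` e3) \<longrightarrow> p \<in> f ` V)"

lemma edges_complete_on_iff: "e \<in> edges (complete_on V) \<longleftrightarrow> (\<exists>i\<in>V. \<exists>j\<in>V. i \<noteq> j \<and> e = {i, j})"
  by (auto simp: complete_on_def card_2_iff)

text \<open>Both segments describe the same vector \<open>p - a\<close>, whose cross product with
  itself is 0 and equals \<open>s * t * orient a b c\<close>; so one of the parameters is 0.\<close>

lemma segments_meet_at_shared_end:
  assumes "orient a b c \<noteq> 0" "p \<in> closed_segment a b" "p \<in> closed_segment a c"
  shows "p = a"
proof -
  obtain s where s: "p = a + of_real s * (b - a)"
    using assms(2) by (rule closed_segment_complexE)
  obtain t where t: "p = a + of_real t * (c - a)"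
    using assms(3) by (rule closed_segment_complexE)
  have "s * t * orient a b c = Im (cnj (of_real s * (b - a)) * (of_real t * (c - a)))"
    by (simp add: orient_def algebra_simps)
  also have "\<dots> = Im (cnj (p - a) * (p - a))"
    using s t by (metis add_diff_cancel_left')
  also have "\<dots> = 0"
    by (rule Im_cnj_mult_self)
  finally show ?thesis
    using assms(1) s t by auto
qed

text \<open>For parallel segments the cross product with \<open>b - a\<close> would be constant
  along the second one, yet it is nonzero at \<open>c\<close> and zero at \<open>p\<close>.\<close>

lemma crossing_segments_transversal:
  assumes "orient a b c \<noteq> 0" "p \<in> closed_segment a b" "p \<in> closed_segment c d"
  shows "Im (cnj (b - a) * (d - c)) \<noteq> 0"
proof
  assume par: "Im (cnj (b - a) * (d - c)) = 0"
  obtain t where t: "p = c + of_real t * (d - c)"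
    using assms(3) by (rule closed_segment_complexE)
  have "Im (cnj (b - a) * (p - a)) = orient a b c + t * Im (cnj (b - a) * (d - c))"
    unfolding orient_def by (rule segment_Im[OF t])
  then show False
    using chord_Im[OF assms(2)] par assms(1) by simp
qed

lemma transversal_segments_meet_once:
  assumes "Im (cnj (b - a) * (d - c)) \<noteq> 0"
    and "p \<in> closed_segment a b" "p \<in> closed_segment c d" "q \<in> closed_segment a b" "q \<in> closed_segment c d"
  shows "q = p"
proof -
  obtain s where s: "q = p + of_real s * (b - a)"
    using closed_segment_subset_line[OF assms(2)] assms(4) by blast
  obtain t where t: "q = p + of_real t * (d - c)"
    using closed_segment_subset_line[OF assms(3)] assms(5) by blast
  have "s * t * Im (cnj (b - a) * (d - c)) = Im (cnj (of_real s * (b - a)) * (of_real t * (d - c)))"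
    by (simp add: algebra_simps)
  also have "\<dots> = Im (cnj (q - p) * (q - p))"
    using s t by (metis add_diff_cancel_left')
  also have "\<dots> = 0"
    by (rule Im_cnj_mult_self)
  finally show ?thesis
    using assms(1) s t by auto
qed

lemma straight_line_drawing:
  assumes fin: "finite V" and gp: "general_position V f"
  shows "arc_drawing (complete_on V) f (\<lambda>e. convex hull (f ` e))"
proof -
  define A where "A e = convex hull (f ` e)" for e
  define G where "G = complete_on V"
  have inj: "inj_on f V"
    and noncol: "\<And>i j k. \<lbrakk>i \<in> V; j \<in> V; k \<in> V; i \<noteq> j; j \<noteq> k; i \<noteq> k\<rbrakk> \<Longrightarrow> orient (f i) (f j) (f k) \<noteq> 0"
    and triple: "\<And>p e1 e2 e3. \<lbrakk>e1 \<in> edges G; e2 \<in> edges G; e3 \<in> edges G; e1 \<noteq> e2; e2 \<noteq> e3; e1 \<noteq> e3;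
      p \<in> A e1; p \<in> A e2; p \<in> A e3\<rbrakk> \<Longrightarrow> p \<in> f ` V"
    using gp unfolding general_position_def A_def G_def by auto
  have edge: "\<exists>i\<in>V. \<exists>j\<in>V. i \<noteq> j \<and> e = {i, j}" if "e \<in> edges G" for e
    using that by (simp add: G_def edges_complete_on_iff)
  have A_pair: "A {i, j} = closed_segment (f i) (f j)" for i j
    by (simp add: A_def segment_convex_hull)
  have verts: "verts G = V"
    by (simp add: G_def complete_on_def)
  have arc: "arc_between (A e) (f ` e)" if e: "e \<in> edges G" for e
  proof -
    obtain i j where ij: "i \<in> V" "j \<in> V" "i \<noteq> j" "e = {i, j}"
      using edge[OF e] by blast
    then have "f i \<noteq> f j"
      using inj by (auto simp: inj_on_eq_iff)
    then show ?thesis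
      using arc_between_segment ij by (simp add: A_pair)
  qed
  have vertex: "v \<in> e" if e: "e \<in> edges G" and v: "v \<in> V" "f v \<in> A e" for e v
  proof (rule ccontr)
    assume "v \<notin> e"
    obtain i j where ij: "i \<in> V" "j \<in> V" "i \<noteq> j" "e = {i, j}"
      using edge[OF e] by blast
    have "f v \<in> closed_segment (f i) (f j)"
      using v(2) ij A_pair by simp
    from chord_Im[OF this] show False
      using noncol[of i j v] ij v \<open>v \<notin> e\<close> by (auto simp: orient_def)
  qed
  have cross: "\<exists>i\<in>V. \<exists>j\<in>V. \<exists>k\<in>V. \<exists>l\<in>V. e = {i, j} \<and> e' = {k, l} \<and> Im (cnj (f j - f i) * (f l - f k)) \<noteq> 0"
    if e: "e \<in> edges G" "e' \<in> edges G" "e \<noteq> e'" and p: "p \<in> A e" "p \<in> A e'" "p \<notin> f ` V" for e e' p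
  proof -
    obtain i j where ij: "i \<in> V" "j \<in> V" "i \<noteq> j" "e = {i, j}"
      using edge[OF e(1)] by blast
    obtain k l where kl: "k \<in> V" "l \<in> V" "k \<noteq> l" "e' = {k, l}"
      using edge[OF e(2)] by blast
    \<comment> \<open>By noncollinearity, edges with a common end meet only there; so crossing edges
      have four distinct ends, as \<open>crossing_segments_transversal\<close> needs.\<close>
    have disj: "w \<notin> e'" if w: "w \<in> e" for w
    proof
      assume "w \<in> e'"
      obtain a where a: "a \<in> V" "a \<noteq> w" "e = {w, a}"
        using w ij by auto
      obtain b where b: "b \<in> V" "b \<noteq> w" "e' = {w, b}"
        using \<open>w \<in> e'\<close> kl by auto
      have "a \<noteq> b"
        using a(3) b(3) e(3) by blast
      have "w \<in> V"
        using w ij by blast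
      have "orient (f w) (f a) (f b) \<noteq> 0"
        by (rule noncol) (use a b \<open>a \<noteq> b\<close> \<open>w \<in> V\<close> in simp_all)
      moreover have "p \<in> closed_segment (f w) (f a)" "p \<in> closed_segment (f w) (f b)"
        using p a b A_pair by simp_all
      ultimately have "p = f w"
        by (rule segments_meet_at_shared_end)
      then show False
        using p(3) \<open>w \<in> V\<close> by blast
    qed
    then have "i \<noteq> k" "j \<noteq> k"
      using ij kl by auto
    then have "Im (cnj (f j - f i) * (f l - f k)) \<noteq> 0"
      using noncol[of i j k] ij kl p A_pair by (intro crossing_segments_transversal) auto
    then show ?thesis
      using ij kl by blast
  qed
  have finG: "finite (edges G)"
    by (rule finite_subset[of _ "Pow V"]) (auto simp: G_def complete_on_def fin)
  define X where "X e e' = {p. p \<in> A e \<and> p \<in> A e' \<and> p \<notin> f ` V}" for e e'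
  have finX: "finite (X e e')" if e: "e \<in> edges G" "e' \<in> edges G" "e \<noteq> e'" for e e'
  proof (cases "X e e' = {}")
    case False
    then obtain p where p: "p \<in> A e" "p \<in> A e'" "p \<notin> f ` V"
      by (auto simp: X_def)
    obtain i j k l where ijkl: "e = {i, j}" "e' = {k, l}" "Im (cnj (f j - f i) * (f l - f k)) \<noteq> 0"
      using cross[OF e p] by blast
    have "X e e' \<subseteq> {p}"
    proof
      fix q assume "q \<in> X e e'"
      then show "q \<in> {p}"
        using transversal_segments_meet_once[OF ijkl(3), of p q] p ijkl A_pair by (auto simp: X_def)
    qed
    then show ?thesis
      using finite_subset by blast
  qed simp
  have crossings_eq: "crossings G f A = (\<Union>(e, e')\<in>{(e, e'). e \<in> edges G \<and> e' \<in> edges G \<and> e \<noteq> e'}. X e e')"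
    by (auto simp: crossings_def verts X_def)
  have "finite {(e, e'). e \<in> edges G \<and> e' \<in> edges G \<and> e \<noteq> e'}"
    by (rule finite_subset[of _ "edges G \<times> edges G"]) (auto simp: finG)
  then have fin_cross: "finite (crossings G f A)"
    unfolding crossings_eq using finX by (intro finite_UN_I) auto
  have germ: "\<exists>e\<in>edges G. \<exists>e'\<in>edges G. e \<noteq> e' \<and> crossing_germ (A e) (A e') p \<and> {d \<in> edges G. p \<in> A d} = {e, e'}"
    if pc: "p \<in> crossings G f A" for p
  proof -
    obtain e e' where e: "e \<in> edges G" "e' \<in> edges G" "e \<noteq> e'" and p: "p \<in> A e" "p \<in> A e'" "p \<notin> f ` V"
      using pc unfolding crossings_def verts by blast
    obtain i j k l where ijkl: "i \<in> V" "j \<in> V" "k \<in> V" "l \<in> V" "e = {i, j}" "e' = {k, l}" "Im (cnj (f j - f i) * (f l - f k)) \<noteq> 0"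
      using cross[OF e p] by blast
    have ends: "p \<notin> f ` e" "p \<notin> f ` e'"
      using p(3) ijkl by auto
    have seg: "p \<in> closed_segment (f i) (f j)" "p \<in> closed_segment (f k) (f l)"
      using p ijkl A_pair by auto
    have "crossing_germ (A e) (A e') p"
      by (rule arc_between_crossing_germ_cong[OF crossing_germ_lines[OF ijkl(7)] open_UNIV UNIV_I
            arc[OF e(1)] p(1) ends(1) arc[OF e(2)] p(2) ends(2)])
         (use closed_segment_subset_line[OF seg(1)] closed_segment_subset_line[OF seg(2)] ijkl A_pair in auto)
    moreover have "d \<in> {e, e'}" if "d \<in> edges G" "p \<in> A d" for d
      using triple[OF e(1,2) that(1) e(3)] that p by auto
    then have "{d \<in> edges G. p \<in> A d} = {e, e'}"
      using e p by (intro equalityI subsetI) auto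
    ultimately show ?thesis
      using e by (intro bexI[of _ e] bexI[of _ e'] conjI)
  qed
  have "arc_drawing G f A"
    unfolding arc_drawing_def verts
    by (intro conjI ballI impI) (fact inj arc vertex fin_cross germ)+
  then show ?thesis
    unfolding G_def A_def[abs_def] .
qed

lemma exists_general_position:
  assumes "finite V"
  shows "\<exists>f :: 'a \<Rightarrow> complex. general_position V f"
  using assms
proof (induction V)
  case empty
  show ?case
    by (simp add: general_position_def complete_on_def)
next
  case (insert w V)
  then obtain f :: "'a \<Rightarrow> complex" where gp: "general_position V f"
    by blast
  define X where "X = crossings (complete_on V) f (\<lambda>e. convex hull (f ` e))"
  have finX: "finite X"
    using straight_line_drawing[OF insert.hyps(1) gp] by (simp add: arc_drawing_def X_def)
  have X_vertex: "f i \<notin> X" if "i \<in> V" for i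
    using that by (auto simp: X_def crossings_def complete_on_def)
  have inj: "inj_on f V"
    and noncol: "\<And>i j k. \<lbrakk>i \<in> V; j \<in> V; k \<in> V; i \<noteq> j; j \<noteq> k; i \<noteq> k\<rbrakk> \<Longrightarrow> orient (f i) (f j) (f k) \<noteq> 0"
    and triple: "\<And>p e1 e2 e3. \<lbrakk>e1 \<in> edges (complete_on V); e2 \<in> edges (complete_on V); e3 \<in> edges (complete_on V);
      e1 \<noteq> e2; e2 \<noteq> e3; e1 \<noteq> e3; p \<in> convex hull (f ` e1); p \<in> convex hull (f ` e2); p \<in> convex hull (f ` e3)\<rbrakk> \<Longrightarrow> p \<in> f ` V"
    using gp unfolding general_position_def by auto
  \<comment> \<open>The direction 1 is arbitrary: the first family only keeps \<open>q\<close> off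
    the old vertices, which matters when there is just one and no line through two exists. The other
    lines join two vertices, or a vertex and an old crossing.\<close>
  define L where "L = (\<lambda>i. (f i, 1)) ` V \<union> (\<lambda>(i, j). (f i, f j - f i)) ` {(i, j). i \<in> V \<and> j \<in> V \<and> i \<noteq> j}
     \<union> (\<lambda>(i, p). (f i, p - f i)) ` (V \<times> X)"
  have "finite {(i, j). i \<in> V \<and> j \<in> V \<and> i \<noteq> j}"
    by (rule finite_subset[of _ "V \<times> V"]) (auto simp: insert.hyps)
  then have "finite L"
    using insert.hyps(1) finX by (simp add: L_def)
  moreover have "d \<noteq> 0" if "(a, d) \<in> L" for a d
    using that inj X_vertex unfolding L_def by (auto simp: inj_on_eq_iff)
  ultimately obtain q where q: "\<And>a d. (a, d) \<in> L \<Longrightarrow> Im (cnj d * (q - a)) \<noteq> 0"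
    using exists_off_finite_lines by blast
  have q_vertex: "q \<noteq> f i" if "i \<in> V" for i
    using q[of "f i" 1] that by (auto simp: L_def)
  have q_lines: "orient (f i) (f j) q \<noteq> 0" if "i \<in> V" "j \<in> V" "i \<noteq> j" for i j
  proof -
    have "(f i, f j - f i) \<in> L"
      unfolding L_def using that by (intro UnI1 UnI2 image_eqI[of _ _ "(i, j)"]) auto
    then show ?thesis
      unfolding orient_def by (rule q)
  qed
  have q_cross: "orient (f i) p q \<noteq> 0" if "i \<in> V" "p \<in> X" for i p
  proof -
    have "(f i, p - f i) \<in> L"
      unfolding L_def using that by (intro UnI2 image_eqI[of _ _ "(i, p)"]) auto
    then show ?thesis
      unfolding orient_def by (rule q)
  qed
  define f' where "f' = f(w := q)"
  have f': "f' w = q" "\<And>i. i \<in> V \<Longrightarrow> f' i = f i"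
    using insert.hyps(2) by (auto simp: f'_def)
  have noncol': "orient (f' i) (f' j) (f' k) \<noteq> 0"
    if ijk: "i \<in> insert w V" "j \<in> insert w V" "k \<in> insert w V" "i \<noteq> j" "j \<noteq> k" "i \<noteq> k" for i j k
  proof -
    consider "i = w" "j \<in> V" "k \<in> V" | "j = w" "i \<in> V" "k \<in> V" | "k = w" "i \<in> V" "j \<in> V" | "i \<in> V" "j \<in> V" "k \<in> V"
      using ijk by auto
    then show ?thesis
    proof cases
      case 1
      then show ?thesis
        using q_lines[of j k] that f' orient_permute(1)[of "f j" "f k" q] by simp
    next
      case 2
      then show ?thesis
        using q_lines[of k i] that f' orient_permute(1)[of "f i" q "f k"] by simp
    next
      case 3
      then show ?thesis
        using q_lines[of i j] that f' by simp
    next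
      case 4
      then show ?thesis
        using noncol that f' by simp
    qed
  qed
  have edge': "(e \<in> edges (complete_on V) \<and> f' ` e = f ` e) \<or> (\<exists>i\<in>V. e = {w, i} \<and> convex hull (f' ` e) = closed_segment q (f i))"
    if e: "e \<in> edges (complete_on (insert w V))" for e
  proof -
    obtain i j where ij: "i \<in> insert w V" "j \<in> insert w V" "i \<noteq> j" "e = {i, j}"
      using e unfolding edges_complete_on_iff by blast
    then consider "i \<in> V" "j \<in> V" | "i = w" "j \<in> V" | "i \<in> V" "j = w"
      by auto
    then show ?thesis
    proof cases
      case 1
      then show ?thesis
        using ij f'(2) by (auto simp: edges_complete_on_iff)
    next
      case 2
      then show ?thesis
        using ij f' by (intro disjI2 bexI[of _ j]) (auto simp: segment_convex_hull)
    next
      case 3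
      then show ?thesis
        using ij f' by (intro disjI2 bexI[of _ i]) (auto simp: segment_convex_hull insert_commute)
    qed
  qed
  have two_new: "p = q" if "p \<in> closed_segment q (f i)" "p \<in> closed_segment q (f j)" "i \<in> V" "j \<in> V" "i \<noteq> j" for p i j
  proof (rule segments_meet_at_shared_end[OF _ that(1,2)])
    show "orient q (f i) (f j) \<noteq> 0"
      using q_lines[OF that(3-5)] orient_permute(1)[of "f i" "f j" q] by simp
  qed
  have one_new: "p \<in> f' ` insert w V"
    if e: "e2 \<in> edges (complete_on V)" "e3 \<in> edges (complete_on V)" "e2 \<noteq> e3"
      and p: "p \<in> closed_segment q (f i)" "p \<in> convex hull (f ` e2)" "p \<in> convex hull (f ` e3)" and i: "i \<in> V" for p i e2 e3
  proof (rule ccontr)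
    assume "p \<notin> f' ` insert w V"
    then have "p \<notin> f ` V"
      using f'(2) by auto
    then have "p \<in> X"
      unfolding X_def using e p by (intro crossingsI[of _ _ _ e2 e3]) (auto simp: complete_on_def)
    have "p \<in> closed_segment (f i) q"
      using p(1) by (simp add: closed_segment_commute)
    from chord_Im[OF this] have "orient (f i) q p = 0"
      by (simp add: orient_def)
    then show False
      using q_cross[OF i \<open>p \<in> X\<close>] orient_permute(1)[of p q "f i"] orient_permute(2)[of q p "f i"]
        orient_permute(1)[of q p "f i"] by simp
  qed
  have "p \<in> f' ` insert w V"
    if e: "e1 \<in> edges (complete_on (insert w V))" "e2 \<in> edges (complete_on (insert w V))" "e3 \<in> edges (complete_on (insert w V))"
      and ne: "e1 \<noteq> e2" "e2 \<noteq> e3" "e1 \<noteq> e3"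
      and p: "p \<in> convex hull (f' ` e1)" "p \<in> convex hull (f' ` e2)" "p \<in> convex hull (f' ` e3)" for p e1 e2 e3
  proof -
    define old where "old e \<longleftrightarrow> e \<in> edges (complete_on V) \<and> p \<in> convex hull (f ` e)" for e
    define new where "new e \<longleftrightarrow> (\<exists>i\<in>V. e = {w, i} \<and> p \<in> closed_segment q (f i))" for e
    have "old d \<or> new d" if "d \<in> edges (complete_on (insert w V))" "p \<in> convex hull (f' ` d)" for d
      using edge'[OF that(1)] that(2) unfolding old_def new_def by metis
    then have kinds: "old e1 \<or> new e1" "old e2 \<or> new e2" "old e3 \<or> new e3"
      using e p by blast+
    have qV: "q \<in> f' ` insert w V"
      using f'(1) by auto
    \<comment> \<open>A triple is classified by its new edges: two of them meet only in
      \<open>q\<close>, a single one would run through an old crossing, and with none the induction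
      hypothesis applies.\<close>
    have nn: "p \<in> f' ` insert w V" if "new d" "new d'" "d \<noteq> d'" for d d'
      using that two_new qV unfolding new_def by metis
    have noo: "p \<in> f' ` insert w V" if "new d" "old d'" "old d''" "d' \<noteq> d''" for d d' d''
      using that one_new unfolding new_def old_def by metis
    have ooo: "p \<in> f' ` insert w V" if "old e1" "old e2" "old e3"
    proof -
      have "p \<in> f ` V"
        using that ne triple[of e1 e2 e3 p] unfolding old_def by blast
      then show ?thesis
        using f'(2) by force
    qed
    show ?thesis
      using kinds ne nn[of e1 e2] nn[of e1 e3] nn[of e2 e3] noo[of e1 e2 e3] noo[of e2 e1 e3] noo[of e3 e1 e2] ooo by blast
  qed
  moreover have "inj_on f' (insert w V)"
    using inj q_vertex f' insert.hyps(2) unfolding inj_on_def by (metis insertE)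
  ultimately have "general_position (insert w V) f'"
    unfolding general_position_def using noncol' by (intro conjI) auto
  then show ?case
    by blast
qed

section \<open>Counting crossings\<close>

definition clique :: "'a ugraph \<Rightarrow> 'a set \<Rightarrow> bool" where
  "clique G C \<longleftrightarrow> C \<subseteq> verts G \<and> (\<forall>a\<in>C. \<forall>b\<in>C. a \<noteq> b \<longrightarrow> {a, b} \<in> edges G)"

text \<open>Without such a crossing the arcs would form an \<open>embedded_complete_graph\<close> on
  five vertices. The edges found may still be adjacent.\<close>

lemma five_clique_has_crossing:
  fixes G :: "'a::linorder ugraph"
  assumes D: "arc_drawing G f A" and S: "clique G S" "card S = 5"
  obtains p e e' where "p \<in> crossings G f A" "e \<in> edges G" "e' \<in> edges G" "e \<noteq> e'" "e \<subseteq> S" "e' \<subseteq> S" "p \<in> A e" "p \<in> A e'"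
proof (rule ccontr)
  assume no_thesis: "\<not> thesis"
  note crossing_found = that
  have SV: "S \<subseteq> verts G" and edge: "\<And>i j. \<lbrakk>i \<in> S; j \<in> S; i \<noteq> j\<rbrakk> \<Longrightarrow> {i, j} \<in> edges G"
    using S by (auto simp: clique_def)
  have inj: "inj_on f (verts G)"
    and arc: "\<And>e. e \<in> edges G \<Longrightarrow> arc_between (A e) (f ` e)"
    and vertex: "\<And>e v. \<lbrakk>e \<in> edges G; v \<in> verts G; f v \<in> A e\<rbrakk> \<Longrightarrow> v \<in> e"
    using D by (auto simp: arc_drawing_def)
  have "\<exists>g. arc g \<and> path_image g = A {i, j} \<and> pathstart g = f i \<and> pathfinish g = f j"
    if "i \<in> S" "j \<in> S" "i \<noteq> j" for i j
  proof -
    have "arc_between (A {i, j}) {f i, f j}"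
      using arc[OF edge[OF that]] by simp
    then show ?thesis
      using arc_between_oriented by metis
  qed
  then obtain h where h: "\<And>i j. \<lbrakk>i \<in> S; j \<in> S; i \<noteq> j\<rbrakk> \<Longrightarrow>
      arc (h i j) \<and> path_image (h i j) = A {i, j} \<and> pathstart (h i j) = f i \<and> pathfinish (h i j) = f j"
    by metis
  \<comment> \<open>The locale wants \<open>g j i\<close> to be literally the reverse of
    \<open>g i j\<close>; the linear order decides which of the two arcs is the chosen one.\<close>
  define g where "g i j = (if i < j then h i j else reversepath (h j i))" for i j
  have g: "arc (g i j)" "path_image (g i j) = A {i, j}" "pathstart (g i j) = f i" "pathfinish (g i j) = f j"
    if "i \<in> S" "j \<in> S" "i \<noteq> j" for i j
    using h[of i j] h[of j i] that by (auto simp: g_def arc_reversepath insert_commute)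
  interpret embedded_complete_graph S f g
  proof
    show "g j i = reversepath (g i j)" if "i \<in> S" "j \<in> S" "i \<noteq> j" for i j
      using that by (auto simp: g_def)
    show "inj_on f S"
      using inj SV by (rule inj_on_subset)
    show "path_image (g i j) \<inter> path_image (g k l) \<subseteq> f ` ({i, j} \<inter> {k, l})"
      if "i \<in> S" "j \<in> S" "i \<noteq> j" "k \<in> S" "l \<in> S" "k \<noteq> l" "{i, j} \<noteq> {k, l}" for i j k l
    proof
      fix p assume "p \<in> path_image (g i j) \<inter> path_image (g k l)"
      then have p: "p \<in> A {i, j}" "p \<in> A {k, l}"
        using g that by auto
      have "p \<in> f ` verts G"
      proof (rule ccontr)
        assume "p \<notin> f ` verts G"
        then have "p \<in> crossings G f A"
          using edge that p by (intro crossingsI[of _ _ _ "{i, j}" "{k, l}"]) auto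
        then show False
          using no_thesis crossing_found[OF _ edge[OF that(1-3)] edge[OF that(4-6)] that(7) _ _ p] that(1,2,4,5) by simp
      qed
      then obtain w where w: "w \<in> verts G" "p = f w"
        by blast
      then have "w \<in> {i, j}" "w \<in> {k, l}"
        using vertex p edge that by blast+
      then show "p \<in> f ` ({i, j} \<inter> {k, l})"
        using w by blast
    qed
  qed (use g in auto)
  obtain xs where xs: "set xs = S" "distinct xs"
    using S(2) finite_distinct_list card.infinite by (metis zero_neq_numeral)
  then have "length xs = 5"
    using S(2) distinct_card by metis
  then obtain a b c d e where "xs = [a, b, c, d, e]"
    by (auto simp: length_Suc_conv numeral_eq_Suc)
  then show False
    using not_five_vertices[of a b c d e] xs by auto
qed

text \<open>Pairs of edges are counted instead of points because a pair determines four vertices.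
  Ordered pairs lose only a factor 2 and can be summed over their first edge.\<close>

definition crossing_pairs :: "('a ugraph) \<Rightarrow> ('a \<Rightarrow> complex) \<Rightarrow> ('a set \<Rightarrow> complex set) \<Rightarrow> 'a set \<Rightarrow> ('a set \<times> 'a set) set" where
  "crossing_pairs G f A C = {(e, e'). e \<in> edges G \<and> e' \<in> edges G \<and> e \<subseteq> C \<and> e' \<subseteq> C \<and> e \<inter> e' = {} \<and>
     (\<exists>p\<in>crossings G f A. p \<in> A e \<and> p \<in> A e')}"

lemma card_2_memE:
  assumes "card e = 2" "a \<in> e"
  obtains b where "b \<noteq> a" "e = {a, b}"
proof -
  obtain x y where "e = {x, y}" "x \<noteq> y"
    using assms(1) by (auto simp: card_2_iff)
  then show thesis
    using assms(2) that[of x] that[of y] by (cases "a = x") (auto simp: insert_commute)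
qed

text \<open>Two disjoint crossing edges use four of the five vertices, so a 5-subset is recovered
  from such a pair and one remaining vertex; hence the factor \<open>card C\<close>.\<close>

lemma choose_five_le_crossing_pairs:
  fixes G :: "'a::linorder ugraph"
  assumes G: "simple_graph G" and D: "arc_drawing G f A" and C: "clique G C"
    and no_adjacent: "\<And>a b c p. \<lbrakk>a \<in> C; b \<in> C; c \<in> C; distinct [a, b, c]; p \<in> crossings G f A; p \<in> A {a, b}\<rbrakk> \<Longrightarrow> p \<notin> A {c, a}"
  shows "card C choose 5 \<le> card (crossing_pairs G f A C) * card C"
proof -
  have finC: "finite C"
    using C G finite_subset by (auto simp: clique_def simple_graph_def)
  define X where "X = crossing_pairs G f A C"
  have finX: "finite X"
    by (rule finite_subset[of _ "edges G \<times> edges G"]) (auto simp: X_def crossing_pairs_def finite_edges[OF G])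
  have "{S. S \<subseteq> C \<and> card S = 5} \<subseteq> (\<lambda>((e, e'), x). insert x (e \<union> e')) ` (X \<times> C)"
  proof
    fix S assume "S \<in> {S. S \<subseteq> C \<and> card S = 5}"
    then have S: "S \<subseteq> C" "card S = 5"
      by auto
    then have "clique G S"
      using C by (auto simp: clique_def)
    then obtain p e e' where p: "p \<in> crossings G f A" "p \<in> A e" "p \<in> A e'"
      and e: "e \<in> edges G" "e' \<in> edges G" "e \<noteq> e'" "e \<subseteq> S" "e' \<subseteq> S"
      using five_clique_has_crossing[OF D _ S(2)] by metis
    have card2: "card e = 2" "card e' = 2"
      using e G by (auto simp: simple_graph_def)
    have disj: "e \<inter> e' = {}"
    proof (rule ccontr)
      assume "e \<inter> e' \<noteq> {}"
      then obtain a where a: "a \<in> e" "a \<in> e'"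
        by blast
      obtain b where b: "b \<noteq> a" "e = {a, b}"
        using card2(1) a(1) by (rule card_2_memE)
      obtain c where c: "c \<noteq> a" "e' = {c, a}"
        using card2(2) a(2) card_2_memE by (metis insert_commute)
      have "b \<noteq> c"
        using b c e(3) by blast
      then show False
        using no_adjacent[of a b c p] b c p e S by auto
    qed
    have finS: "finite S"
      using S(2) card.infinite by fastforce
    have "finite e" "finite e'"
      using e finS finite_subset by blast+
    then have "card (e \<union> e') = 4"
      using card2 disj by (simp add: card_Un_disjoint)
    then have "card (S - (e \<union> e')) = 1"
      using S(2) e finS by (subst card_Diff_subset) (auto intro: finite_subset)
    then obtain x where x: "S - (e \<union> e') = {x}"
      using card_1_singletonE by blast
    then have "S = insert x (e \<union> e')" "x \<in> C"
      using e S by blast+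
    moreover have "(e, e') \<in> X"
      unfolding X_def crossing_pairs_def using e S disj p by blast
    ultimately show "S \<in> (\<lambda>((e, e'), x). insert x (e \<union> e')) ` (X \<times> C)"
      by (intro image_eqI[of _ _ "((e, e'), x)"]) auto
  qed
  then have "card {S. S \<subseteq> C \<and> card S = 5} \<le> card (X \<times> C)"
    using finX finC by (meson finite_SigmaI surj_card_le)
  then show ?thesis
    using finC by (simp add: n_subsets X_def card_cartesian_product)
qed

text \<open>Only two edges pass through a crossing, so for a fixed first edge the crossing point
  determines the partner, and an edge has no more partners than crossings.\<close>

lemma card_crossing_pairs_le:
  assumes G: "simple_graph G" and D: "arc_drawing G f A" and C: "clique G C"
    and few: "\<And>e. \<lbrakk>e \<in> edges G; e \<subseteq> C\<rbrakk> \<Longrightarrow> card (crossings G f A \<inter> A e) \<le> M"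
  shows "card (crossing_pairs G f A C) \<le> (card C choose 2) * M"
proof -
  have finC: "finite C"
    using C G finite_subset by (auto simp: clique_def simple_graph_def)
  have fin: "finite (crossings G f A)"
    using D by (simp add: arc_drawing_def)
  define E where "E = {e. e \<subseteq> C \<and> card e = 2}"
  define T where "T e = {e'. (e, e') \<in> crossing_pairs G f A C}" for e
  have T: "e \<in> edges G" "e \<subseteq> C" "e' \<in> edges G" "e \<noteq> e'" "\<exists>p\<in>crossings G f A. p \<in> A e \<and> p \<in> A e'"
    if "e' \<in> T e" for e e'
  proof -
    have ee': "e \<in> edges G" "e \<subseteq> C" "e' \<in> edges G" "e \<inter> e' = {}" "\<exists>p\<in>crossings G f A. p \<in> A e \<and> p \<in> A e'"
      using that by (auto simp: T_def crossing_pairs_def)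
    have "card e = 2"
      using ee' G by (auto simp: simple_graph_def)
    then have "e \<noteq> {}"
      by auto
    then show "e \<in> edges G" "e \<subseteq> C" "e' \<in> edges G" "e \<noteq> e'" "\<exists>p\<in>crossings G f A. p \<in> A e \<and> p \<in> A e'"
      using ee' by auto
  qed
  have card_T: "finite (T e) \<and> card (T e) \<le> M" for e
  proof (cases "T e = {}")
    case False
    then have e: "e \<in> edges G" "e \<subseteq> C"
      using T by blast+
    have "\<forall>e'\<in>T e. \<exists>p. p \<in> crossings G f A \<and> p \<in> A e \<and> p \<in> A e'"
      using T(5) by blast
    from bchoice[OF this] obtain r where r: "\<And>e'. e' \<in> T e \<Longrightarrow> r e' \<in> crossings G f A \<and> r e' \<in> A e \<and> r e' \<in> A e'"
      by blast
    have inj: "inj_on r (T e)"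
    proof (rule inj_onI)
      fix d d' assume d: "d \<in> T e" "d' \<in> T e" "r d = r d'"
      have "{c \<in> edges G. r d \<in> A c} = {e, d}"
        using r[OF d(1)] T[OF d(1)] by (intro crossing_edges(1)[OF D]) auto
      moreover have "d' \<in> {c \<in> edges G. r d \<in> A c}"
        using r[OF d(2)] T(3)[OF d(2)] d(3) by simp
      ultimately show "d = d'"
        using T(4)[OF d(2)] by auto
    qed
    have sub: "r ` T e \<subseteq> crossings G f A \<inter> A e"
      using r by blast
    have "finite (crossings G f A \<inter> A e)"
      using fin by simp
    then have "finite (T e)" "card (T e) \<le> card (crossings G f A \<inter> A e)"
      using inj_on_finite[OF inj sub] card_inj_on_le[OF inj sub] by simp_all
    then show ?thesis
      using few[OF e] by simp
  qed simp
  have "crossing_pairs G f A C \<subseteq> Sigma E T"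
    using G by (auto simp: T_def E_def crossing_pairs_def simple_graph_def)
  moreover have finE: "finite E"
    using finC by (simp add: E_def)
  moreover have "finite (Sigma E T)"
    using finE card_T by (intro finite_SigmaI) auto
  ultimately have "card (crossing_pairs G f A C) \<le> card (Sigma E T)"
    by (intro card_mono)
  also have "\<dots> = (\<Sum>e\<in>E. card (T e))"
    using finE card_T by (intro card_SigmaI) auto
  also have "\<dots> \<le> card E * M"
    using card_T sum_bounded_above[of E "\<lambda>e. card (T e)" M] by simp
  also have "card E = card C choose 2"
    using finC by (simp add: E_def n_subsets)
  finally show ?thesis .
qed

text \<open>Bounding the left side by \<open>2 * m ^ 4\<close> and the right side from below by
  \<open>(m / 5) ^ 5\<close> reduces the claim to \<open>2 * 3125 < m\<close>; 7000 is a round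
  number above 6250.\<close>

lemma choose_five_large:
  fixes m :: nat
  assumes "7000 \<le> m"
  shows "(m choose 2) * (2 * m) * m < m choose 5"
proof -
  have "real ((m choose 2) * (2 * m) * m) \<le> real (m ^ 2 * (2 * m) * m)"
    using binomial_le_pow2 binomial_le_pow[of 2 m] assms by (intro of_nat_mono mult_right_mono) auto
  also have "\<dots> = 2 * real m ^ 4"
    by (simp add: power2_eq_square power4_eq_xxxx)
  also have "\<dots> < (real m / 3125) * real m ^ 4"
    using assms by (intro mult_strict_right_mono) auto
  also have "\<dots> = (real m / real 5) ^ 5"
    by (simp add: power_divide eval_nat_numeral)
  also have "\<dots> \<le> real (m choose 5)"
    using assms by (intro binomial_ge_n_over_k_pow_k) auto
  finally show ?thesis
    by (simp only: of_nat_less_iff)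
qed

section \<open>One decreasing move\<close>

lemma clique_delta_Y_graph:
  assumes "clique G C"
  shows "clique (delta_Y_graph G a b c v) (C - {a, b, c})"
  using assms by (auto simp: clique_def delta_Y_graph_def doubleton_eq_iff)

text \<open>The bound on \<open>card (verts G)\<close> turns the price of redrawing, one crossing
  per vertex, into a multiple of the clique size. Natural numbers as vertices provide a fresh vertex
  and a linear order.\<close>

lemma delta_Y_move_decreasing_crossing_number:
  fixes G :: "nat ugraph"
  assumes G: "simple_graph G" and D0: "arc_drawing G f0 A0" and C: "clique G C"
    and large: "7000 \<le> card C" "card (verts G) \<le> 2 * card C"
  obtains a b c v f A where "delta_Y_move G (delta_Y_graph G a b c v)"
    "arc_drawing (delta_Y_graph G a b c v) f A"
    "crossing_number (delta_Y_graph G a b c v) < crossing_number G" "v \<notin> verts G"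
proof -
  obtain f A where D: "arc_drawing G f A" and opt: "card (crossings G f A) = crossing_number G"
    using crossing_number_attained[OF G D0] .
  have fin: "finite (crossings G f A)"
    using D by (simp add: arc_drawing_def)
  have finV: "finite (verts G)"
    using G by (simp add: simple_graph_def)
  then obtain v where v: "v \<notin> verts G"
    using ex_new_if_finite[OF infinite_UNIV_nat] by blast
  have edge: "\<And>i j. \<lbrakk>i \<in> C; j \<in> C; i \<noteq> j\<rbrakk> \<Longrightarrow> {i, j} \<in> edges G"
    using C by (auto simp: clique_def)
  note result = that
  have finish: thesis
    if abc: "a \<in> C" "b \<in> C" "c \<in> C" "distinct [a, b, c]" and D': "arc_drawing (delta_Y_graph G a b c v) f' A'"
      and less: "card (crossings (delta_Y_graph G a b c v) f' A') < card (crossings G f A)" for a b c f' A'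
  proof -
    have move: "delta_Y_move G (delta_Y_graph G a b c v)"
      using abc edge v by (intro delta_Y_move_delta_Y_graph) auto
    have "crossing_number (delta_Y_graph G a b c v) < crossing_number G"
      using crossing_number_le[OF simple_graph_delta_Y_move[OF G move] D'] less opt by simp
    then show thesis
      using result[OF move D'] v by simp
  qed
  show thesis
  proof (cases "\<exists>a\<in>C. \<exists>b\<in>C. \<exists>c\<in>C. \<exists>p\<in>crossings G f A. distinct [a, b, c] \<and> p \<in> A {a, b} \<and> p \<in> A {c, a}")
    case True
    then obtain a b c p where abc: "a \<in> C" "b \<in> C" "c \<in> C" "distinct [a, b, c]"
      and p: "p \<in> crossings G f A" "p \<in> A {a, b}" "p \<in> A {c, a}"
      by blast
    have es: "{a, b} \<in> edges G" "{b, c} \<in> edges G" "{c, a} \<in> edges G"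
      using abc edge by auto
    obtain f' A' where *: "arc_drawing (delta_Y_graph G a b c v) f' A'"
      "crossings (delta_Y_graph G a b c v) f' A' \<subseteq> crossings G f A - {p}"
      using delta_Y_at_crossing[OF G D abc(4) es v p] .
    have "crossings (delta_Y_graph G a b c v) f' A' \<subset> crossings G f A"
      using *(2) p(1) by blast
    then show thesis
      using finish[OF abc *(1)] psubset_card_mono[OF fin] by blast
  next
    case no_adjacent: False
    show thesis
    proof (cases "\<exists>e\<in>edges G. e \<subseteq> C \<and> card (verts G) < card (crossings G f A \<inter> A e)")
      case True
      then obtain e where e: "e \<in> edges G" "e \<subseteq> C" "card (verts G) < card (crossings G f A \<inter> A e)"
        by blast
      have "card e = 2"
        using e G by (auto simp: simple_graph_def)
      then obtain x y where xy: "e = {x, y}" "x \<noteq> y"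
        by (auto simp: card_2_iff)
      have "\<not> C \<subseteq> {x, y}"
        using large(1) card_mono[of "{x, y}" C] xy by auto
      then obtain c where c: "c \<in> C" "c \<noteq> x" "c \<noteq> y"
        by blast
      have cxy: "c \<in> C" "x \<in> C" "y \<in> C" "distinct [c, x, y]"
        using c xy e by auto
      have es: "{c, x} \<in> edges G" "{x, y} \<in> edges G" "{y, c} \<in> edges G"
        using cxy edge by auto
      obtain f' A' where *: "arc_drawing (delta_Y_graph G c x y v) f' A'"
        "card (crossings (delta_Y_graph G c x y v) f' A') \<le> card (crossings G f A - A {x, y}) + card (verts G)"
        using delta_Y_near_vertex[OF G D cxy(4) es v] .
      \<comment> \<open>More than \<open>card (verts G)\<close> crossings vanish with
        \<open>e\<close>, and at most that many are created.\<close>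
      have "card (crossings G f A) = card (crossings G f A - A e) + card (crossings G f A \<inter> A e)"
        using fin by (metis Int_Diff_Un Int_Diff_disjoint add.commute card_Un_disjoint finite_Diff finite_Int)
      then show thesis
        using finish[OF cxy *(1)] *(2) e(3) xy by simp
    next
      case False
      \<comment> \<open>If every clique edge had at most \<open>card (verts G)\<close> crossings,
        the lower and upper counts of crossing pairs would contradict each other.\<close>
      have "card C choose 5 \<le> card (crossing_pairs G f A C) * card C"
        by (rule choose_five_le_crossing_pairs[OF G D C]) (use no_adjacent in blast)
      also have "\<dots> \<le> (card C choose 2) * card (verts G) * card C"
        using False by (intro mult_right_mono card_crossing_pairs_le[OF G D C]) force+
      also have "\<dots> \<le> (card C choose 2) * (2 * card C) * card C"
        using large(2) by (intro mult_right_mono mult_left_mono) auto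
      also have "\<dots> < card C choose 5"
        using choose_five_large[OF large(1)] .
      finally show thesis
        by simp
    qed
  qed
qed

section \<open>Iterating the decreasing move\<close>

theorem theorem3:
  fixes k :: nat
  shows "\<exists>(n::nat) (G :: nat \<Rightarrow> nat ugraph).
           G 0 = complete_graph n \<and>
           (\<forall>i<k. delta_Y_move (G i) (G (Suc i))) \<and>
           (\<forall>i<k. crossing_number (G i) > crossing_number (G (Suc i)))"
proof -
  \<comment> \<open>Before move number \<open>i\<close>, counted from 0, the clique has at least
    \<open>n - 3 * i\<close> vertices and the graph \<open>n + i\<close>. The move needs
    \<open>7000 \<le> n - 3 * i\<close> and \<open>n + i \<le> 2 * (n - 3 * i)\<close>, that is
    \<open>7 * i \<le> n\<close>; for \<open>i < k\<close> the summand \<open>10 * k\<close> covers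
    both.\<close>
  define n where "n = 7000 + 10 * k"
  \<comment> \<open>The invariant includes a drawing because the next move starts from an optimal
    one, which exists only if some drawing does.\<close>
  define good where "good i G \<longleftrightarrow> simple_graph G \<and> (\<exists>f A. arc_drawing G f A) \<and> card (verts G) = n + i \<and>
    (\<exists>C. clique G C \<and> n \<le> card C + 3 * i)" for i and G :: "nat ugraph"
  have start: "good 0 (complete_graph n)"
  proof -
    have eq: "complete_graph n = complete_on {1..n}"
      by (simp add: complete_graph_def complete_on_def)
    obtain f :: "nat \<Rightarrow> complex" where "general_position {1..n} f"
      using exists_general_position[of "{1..n}"] by blast
    then have "\<exists>f A. arc_drawing (complete_graph n) f A"
      unfolding eq using straight_line_drawing[of "{1..n}" f] by blast
    moreover have "clique (complete_graph n) {1..n}"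
      by (auto simp: clique_def complete_graph_def)
    ultimately show ?thesis
      unfolding good_def using simple_graph_complete_graph by (auto simp: complete_graph_def intro: exI[of _ "{1..n}"])
  qed
  have step: "\<exists>H. good (Suc i) H \<and> delta_Y_move G H \<and> crossing_number H < crossing_number G"
    if i: "i < k" and good: "good i G" for i G
  proof -
    obtain f A C where G: "simple_graph G" and D: "arc_drawing G f A" and V: "card (verts G) = n + i"
      and C: "clique G C" "n \<le> card C + 3 * i"
      using good unfolding good_def by blast
    have large: "7000 \<le> card C" "card (verts G) \<le> 2 * card C"
      using C(2) V i by (auto simp: n_def)
    obtain a b c v f' A' where H: "delta_Y_move G (delta_Y_graph G a b c v)"
      "arc_drawing (delta_Y_graph G a b c v) f' A'"
      "crossing_number (delta_Y_graph G a b c v) < crossing_number G" "v \<notin> verts G"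
      using delta_Y_move_decreasing_crossing_number[OF G D C(1) large] .
    have "card (verts (delta_Y_graph G a b c v)) = n + Suc i"
      using H(4) V G by (simp add: delta_Y_graph_def simple_graph_def)
    moreover have "card C - card {a, b, c} \<le> card (C - {a, b, c})"
      by (intro diff_card_le_card_Diff) simp
    then have "n \<le> card (C - {a, b, c}) + 3 * Suc i"
      using C(2) card_insert_le_m1[of 3 "{b, c}" a] card_insert_le_m1[of 2 "{c}" b] by (simp add: card_insert_if split: if_splits)
    ultimately have "good (Suc i) (delta_Y_graph G a b c v)"
      unfolding good_def using simple_graph_delta_Y_move[OF G H(1)] H(2) clique_delta_Y_graph[OF C(1)] by blast
    then show ?thesis
      using H by blast
  qed
  \<comment> \<open>Dependent choice yields an infinite sequence, so the conditions are guarded by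
    \<open>k\<close>; beyond it the graphs are arbitrary.\<close>
  have "\<exists>G. \<forall>i. ((i \<le> k \<longrightarrow> good i (G i)) \<and> (i = 0 \<longrightarrow> G i = complete_graph n)) \<and>
      (i < k \<longrightarrow> delta_Y_move (G i) (G (Suc i)) \<and> crossing_number (G (Suc i)) < crossing_number (G i))"
  proof (rule dependent_nat_choice)
    show "\<exists>G. (0 \<le> k \<longrightarrow> good 0 G) \<and> ((0::nat) = 0 \<longrightarrow> G = complete_graph n)"
      using start by blast
    show "\<exists>H. ((Suc i \<le> k \<longrightarrow> good (Suc i) H) \<and> (Suc i = 0 \<longrightarrow> H = complete_graph n)) \<and>
        (i < k \<longrightarrow> delta_Y_move G H \<and> crossing_number H < crossing_number G)"
      if "(i \<le> k \<longrightarrow> good i G) \<and> (i = 0 \<longrightarrow> G = complete_graph n)" for G i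
      using step[of i G] that by (cases "i < k") auto
  qed
  then show ?thesis
    by blast
qed

end
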